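(* Let $d\ge2$, let $X_n$ be finite $(d-1)$-connected uniform $d$-complexes and $X$ a countable $(d-1)$-connected uniform $d$-complex, all with $(d-1)$-degrees bounded by a common constant, such that $X_n\to X$. Suppose one of the following holds: (1) $0\notin\operatorname{Spec}(\Delta^+_X|_{Z_{d-1}(X)})$, i.e. $\lambda(X)\neq0$; (2) $0$ is a non-isolated point of $\operatorname{Spec}(\Delta^+_X|_{Z_{d-1}(X)})$; (3) the $(d-2)$-cells of all $X_n$ have degrees bounded by a common constant, and $\inf_n\lambda_{d-2}(X_n)>0$. Then $\liminf_{n\to\infty}\lambda(X_n)\le\lambda(X)$.
   Context: A simplicial complex is a collection of finite subsets (cells) of a vertex set closed under taking subsets (the empty set is a cell); a $j$-cell has $j+1$ vertices; $X^j$ is the set of $j$-cells; the degree $\deg\sigma$ of a $j$-cell is the number of $(j+1)$-cells containing it; a $d$-complex has maximal cell dimension $d$ and is uniform if every cell lies in a $d$-cell. For $j\ge1$ each $j$-cell has two orientations (orderings of its vertices modulo even permutations); $X^j_\pm$ is the set of oriented $j$-cells, $\bar\sigma$ the opposite orientation. The oriented cell $[v_0,\dots,v_j]$ induces on its face $\{v_0,\dots,v_j\}\setminus\{v_i\}$ the orientation $(-1)^i[v_0,\dots,\widehat{v_i},\dots,v_j]$ ($-1$ meaning reversal). For $v\notin\sigma$ write $v\triangleleft\sigma$ if $\sigma\cup\{v\}\in X$, and $v\sigma=[v,\sigma_0,\dots,\sigma_k]$ for $\sigma=[\sigma_0,\dots,\sigma_k]$. $\Omega^j(X)$ is the space of real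 functions $f$ on $X^j_\pm$ with $f(\bar\sigma)=-f(\sigma)$ ($j=0$: functions on vertices; $j=-1$: functions on $\{\emptyset\}$). Two oriented $(d-1)$-cells are neighbours, $\sigma\sim\sigma'$, if some oriented $d$-cell $\tau$ has both $\sigma$ and $\overline{\sigma'}$ as faces with the induced orientations; $X$ is $(d-1)$-connected if any two oriented $(d-1)$-cells are joined by a chain of neighbours. Norms: on $\Omega^{d-1}$, $\|f\|^2=\sum_{\sigma\in X^{d-1}}f(\sigma)^2/\deg\sigma$; on $\Omega^k$, $k\neq d-1$, $\|f\|^2=\sum_{\sigma\in X^k}f(\sigma)^2$; $\Omega^k_{L^2}$ denotes the forms of finite norm. Boundary $\partial_k:\Omega^k\to\Omega^{k-1}$, $(\partial_kf)(\sigma)=\sum_{v\triangleleft\sigma}f(v\sigma)$. Coboundary (pointwise), writing $\sigma\setminus\sigma_i=[\sigma_0,\dots,\widehat{\sigma_i},\dots,\sigma_k]$: $(\delta_{d-1}f)(\sigma)=\deg\sigma\sum_{i=0}^{d-1}(-1)^if(\sigma\setminus\sigma_i)$ for $f\in\Omega^{d-2}$, and $(\delta_df)(\sigma)=\sum_{i=0}^d(-1)^if(\sigma\setminus\sigma_i)/\deg(\sigma\setminus\sigma_i)$. Upper Laplacian $\Delta^+_X=\partial_d\delta_d$ on $\Omega^{d-1}_{L^2}$: $(\Delta^+f)(\sigma)=f(\sigma)-\sum_{\sigma'\sim\sigma}f(\sigma')/\deg\sigma'$. $B^{d-1}(X)=\{\delta_{d-1}f:f\in\Omega^{d-2}_{L^2}\}\cap\Omega^{d-1}_{L^2}$,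 $Z_{d-1}(X)=(B^{d-1})^\perp$ (a $\Delta^+$-invariant subspace of $\Omega^{d-1}_{L^2}$; for finite $X$ it equals $\ker\partial_{d-1}$), and the spectral gap is $\lambda(X)=\min\operatorname{Spec}(\Delta^+_X|_{Z_{d-1}(X)})$. For a finite complex $Y$, $\lambda_{d-2}(Y)=\min\operatorname{Spec}\big(\partial_{d-1}\delta_{d-1}|_{\ker\partial_{d-2}}\big)$, where $\partial_{d-1}\delta_{d-1}$ acts on $\Omega^{d-2}(Y)$. The distance between $(d-1)$-cells $\sigma,\sigma'$ is the minimal $n$ such that there are $(d-1)$-cells $\sigma=\tau_0,\dots,\tau_n=\sigma'$ with $\tau_i\cup\tau_{i+1}\in X^d$. The ball $B_R(X,\sigma)$ is the subcomplex consisting of the $(d-1)$-cells at distance $\le R$ from $\sigma$, the $d$-cells all of whose $(d-1)$-faces are at distance $\le R$, and all subsets of these. $X_n\to X$ means: there are $\sigma_n\in X_n^{d-1}$, $\sigma\in X^{d-1}$ such that for every $R$ there is $N$ such that for $n\ge N$ there is a simplicial isomorphism $B_R(X_n,\sigma_n)\to B_R(X,\sigma)$ sending $\sigma_n$ to $\sigma$. *)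

theory Defs
  imports "HOL-Analysis.Analysis" "HOL-Combinatorics.Permutations"
begin

text \<open>Conventions. A simplicial complex is a set X of finite vertex sets closed under subsets.
  Cells are indexed by their NUMBER OF VERTICES: cells X k is the set of (k-1)-cells.
  Oriented cells are lists of distinct vertices (orderings); two orderings give the same
  orientation iff they differ by an even permutation. A k-form (k vertices) is a real
  function on lists, supported on oriented cells, changing sign under a transposition.\<close>

definition simp_complex :: "'v set set \<Rightarrow> bool" where
  "simp_complex X \<longleftrightarrow> {} \<in> X \<and> (\<forall>s\<in>X. finite s) \<and> (\<forall>s\<in>X. \<forall>t. t \<subseteq> s \<longrightarrow> t \<in> X)"

definition cells :: "'v set set \<Rightarrow> nat \<Rightarrow> 'v set set" where
  "cells X k = {s \<in> X. card s = k}"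

definition dim_complex :: "'v set set \<Rightarrow> nat \<Rightarrow> bool" where
  "dim_complex X d \<longleftrightarrow> simp_complex X \<and> (\<forall>s\<in>X. card s \<le> d + 1) \<and> cells X (d + 1) \<noteq> {}"

definition uniform :: "'v set set \<Rightarrow> nat \<Rightarrow> bool" where
  "uniform X d \<longleftrightarrow> (\<forall>s\<in>X. \<exists>t\<in>cells X (d + 1). s \<subseteq> t)"

definition cofaces :: "'v set set \<Rightarrow> 'v set \<Rightarrow> 'v set set" where
  "cofaces X s = {t \<in> X. s \<subseteq> t \<and> card t = card s + 1}"

definition deg :: "'v set set \<Rightarrow> 'v set \<Rightarrow> nat" where
  "deg X s = card (cofaces X s)"

definition deg_bounded :: "'v set set \<Rightarrow> nat \<Rightarrow> nat \<Rightarrow> bool" where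
  "deg_bounded X k K \<longleftrightarrow> (\<forall>s\<in>cells X k. finite (cofaces X s) \<and> card (cofaces X s) \<le> K)"

definition ocell :: "'v set set \<Rightarrow> nat \<Rightarrow> 'v list \<Rightarrow> bool" where
  "ocell X k xs \<longleftrightarrow> distinct xs \<and> length xs = k \<and> set xs \<in> X"

definition lswap :: "'v list \<Rightarrow> nat \<Rightarrow> nat \<Rightarrow> 'v list" where
  "lswap xs i j = xs[i := xs ! j, j := xs ! i]"

definition is_form :: "'v set set \<Rightarrow> nat \<Rightarrow> ('v list \<Rightarrow> real) \<Rightarrow> bool" where
  "is_form X k f \<longleftrightarrow> (\<forall>xs. f xs \<noteq> 0 \<longrightarrow> ocell X k xs) \<and>
     (\<forall>xs i j. i < length xs \<and> j < length xs \<and> i \<noteq> j \<longrightarrow> f (lswap xs i j) = - f xs)"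

definition cellrep :: "'v set \<Rightarrow> 'v list" where
  "cellrep s = (SOME xs. distinct xs \<and> set xs = s)"

definition ldel :: "nat \<Rightarrow> 'v list \<Rightarrow> 'v list" where
  "ldel i xs = take i xs @ drop (Suc i) xs"

definition inner_w :: "'v set set \<Rightarrow> nat \<Rightarrow> ('v list \<Rightarrow> real) \<Rightarrow> ('v list \<Rightarrow> real) \<Rightarrow> real" where
  "inner_w X d f g = infsum (\<lambda>s. f (cellrep s) * g (cellrep s) / real (deg X s)) (cells X d)"

definition norm_w :: "'v set set \<Rightarrow> nat \<Rightarrow> ('v list \<Rightarrow> real) \<Rightarrow> real" where
  "norm_w X d f = sqrt (infsum (\<lambda>s. (f (cellrep s))\<^sup>2 / real (deg X s)) (cells X d))"

definition L2w :: "'v set set \<Rightarrow> nat \<Rightarrow> ('v list \<Rightarrow> real) set" where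
  "L2w X d = {f. is_form X d f \<and> (\<lambda>s. (f (cellrep s))\<^sup>2 / real (deg X s)) summable_on cells X d}"

definition norm_u :: "'v set set \<Rightarrow> nat \<Rightarrow> ('v list \<Rightarrow> real) \<Rightarrow> real" where
  "norm_u X k f = sqrt (infsum (\<lambda>s. (f (cellrep s))\<^sup>2) (cells X k))"

definition L2u :: "'v set set \<Rightarrow> nat \<Rightarrow> ('v list \<Rightarrow> real) set" where
  "L2u X k = {f. is_form X k f \<and> (\<lambda>s. (f (cellrep s))\<^sup>2) summable_on cells X k}"

definition bd :: "'v set set \<Rightarrow> ('v list \<Rightarrow> real) \<Rightarrow> 'v list \<Rightarrow> real" where
  "bd X f xs = (if ocell X (length xs) xs
     then (\<Sum>v\<in>{v. v \<notin> set xs \<and> insert v (set xs) \<in> X}. f (v # xs)) else 0)"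

definition delta1 :: "'v set set \<Rightarrow> nat \<Rightarrow> ('v list \<Rightarrow> real) \<Rightarrow> 'v list \<Rightarrow> real" where
  "delta1 X d g xs = (if ocell X d xs
     then real (deg X (set xs)) * (\<Sum>i<d. (-1) ^ i * g (ldel i xs)) else 0)"

definition delta2 :: "'v set set \<Rightarrow> nat \<Rightarrow> ('v list \<Rightarrow> real) \<Rightarrow> 'v list \<Rightarrow> real" where
  "delta2 X d f xs = (if ocell X (d + 1) xs
     then (\<Sum>i<d+1. (-1) ^ i * f (ldel i xs) / real (deg X (set (ldel i xs)))) else 0)"

definition upper_lap :: "'v set set \<Rightarrow> nat \<Rightarrow> ('v list \<Rightarrow> real) \<Rightarrow> 'v list \<Rightarrow> real" where
  "upper_lap X d f = bd X (delta2 X d f)"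

definition Bspace :: "'v set set \<Rightarrow> nat \<Rightarrow> ('v list \<Rightarrow> real) set" where
  "Bspace X d = {delta1 X d g | g. g \<in> L2u X (d - 1)} \<inter> L2w X d"

definition Zspace :: "'v set set \<Rightarrow> nat \<Rightarrow> ('v list \<Rightarrow> real) set" where
  "Zspace X d = {f \<in> L2w X d. \<forall>b\<in>Bspace X d. inner_w X d f b = 0}"

definition spec_on :: "('a \<Rightarrow> real) set \<Rightarrow> (('a \<Rightarrow> real) \<Rightarrow> 'a \<Rightarrow> real)
     \<Rightarrow> (('a \<Rightarrow> real) \<Rightarrow> real) \<Rightarrow> real set" where
  "spec_on Z T nrm = {mu. \<not> (\<exists>S. (\<forall>f\<in>Z. S f \<in> Z
        \<and> S (\<lambda>x. T f x - mu * f x) = f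
        \<and> (\<lambda>x. T (S f) x - mu * S f x) = f)
      \<and> (\<exists>C. \<forall>f\<in>Z. nrm (S f) \<le> C * nrm f))}"

definition spec_Z :: "'v set set \<Rightarrow> nat \<Rightarrow> real set" where
  "spec_Z X d = spec_on (Zspace X d) (upper_lap X d) (norm_w X d)"

definition spectral_gap :: "'v set set \<Rightarrow> nat \<Rightarrow> real" where
  "spectral_gap X d = Inf (spec_Z X d)"

text \<open>lambda_{d-2}(Y) for finite Y: min Spec of bd delta_{d-1} on ker bd_{d-2}
  inside the (d-2)-forms ((d-1)-vertex forms).\<close>
definition lambda_low :: "'v set set \<Rightarrow> nat \<Rightarrow> real" where
  "lambda_low Y d = Inf (spec_on {g. is_form Y (d - 1) g \<and> bd Y g = (\<lambda>_. 0)}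
       (\<lambda>g. bd Y (delta1 Y d g)) (norm_u Y (d - 1)))"

definition perm_rel :: "'v list \<Rightarrow> 'v list \<Rightarrow> bool \<Rightarrow> bool" where
  "perm_rel xs ys b \<longleftrightarrow> (\<exists>p. p permutes {..<length xs}
      \<and> ys = map (\<lambda>i. xs ! p i) [0..<length xs] \<and> evenperm p = b)"

text \<open>Neighbours among oriented (d-1)-cells: some oriented d-cell tau has xs and the
  reverse of ys as faces with the induced orientation ((-1)^i on face i).\<close>
definition nbr :: "'v set set \<Rightarrow> nat \<Rightarrow> 'v list \<Rightarrow> 'v list \<Rightarrow> bool" where
  "nbr X d xs ys \<longleftrightarrow> ocell X d xs \<and> ocell X d ys \<and>
     (\<exists>tau. ocell X (d + 1) tau \<and> (\<exists>i<d+1. \<exists>j<d+1.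
        perm_rel (ldel i tau) xs (even i) \<and> perm_rel (ldel j tau) ys (\<not> even j)))"

definition codim1_connected :: "'v set set \<Rightarrow> nat \<Rightarrow> bool" where
  "codim1_connected X d \<longleftrightarrow>
     (\<forall>xs ys. ocell X d xs \<and> ocell X d ys \<longrightarrow> (nbr X d)\<^sup>*\<^sup>* xs ys)"

definition adjc :: "'v set set \<Rightarrow> nat \<Rightarrow> 'v set \<Rightarrow> 'v set \<Rightarrow> bool" where
  "adjc X d s t \<longleftrightarrow> s \<in> cells X d \<and> t \<in> cells X d \<and> s \<union> t \<in> cells X (d + 1)"

definition dist_le :: "'v set set \<Rightarrow> nat \<Rightarrow> nat \<Rightarrow> 'v set \<Rightarrow> 'v set \<Rightarrow> bool" where
  "dist_le X d R s t \<longleftrightarrow> s \<in> cells X d \<and> t \<in> cells X d \<and> (\<exists>m\<le>R. (adjc X d ^^ m) s t)"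

definition ball :: "'v set set \<Rightarrow> nat \<Rightarrow> nat \<Rightarrow> 'v set \<Rightarrow> 'v set set" where
  "ball X d R c = {u. \<exists>t. u \<subseteq> t \<and>
     ((t \<in> cells X d \<and> dist_le X d R c t) \<or>
      (t \<in> cells X (d + 1) \<and> (\<forall>s. s \<subseteq> t \<and> card s = d \<longrightarrow> dist_le X d R c s)))}"

definition simp_iso :: "'a set set \<Rightarrow> 'b set set \<Rightarrow> ('a \<Rightarrow> 'b) \<Rightarrow> bool" where
  "simp_iso A B phi \<longleftrightarrow> bij_betw phi (\<Union>A) (\<Union>B) \<and>
     (\<forall>u. u \<subseteq> \<Union>A \<longrightarrow> (u \<in> A \<longleftrightarrow> phi ` u \<in> B))"

definition converges_to :: "(nat \<Rightarrow> 'a set set) \<Rightarrow> 'b set set \<Rightarrow> nat \<Rightarrow> bool" where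
  "converges_to Xs X d \<longleftrightarrow> (\<exists>sn s. (\<forall>n. sn n \<in> cells (Xs n) d) \<and> s \<in> cells X d \<and>
     (\<forall>R. \<exists>N. \<forall>n\<ge>N. \<exists>phi. simp_iso (ball (Xs n) d R (sn n)) (ball X d R s) phi
          \<and> phi ` (sn n) = s))"

end

theory Submission
  imports Defs
begin

text \<open>
  Write \<open>\<lambda>'\<close> for a point of the spectrum of the upper Laplacian on \<open>Z(X)\<close>. Since the Laplacian is bounded
  and self-adjoint, \<open>\<lambda>'\<close> has approximate eigenforms in \<open>Z(X)\<close>; cutting one off at a large radius gives a
  form \<open>f\<close> supported in a ball, which the ball isomorphism transplants isometrically to \<open>X\<^sub>n\<close>, commuting
  with the Laplacian. The cut-off leaves \<open>Z\<close>, and this is repaired in one of two ways.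

  If \<open>\<lambda>' > 0\<close>, replace \<open>f\<close> by its Laplacian: it is a boundary, hence its transplant lies in \<open>Z(X\<^sub>n)\<close>, it has
  norm about \<open>\<lambda>' \<parallel>f\<parallel>\<close>, and its Rayleigh quotient is close to \<open>\<lambda>'\<close>. This settles cases (1) and (2).

  If \<open>\<lambda>' = 0\<close> in case (3), invertibility of \<open>\<partial>\<delta>\<close> on \<open>ker \<partial>\<close> yields \<open>g\<close> on \<open>X\<^sub>n\<close> such that
  (transplant of \<open>f\<close>) \<open>- \<delta> g\<close> lies in \<open>Z(X\<^sub>n)\<close> and \<open>\<parallel>g\<parallel>\<close> is at most a constant times \<open>\<parallel>\<delta> g\<parallel>\<close>. Moving \<open>g\<close> back
  to \<open>X\<close> and pairing with the original form, which is orthogonal to all coboundaries, shows that \<open>\<delta> g\<close> is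
  small; as the Laplacian kills \<open>\<delta> g\<close>, the Rayleigh quotient stays small.
\<close>

section \<open>Bounded positive operators on Hilbert spaces of functions\<close>

text \<open>The spectrum is defined by invertibility on \<open>Z\<close>, so two bridges to
  estimates are needed. A symmetric operator that is bounded below is invertible, which turns a
  spectral value of \<open>X\<close> into approximate eigenforms. The infimum of the Rayleigh
  quotients is itself a spectral value, which turns one test form on a finite complex into an upper
  bound for its gap.

  The obstacle is that membership of \<open>Z\<close> is a global condition: a cut-off form is no
  longer orthogonal to the coboundaries, and neither is its transplant. Applying the Laplacian
  repairs this but gives no control of the norm at the spectral value 0, so 0 needs separate
  hypotheses. A non-isolated 0 is reached through positive spectral values. Otherwise the correcting
  coboundary must be bounded on \<open>X\<close>, where no degree bound for (d-2)-cells is given; it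
  is inherited from the approximating complexes, because finitely many cofaces of a cell lie in one
  ball.

  The weight \<open>1 / deg\<close> on (d-1)-forms bounds the Laplacian by d+1, whatever the degrees
  are.\<close>

locale psd_form =
  fixes V :: "('a \<Rightarrow> real) set" and B :: "('a \<Rightarrow> real) \<Rightarrow> ('a \<Rightarrow> real) \<Rightarrow> real"
  assumes zero_mem: "(\<lambda>_. 0) \<in> V"
    and lin_mem: "f \<in> V \<Longrightarrow> g \<in> V \<Longrightarrow> (\<lambda>x. a * f x + b * g x) \<in> V"
    and form_lin: "f \<in> V \<Longrightarrow> g \<in> V \<Longrightarrow> h \<in> V \<Longrightarrow>
      B (\<lambda>x. a * f x + b * g x) h = a * B f h + b * B g h"
    and form_sym: "f \<in> V \<Longrightarrow> g \<in> V \<Longrightarrow> B f g = B g f"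
    and form_nonneg: "f \<in> V \<Longrightarrow> 0 \<le> B f f"
begin

lemma diff_mem: "f \<in> V \<Longrightarrow> g \<in> V \<Longrightarrow> (\<lambda>x. f x - g x) \<in> V"
  using lin_mem[of f g 1 "-1"] by simp

lemma shift_mem: "f \<in> V \<Longrightarrow> g \<in> V \<Longrightarrow> (\<lambda>x. f x - b * g x) \<in> V"
  using lin_mem[of f g 1 "-b"] by simp

lemma form_lin_right:
  "f \<in> V \<Longrightarrow> g \<in> V \<Longrightarrow> h \<in> V \<Longrightarrow> B h (\<lambda>x. a * f x + b * g x) = a * B h f + b * B h g"
  using form_lin[of f g h a b] form_sym[of h] lin_mem[of f g a b] by simp

lemma form_diff_left:
  "f \<in> V \<Longrightarrow> g \<in> V \<Longrightarrow> h \<in> V \<Longrightarrow> B (\<lambda>x. f x - b * g x) h = B f h - b * B g h"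
  using form_lin[of f g h 1 "-b"] by simp

lemma form_diff_right:
  "f \<in> V \<Longrightarrow> g \<in> V \<Longrightarrow> h \<in> V \<Longrightarrow> B h (\<lambda>x. f x - b * g x) = B h f - b * B h g"
  using form_lin_right[of f g h 1 "-b"] by simp

lemma form_diff_self:
  assumes "f \<in> V" "g \<in> V"
  shows "B (\<lambda>x. f x - b * g x) (\<lambda>x. f x - b * g x) = B f f - 2 * b * B f g + b\<^sup>2 * B g g"
  using assms form_sym[of g f]
  by (simp add: form_diff_left form_diff_right shift_mem algebra_simps power2_eq_square)

lemma cauchy_schwarz:
  assumes f: "f \<in> V" and g: "g \<in> V"
  shows "(B f g)\<^sup>2 \<le> B f f * B g g"
proof (cases "B g g = 0")
  case True
  \<comment> \<open>With \<open>B g g = 0\<close> the quadratic in \<open>b\<close> degenerates to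
    an affine function, which is nonnegative everywhere only if its slope vanishes. The
    \<open>b\<close> inserted below would give it the value -1.\<close>
  have nonneg: "0 \<le> B f f - 2 * b * B f g" for b
    using form_diff_self[OF f g, of b] form_nonneg[OF shift_mem[OF f g, of b]] True by simp
  have "B f g = 0"
  proof (rule ccontr)
    assume "B f g \<noteq> 0"
    then show False
      using nonneg[of "(B f f + 1) / (2 * B f g)"] by simp
  qed
  then show ?thesis using True by simp
next
  case False
  then have pos: "B g g > 0" using form_nonneg[OF g] by simp
  \<comment> \<open>\<open>B f g / B g g\<close> is the value of \<open>b\<close> that minimises the
    quadratic.\<close>
  have "0 \<le> B f f - 2 * (B f g / B g g) * B f g + (B f g / B g g)\<^sup>2 * B g g"
    using form_diff_self[OF f g] form_nonneg[OF shift_mem[OF f g]] by metis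
  also have "\<dots> = B f f - (B f g)\<^sup>2 / B g g"
    using pos by (simp add: field_simps power2_eq_square)
  finally show ?thesis using pos by (simp add: field_simps)
qed

lemma cauchy_schwarz_sqrt:
  assumes "f \<in> V" "g \<in> V"
  shows "\<bar>B f g\<bar> \<le> sqrt (B f f) * sqrt (B g g)"
  using real_sqrt_le_mono[OF cauchy_schwarz[OF assms]] by (simp add: real_sqrt_mult)

lemma seminorm_triangle:
  assumes f: "f \<in> V" and g: "g \<in> V"
  shows "sqrt (B (\<lambda>x. f x - b * g x) (\<lambda>x. f x - b * g x)) \<le> sqrt (B f f) + \<bar>b\<bar> * sqrt (B g g)"
proof -
  have "- (2 * b * B f g) \<le> 2 * \<bar>b\<bar> * \<bar>B f g\<bar>"
    by (metis abs_ge_minus_self abs_mult abs_numeral)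
  also have "\<dots> \<le> 2 * \<bar>b\<bar> * (sqrt (B f f) * sqrt (B g g))"
    using cauchy_schwarz_sqrt[OF f g] by (intro mult_left_mono) auto
  finally have "B (\<lambda>x. f x - b * g x) (\<lambda>x. f x - b * g x)
      \<le> B f f + 2 * \<bar>b\<bar> * (sqrt (B f f) * sqrt (B g g)) + b\<^sup>2 * B g g"
    using form_diff_self[OF f g, of b] by simp
  also have "\<dots> = (sqrt (B f f) + \<bar>b\<bar> * sqrt (B g g))\<^sup>2"
    using form_nonneg[OF f] form_nonneg[OF g] by (simp add: power2_sum power_mult_distrib algebra_simps)
  finally show ?thesis
    using form_nonneg f g by (intro real_le_lsqrt) auto
qed

lemma seminorm_triangle_reverse:
  assumes f: "f \<in> V" and g: "g \<in> V"
  shows "sqrt (B f f) - \<bar>b\<bar> * sqrt (B g g) \<le> sqrt (B (\<lambda>x. f x - b * g x) (\<lambda>x. f x - b * g x))"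
  using seminorm_triangle[OF shift_mem[OF f g, of b] g, of "-b"] by simp

lemma seminorm_triangle3:
  assumes "f \<in> V" "g \<in> V" "h \<in> V"
  shows "sqrt (B (\<lambda>x. f x - h x) (\<lambda>x. f x - h x))
    \<le> sqrt (B (\<lambda>x. f x - g x) (\<lambda>x. f x - g x)) + sqrt (B (\<lambda>x. g x - h x) (\<lambda>x. g x - h x))"
  using seminorm_triangle[OF diff_mem[OF assms(1,2)] diff_mem[OF assms(2,3)], of "-1"] by simp

lemma form_diff_commute:
  assumes "f \<in> V" "g \<in> V"
  shows "B (\<lambda>x. f x - g x) (\<lambda>x. f x - g x) = B (\<lambda>x. g x - f x) (\<lambda>x. g x - f x)"
  using form_diff_self[OF assms, of 1] form_diff_self[OF assms(2,1), of 1] form_sym[OF assms] by simp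

end

section \<open>Complete inner product spaces of functions and coercive equations\<close>

locale hilbert_fun = psd_form +
  assumes form_definite: "f \<in> V \<Longrightarrow> B f f = 0 \<Longrightarrow> f = (\<lambda>_. 0)"
    and complete: "(\<And>n::nat. F n \<in> V) \<Longrightarrow>
      (\<And>e. e > 0 \<Longrightarrow> \<exists>N. \<forall>m\<ge>N. \<forall>n\<ge>N. sqrt (B (\<lambda>x. F m x - F n x) (\<lambda>x. F m x - F n x)) < e) \<Longrightarrow>
      \<exists>f\<in>V. \<forall>e>0. \<exists>N. \<forall>n\<ge>N. sqrt (B (\<lambda>x. F n x - f x) (\<lambda>x. F n x - f x)) < (e::real)"
begin

text \<open>The value 0 off \<open>V\<close> is there because \<open>Metric_space\<close> demands
  nonnegativity and symmetry for all arguments, not only on the carrier.\<close>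

definition fdist :: "('a \<Rightarrow> real) \<Rightarrow> ('a \<Rightarrow> real) \<Rightarrow> real" where
  "fdist f g = (if f \<in> V \<and> g \<in> V then sqrt (B (\<lambda>x. f x - g x) (\<lambda>x. f x - g x)) else 0)"

sublocale metric: Metric_space V fdist
proof
  show "0 \<le> fdist f g" for f g
    using form_nonneg diff_mem by (auto simp: fdist_def)
  show "fdist f g = fdist g f" for f g
    using form_diff_commute by (auto simp: fdist_def)
  show "(fdist f g = 0) = (f = g)" if fg: "f \<in> V" "g \<in> V" for f g
  proof
    assume "fdist f g = 0"
    then have "(\<lambda>x. f x - g x) = (\<lambda>_. 0)"
      using fg form_definite[OF diff_mem[OF fg]] by (simp add: fdist_def)
    then show "f = g" by (metis eq_iff_diff_eq_0 ext)
  next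
    assume "f = g"
    then show "fdist f g = 0"
      using form_lin[OF fg(1) fg(1) zero_mem, of 0 0] by (simp add: fdist_def)
  qed
  show "fdist f h \<le> fdist f g + fdist g h" if "f \<in> V" "g \<in> V" "h \<in> V" for f g h
    using seminorm_triangle3 that by (simp add: fdist_def)
qed

lemma mcomplete: "metric.mcomplete"
  unfolding metric.mcomplete_def
proof (intro allI impI)
  fix F assume F: "metric.MCauchy F"
  then have mem: "F n \<in> V" for n by (auto simp: metric.MCauchy_def)
  have "\<exists>f\<in>V. \<forall>e>0. \<exists>N. \<forall>n\<ge>N. sqrt (B (\<lambda>x. F n x - f x) (\<lambda>x. F n x - f x)) < e"
  proof (rule complete[OF mem])
    fix e :: real assume "e > 0"
    then obtain N where "\<forall>m n. N \<le> m \<longrightarrow> N \<le> n \<longrightarrow> fdist (F m) (F n) < e"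
      using F by (meson metric.MCauchy_def)
    then show "\<exists>N. \<forall>m\<ge>N. \<forall>n\<ge>N. sqrt (B (\<lambda>x. F m x - F n x) (\<lambda>x. F m x - F n x)) < e"
      using mem by (auto simp: fdist_def)
  qed
  then show "\<exists>f. limitin metric.mtopology F f sequentially"
    unfolding metric.limit_metric_sequentially using mem by (auto simp: fdist_def)
qed

text \<open>A solution is a fixed point of \<open>f - t * (A f - y)\<close>. Squared distances
  shrink by the factor \<open>1 - 2 * t * \<alpha> + t\<^sup>2 * M\<close>, where \<open>M\<close>
  bounds squares of norms; \<open>t = \<alpha> / M\<close> minimises it to
  \<open>1 - \<alpha>\<^sup>2 / M\<close>.\<close>

lemma lax_milgram:
  fixes A :: "('a \<Rightarrow> real) \<Rightarrow> 'a \<Rightarrow> real"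
  assumes A_mem: "\<And>f. f \<in> V \<Longrightarrow> A f \<in> V"
    and A_diff: "\<And>f g. f \<in> V \<Longrightarrow> g \<in> V \<Longrightarrow> A (\<lambda>x. f x - g x) = (\<lambda>x. A f x - A g x)"
    and coercive: "\<alpha> > 0" "\<And>f. f \<in> V \<Longrightarrow> \<alpha> * B f f \<le> B (A f) f"
    and bounded: "M > 0" "\<And>f. f \<in> V \<Longrightarrow> B (A f) (A f) \<le> M * B f f"
    and y: "y \<in> V"
  shows "\<exists>f\<in>V. A f = y"
proof -
  define t where "t = \<alpha> / M"
  have t: "t > 0" using coercive bounded by (simp add: t_def)
  define P where "P f = (\<lambda>x. f x - t * (A f x - y x))" for f
  have P_mem: "P f \<in> V" if "f \<in> V" for f
    unfolding P_def using shift_mem[OF that diff_mem[OF A_mem[OF that] y]] by simp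
  define q where "q = sqrt (1 - \<alpha>\<^sup>2 / M)"
  have q: "q < 1" using coercive bounded by (simp add: q_def)
  have contr: "fdist (P f) (P g) \<le> q * fdist f g" if f: "f \<in> V" and g: "g \<in> V" for f g
  proof -
    let ?u = "\<lambda>x. f x - g x"
    have u: "?u \<in> V" "A ?u \<in> V" using f g diff_mem A_mem by auto
    have "(\<lambda>x. P f x - P g x) = (\<lambda>x. ?u x - t * A ?u x)"
      by (simp add: P_def A_diff[OF f g] fun_eq_iff algebra_simps)
    then have "B (\<lambda>x. P f x - P g x) (\<lambda>x. P f x - P g x) = B ?u ?u - 2 * t * B ?u (A ?u) + t\<^sup>2 * B (A ?u) (A ?u)"
      using form_diff_self[OF u] by simp
    also have "\<dots> \<le> B ?u ?u - 2 * t * (\<alpha> * B ?u ?u) + t\<^sup>2 * (M * B ?u ?u)"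
      using coercive(2)[OF u(1)] bounded(2)[OF u(1)] t form_sym[OF u]
      by (intro add_mono diff_mono mult_left_mono) auto
    also have "\<dots> = (1 - \<alpha>\<^sup>2 / M) * B ?u ?u"
      using bounded(1) by (simp add: t_def field_simps power2_eq_square)
    finally show ?thesis
      using f g P_mem by (simp add: fdist_def q_def flip: real_sqrt_mult)
  qed
  obtain f where f: "f \<in> V" "P f = f"
    using metric.Banach_fixedpoint_thm[of P q] mcomplete zero_mem P_mem q contr by blast
  have "A f x = y x" for x
    using fun_cong[OF f(2), of x] t by (simp add: P_def)
  then show ?thesis using f by blast
qed

end

section \<open>Spectrum and Rayleigh quotients of a bounded positive operator\<close>

locale positive_operator = hilbert_fun +
  fixes T :: "('a \<Rightarrow> real) \<Rightarrow> 'a \<Rightarrow> real" and M :: real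
  assumes op_mem: "f \<in> V \<Longrightarrow> T f \<in> V"
    and op_lin: "f \<in> V \<Longrightarrow> g \<in> V \<Longrightarrow> T (\<lambda>x. a * f x + b * g x) = (\<lambda>x. a * T f x + b * T g x)"
    and op_sym: "f \<in> V \<Longrightarrow> g \<in> V \<Longrightarrow> B (T f) g = B f (T g)"
    and op_nonneg: "f \<in> V \<Longrightarrow> 0 \<le> B (T f) f"
    and op_bounded: "f \<in> V \<Longrightarrow> sqrt (B (T f) (T f)) \<le> M * sqrt (B f f)"
    and bound_pos: "0 < M"
begin

abbreviation nrm :: "('a \<Rightarrow> real) \<Rightarrow> real" where "nrm f \<equiv> sqrt (B f f)"

abbreviation spec :: "real set" where "spec \<equiv> spec_on V T nrm"

definition shifted :: "real \<Rightarrow> ('a \<Rightarrow> real) \<Rightarrow> 'a \<Rightarrow> real" where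
  "shifted mu f = (\<lambda>x. T f x - mu * f x)"

lemma shifted_mem: "f \<in> V \<Longrightarrow> shifted mu f \<in> V"
  unfolding shifted_def by (intro shift_mem op_mem)

lemma shifted_lin: "f \<in> V \<Longrightarrow> g \<in> V \<Longrightarrow>
    shifted mu (\<lambda>x. a * f x + b * g x) = (\<lambda>x. a * shifted mu f x + b * shifted mu g x)"
  by (simp add: shifted_def op_lin fun_eq_iff algebra_simps)

lemma shifted_diff: "f \<in> V \<Longrightarrow> g \<in> V \<Longrightarrow>
    shifted mu (\<lambda>x. f x - g x) = (\<lambda>x. shifted mu f x - shifted mu g x)"
  using shifted_lin[of f g mu 1 "-1"] by simp

lemma shifted_sym: "f \<in> V \<Longrightarrow> g \<in> V \<Longrightarrow> B (shifted mu f) g = B f (shifted mu g)"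
  by (simp add: shifted_def form_diff_left form_diff_right op_mem op_sym)

lemma shifted_bounded:
  assumes f: "f \<in> V"
  shows "nrm (shifted mu f) \<le> (M + \<bar>mu\<bar>) * nrm f"
  using seminorm_triangle[OF op_mem[OF f] f, of mu] op_bounded[OF f]
  by (simp add: shifted_def algebra_simps)

text \<open>The shifted operator \<open>D\<close> may be indefinite, so the coercive equation is
  solved for its square: by symmetry \<open>B (D (D f)) f\<close> is the squared norm of
  \<open>D f\<close>, hence at least \<open>e\<^sup>2 * B f f\<close>. If \<open>D\<close> composed
  with itself is onto, so is \<open>D\<close>; the lower bound gives injectivity and a bounded
  inverse.\<close>

lemma bounded_below_not_in_spec:
  assumes e: "e > 0" and below: "\<And>f. f \<in> V \<Longrightarrow> e * nrm f \<le> nrm (shifted mu f)"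
  shows "mu \<notin> spec"
proof -
  let ?D = "shifted mu"
  have ip_sq: "(nrm f)\<^sup>2 = B f f" if "f \<in> V" for f using form_nonneg[OF that] by simp
  have onto: "\<exists>f\<in>V. ?D (?D f) = y" if y: "y \<in> V" for y
  proof (rule lax_milgram[where \<alpha> = "e\<^sup>2" and M = "((M + \<bar>mu\<bar>)\<^sup>2)\<^sup>2"])
    show "?D (?D f) \<in> V" if "f \<in> V" for f using that by (intro shifted_mem)
    show "?D (?D (\<lambda>x. f x - g x)) = (\<lambda>x. ?D (?D f) x - ?D (?D g) x)"
      if "f \<in> V" "g \<in> V" for f g using that by (simp add: shifted_diff shifted_mem)
    show "e\<^sup>2 * B f f \<le> B (?D (?D f)) f" if f: "f \<in> V" for f
    proof -
      have "(e * nrm f)\<^sup>2 \<le> (nrm (?D f))\<^sup>2"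
        using below[OF f] e form_nonneg[OF f] by (intro power_mono) auto
      then show ?thesis
        unfolding power_mult_distrib ip_sq[OF f] ip_sq[OF shifted_mem[OF f]]
        by (simp only: shifted_sym[OF shifted_mem[OF f] f] shifted_sym[OF f shifted_mem[OF f]])
    qed
    show "0 < ((M + \<bar>mu\<bar>)\<^sup>2)\<^sup>2" using bound_pos by simp
    show "B (?D (?D f)) (?D (?D f)) \<le> ((M + \<bar>mu\<bar>)\<^sup>2)\<^sup>2 * B f f" if f: "f \<in> V" for f
    proof -
      have "nrm (?D (?D f)) \<le> (M + \<bar>mu\<bar>) * ((M + \<bar>mu\<bar>) * nrm f)"
        using shifted_bounded[OF shifted_mem[OF f], of mu mu] shifted_bounded[OF f, of mu] bound_pos
        by (meson abs_ge_zero add_nonneg_nonneg less_imp_le mult_left_mono order_trans)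
      from power_mono[OF this, of 2] show ?thesis
        using f by (simp add: shifted_mem power_mult_distrib ip_sq form_nonneg power2_eq_square mult_ac)
    qed
  qed (use e y in auto)
  define S where "S y = (SOME f. f \<in> V \<and> ?D f = y)" for y
  have S: "S y \<in> V \<and> ?D (S y) = y" if y: "y \<in> V" for y
  proof -
    have "\<exists>f. f \<in> V \<and> ?D f = y" using onto[OF y] shifted_mem by blast
    from someI_ex[OF this] show ?thesis by (simp add: S_def)
  qed
  have inj: "f = g" if fg: "f \<in> V" "g \<in> V" "?D f = ?D g" for f g
  proof -
    have "?D (\<lambda>x. f x - g x) = (\<lambda>_. 0)" using fg by (simp add: shifted_diff)
    moreover have "B (\<lambda>_. 0) (\<lambda>_. 0) = 0" using form_lin[OF zero_mem zero_mem zero_mem, of 0 0] by simp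
    ultimately have "nrm (\<lambda>x. f x - g x) \<le> 0"
      using below[OF diff_mem[OF fg(1,2)]] e by (simp add: mult_le_0_iff)
    then have "B (\<lambda>x. f x - g x) (\<lambda>x. f x - g x) = 0"
      using form_nonneg[OF diff_mem[OF fg(1,2)]] by simp
    then have "(\<lambda>x. f x - g x) = (\<lambda>_. 0)"
      using form_definite[OF diff_mem[OF fg(1,2)]] by simp
    then show "f = g" by (metis eq_iff_diff_eq_0 ext)
  qed
  have "nrm (S f) \<le> 1 / e * nrm f" if "f \<in> V" for f
    using below[of "S f"] S[OF that] e by (simp add: field_simps)
  then have "\<exists>C. \<forall>f\<in>V. nrm (S f) \<le> C * nrm f" by blast
  moreover have "\<forall>f\<in>V. S f \<in> V \<and> S (?D f) = f \<and> ?D (S f) = f"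
    using S inj shifted_mem by metis
  ultimately show ?thesis
    unfolding spec_on_def shifted_def by blast
qed

lemma spec_imp_approximate_eigenvector:
  assumes "mu \<in> spec" "e > 0"
  obtains f where "f \<in> V" "nrm (shifted mu f) < e * nrm f"
  using bounded_below_not_in_spec[of e mu] assms by force

text \<open>For \<open>mu < 0\<close> positivity of \<open>T\<close> gives
  \<open>B (T f - mu * f) f \<ge> - mu * B f f\<close>, which contradicts an approximate eigenvector
  of accuracy \<open>- mu\<close>.\<close>

lemma spec_nonneg:
  assumes "mu \<in> spec"
  shows "0 \<le> mu"
proof (rule ccontr)
  assume neg: "\<not> 0 \<le> mu"
  obtain f where f: "f \<in> V" "nrm (shifted mu f) < (- mu) * nrm f"
    using spec_imp_approximate_eigenvector[OF assms, of "- mu"] neg by auto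
  have pos: "nrm f > 0"
    using form_nonneg[OF shifted_mem[OF f(1), of mu]] f(2) neg
    by (smt (verit) mult_le_0_iff real_sqrt_ge_zero)
  have "(- mu) * (nrm f * nrm f) \<le> B (shifted mu f) f"
    using op_nonneg[OF f(1)] form_nonneg[OF f(1)] by (simp add: shifted_def form_diff_left op_mem f(1))
  also have "\<dots> \<le> nrm (shifted mu f) * nrm f"
    using cauchy_schwarz_sqrt[OF shifted_mem[OF f(1)] f(1)] by (metis abs_le_D1)
  also have "\<dots> < (- mu) * nrm f * nrm f"
    using f(2) pos by (intro mult_strict_right_mono)
  finally show False by (simp only: mult.assoc less_irrefl)
qed

text \<open>The operator \<open>D\<close>, the shift by \<open>m\<close>, is positive.
  Cauchy-Schwarz for the form \<open>B (D f) g\<close>, applied to \<open>f\<close> and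
  \<open>D f\<close>, bounds the squared norm of \<open>D f\<close> by a multiple of
  \<open>B (D f) f\<close>. A bounded inverse of \<open>D\<close> would then bound
  \<open>B f f\<close> by \<open>B (D f) f\<close>, contrary to \<open>opt\<close>.\<close>

lemma rayleigh_inf_in_spec:
  assumes m: "\<And>f. f \<in> V \<Longrightarrow> m * B f f \<le> B (T f) f"
    and opt: "\<And>e. e > 0 \<Longrightarrow> \<exists>f\<in>V. B (T f) f < (m + e) * B f f"
  shows "m \<in> spec"
  unfolding spec_on_def mem_Collect_eq
proof (rule notI)
  let ?D = "shifted m"
  assume "\<exists>S. (\<forall>f\<in>V. S f \<in> V \<and> S (\<lambda>x. T f x - m * f x) = f \<and> (\<lambda>x. T (S f) x - m * S f x) = f)
      \<and> (\<exists>C. \<forall>f\<in>V. nrm (S f) \<le> C * nrm f)"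
  then obtain S C where S: "\<And>f. f \<in> V \<Longrightarrow> S (?D f) = f"
    and C: "\<And>f. f \<in> V \<Longrightarrow> nrm (S f) \<le> C * nrm f"
    unfolding shifted_def by blast
  define L where "L = M + \<bar>m\<bar>"
  have L: "L > 0" using bound_pos by (simp add: L_def)
  \<comment> \<open>This form is only semidefinite, which is why Cauchy-Schwarz was proved without
    definiteness.\<close>
  interpret q: psd_form V "\<lambda>f g. B (?D f) g"
  proof
    show "B (?D f) g = B (?D g) f" if "f \<in> V" "g \<in> V" for f g
      using that by (metis form_sym shifted_mem shifted_sym)
    show "0 \<le> B (?D f) f" if "f \<in> V" for f
      using m[OF that] that by (simp add: shifted_def form_diff_left op_mem)
  qed (auto simp: zero_mem lin_mem shifted_lin form_lin shifted_mem)
  have key: "B f f \<le> C\<^sup>2 * L * B (?D f) f" if f: "f \<in> V" for f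
  proof -
    let ?h = "?D f"
    have h: "?h \<in> V" using shifted_mem[OF f] .
    have "(B ?h ?h)\<^sup>2 \<le> B ?h f * B (?D ?h) ?h"
      using q.cauchy_schwarz[OF f h] .
    also have "B (?D ?h) ?h \<le> nrm (?D ?h) * nrm ?h"
      using cauchy_schwarz_sqrt[OF shifted_mem[OF h] h] by (metis abs_le_D1)
    also have "\<dots> \<le> L * nrm ?h * nrm ?h"
      using shifted_bounded[OF h] form_nonneg[OF h] by (intro mult_right_mono) (auto simp: L_def)
    finally have "(B ?h ?h)\<^sup>2 \<le> B ?h f * (L * B ?h ?h)"
      using q.form_nonneg[OF f] form_nonneg[OF h] by (simp add: mult_left_mono mult.assoc)
    then have hh: "B ?h ?h \<le> L * B ?h f"
      using form_nonneg[OF h] q.form_nonneg[OF f] L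
      by (cases "B ?h ?h = 0") (auto simp: power2_eq_square mult_ac)
    have "nrm f \<le> C * nrm ?h" using C[OF h] S[OF f] by simp
    then have "(nrm f)\<^sup>2 \<le> (C * nrm ?h)\<^sup>2" using form_nonneg[OF f] by (intro power_mono) auto
    then have "B f f \<le> C\<^sup>2 * B ?h ?h"
      using form_nonneg[OF f] form_nonneg[OF h] by (simp add: power_mult_distrib)
    also have "\<dots> \<le> C\<^sup>2 * (L * B ?h f)" using hh by (intro mult_left_mono) auto
    finally show ?thesis by (simp add: mult.assoc)
  qed
  \<comment> \<open>The summand 1 keeps \<open>K\<close> positive even if
    \<open>C = 0\<close>.\<close>
  define K where "K = C\<^sup>2 * L + 1"
  have K: "K > 0" using L by (simp add: K_def add_nonneg_pos)
  obtain f where f: "f \<in> V" "B (T f) f < (m + 1 / K) * B f f"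
    using opt[of "1 / K"] K by auto
  have "B f f \<le> K * B (?D f) f"
    using key[OF f(1)] q.form_nonneg[OF f(1)] by (simp add: K_def algebra_simps)
  moreover have "B (?D f) f < B f f / K"
    using f by (simp add: shifted_def form_diff_left op_mem algebra_simps)
  ultimately show False using K by (simp add: field_simps)
qed

text \<open>The infimum of all Rayleigh quotients is such an \<open>m\<close>. The same fact shows
  later that spectra are nonempty.\<close>

lemma spec_below_rayleigh:
  assumes f: "f \<in> V" "f \<noteq> (\<lambda>_. 0)"
  obtains m where "m \<in> spec" "m * B f f \<le> B (T f) f"
proof -
  define Q where "Q = (\<lambda>f. B (T f) f / B f f) ` (V - {\<lambda>_. 0})"
  define m where "m = Inf Q"
  have pos: "B g g > 0" if "g \<in> V" "g \<noteq> (\<lambda>_. 0)" for g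
    using form_nonneg form_definite that by (metis less_eq_real_def)
  have ne: "Q \<noteq> {}" using f by (auto simp: Q_def)
  have bdd: "bdd_below Q"
    by (intro bdd_belowI[of _ 0]) (auto simp: Q_def intro!: divide_nonneg_nonneg op_nonneg form_nonneg)
  have zero: "B (T (\<lambda>_. 0)) (\<lambda>_. 0) = 0" "B (\<lambda>_. 0) (\<lambda>_. 0) = 0"
    using form_lin_right[OF zero_mem zero_mem op_mem[OF zero_mem], of 0 0]
      form_lin[OF zero_mem zero_mem zero_mem, of 0 0] by auto
  have m: "m * B g g \<le> B (T g) g" if "g \<in> V" for g
  proof (cases "g = (\<lambda>_. 0)")
    case False
    then have "m \<le> B (T g) g / B g g"
      unfolding m_def using that bdd by (intro cInf_lower) (auto simp: Q_def)
    then show ?thesis using pos[OF that False] by (simp add: field_simps)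
  qed (use zero in simp)
  have "m \<in> spec"
  proof (rule rayleigh_inf_in_spec[OF m])
    fix e :: real assume "e > 0"
    then obtain r where "r \<in> Q" "r < m + e"
      using cInf_lessD[OF ne, of "m + e"] by (auto simp: m_def)
    then obtain g where g: "g \<in> V" "g \<noteq> (\<lambda>_. 0)" "B (T g) g / B g g < m + e"
      by (auto simp: Q_def)
    then show "\<exists>g\<in>V. B (T g) g < (m + e) * B g g"
      using pos[OF g(1,2)] by (intro bexI[of _ g]) (simp_all add: field_simps)
  qed
  then show ?thesis using that m f(1) by blast
qed

lemma Inf_spec_le_rayleigh:
  assumes f: "f \<in> V"
  shows "Inf spec * B f f \<le> B (T f) f"
proof (cases "f = (\<lambda>_. 0)")
  case True
  then show ?thesis
    using form_lin[OF zero_mem zero_mem zero_mem, of 0 0] op_nonneg[OF f] by simp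
next
  case False
  obtain m where m: "m \<in> spec" "m * B f f \<le> B (T f) f"
    using spec_below_rayleigh[OF f False] .
  have "Inf spec \<le> m"
    using m(1) spec_nonneg by (intro cInf_lower bdd_belowI[of _ 0])
  then show ?thesis
    using m(2) form_nonneg[OF f] by (meson mult_right_mono order_trans)
qed

end

section \<open>Weighted square summable functions\<close>

text \<open>Index set, weight and sampling map \<open>r\<close> are abstract so that weighted and
  unweighted norms share one theory; for forms, \<open>r\<close> picks one ordering of each
  cell.\<close>

definition wsq_summable :: "'i set \<Rightarrow> ('i \<Rightarrow> real) \<Rightarrow> ('i \<Rightarrow> 'a) \<Rightarrow> ('a \<Rightarrow> real) \<Rightarrow> bool" where
  "wsq_summable A w r f \<longleftrightarrow> (\<lambda>s. w s * (f (r s))\<^sup>2) summable_on A"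

definition wip :: "'i set \<Rightarrow> ('i \<Rightarrow> real) \<Rightarrow> ('i \<Rightarrow> 'a) \<Rightarrow> ('a \<Rightarrow> real) \<Rightarrow> ('a \<Rightarrow> real) \<Rightarrow> real" where
  "wip A w r f g = infsum (\<lambda>s. w s * (f (r s) * g (r s))) A"

lemma summable_on_nonneg_comparison:
  fixes f g :: "'i \<Rightarrow> real"
  assumes "g summable_on A" "\<And>x. x \<in> A \<Longrightarrow> 0 \<le> f x" "\<And>x. x \<in> A \<Longrightarrow> f x \<le> g x"
  shows "f summable_on A"
  using assms by (intro summable_on_comparison_test[of g A f]) auto

lemma wip_summable:
  assumes "wsq_summable A w r f" "wsq_summable A w r g" "\<And>s. s \<in> A \<Longrightarrow> 0 \<le> w s"
  shows "(\<lambda>s. w s * (f (r s) * g (r s))) summable_on A"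
proof (rule Infinite_Sum.abs_summable_summable[OF Infinite_Sum.abs_summable_on_comparison_test'])
  show "(\<lambda>s. w s * (f (r s))\<^sup>2 + w s * (g (r s))\<^sup>2) summable_on A"
    using assms by (intro summable_on_add) (auto simp: wsq_summable_def)
  fix s assume s: "s \<in> A"
  have "\<bar>f (r s) * g (r s)\<bar> \<le> (f (r s))\<^sup>2 + (g (r s))\<^sup>2"
  proof -
    have "2 * (\<bar>f (r s)\<bar> * \<bar>g (r s)\<bar>) \<le> (f (r s))\<^sup>2 + (g (r s))\<^sup>2"
      using sum_squares_bound[of "\<bar>f (r s)\<bar>" "\<bar>g (r s)\<bar>"] by (simp add: mult.assoc)
    moreover have "0 \<le> \<bar>f (r s)\<bar> * \<bar>g (r s)\<bar>" by simp
    ultimately show ?thesis unfolding abs_mult by linarith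
  qed
  then show "norm (w s * (f (r s) * g (r s))) \<le> w s * (f (r s))\<^sup>2 + w s * (g (r s))\<^sup>2"
    using mult_left_mono[OF _ assms(3)[OF s]] assms(3)[OF s]
    by (simp add: abs_mult flip: distrib_left)
qed

lemma wsq_summable_lin:
  assumes "wsq_summable A w r f" "wsq_summable A w r g" "\<And>s. s \<in> A \<Longrightarrow> 0 \<le> w s"
  shows "wsq_summable A w r (\<lambda>x. a * f x + b * g x)"
proof -
  have "(\<lambda>s. a\<^sup>2 * (w s * (f (r s))\<^sup>2) + (2 * a * b * (w s * (f (r s) * g (r s)))
      + b\<^sup>2 * (w s * (g (r s))\<^sup>2))) summable_on A"
    using assms wip_summable[OF assms]
    by (intro summable_on_add summable_on_cmult_right) (auto simp: wsq_summable_def)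
  then show ?thesis
    unfolding wsq_summable_def
    by (rule summable_on_cong[THEN iffD1, rotated]) (simp add: power2_eq_square algebra_simps)
qed

lemma wip_lin:
  assumes "wsq_summable A w r f" "wsq_summable A w r g" "wsq_summable A w r h"
    and "\<And>s. s \<in> A \<Longrightarrow> 0 \<le> w s"
  shows "wip A w r (\<lambda>x. a * f x + b * g x) h = a * wip A w r f h + b * wip A w r g h"
proof -
  have "wip A w r (\<lambda>x. a * f x + b * g x) h
      = infsum (\<lambda>s. a * (w s * (f (r s) * h (r s))) + b * (w s * (g (r s) * h (r s)))) A"
    unfolding wip_def by (rule infsum_cong) (simp add: algebra_simps)
  also have "\<dots> = a * wip A w r f h + b * wip A w r g h"
    using assms by (subst infsum_add)
      (auto simp: wip_def infsum_cmult_right wip_summable intro!: summable_on_cmult_right)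
  finally show ?thesis .
qed

lemma wip_sym: "wip A w r f g = wip A w r g f"
  by (simp add: wip_def mult.commute)

lemma wip_self: "wip A w r f f = infsum (\<lambda>s. w s * (f (r s))\<^sup>2) A"
  by (simp add: wip_def power2_eq_square)

lemma wip_nonneg: "(\<And>s. s \<in> A \<Longrightarrow> 0 \<le> w s) \<Longrightarrow> 0 \<le> wip A w r f f"
  unfolding wip_self by (intro infsum_nonneg) simp

lemma wip_psd_form:
  assumes "\<And>s. s \<in> A \<Longrightarrow> 0 \<le> w s" "\<And>f. f \<in> V \<Longrightarrow> wsq_summable A w r f"
    "(\<lambda>_. 0) \<in> V" "\<And>f g a b. f \<in> V \<Longrightarrow> g \<in> V \<Longrightarrow> (\<lambda>x. a * f x + b * g x) \<in> V"
  shows "psd_form V (wip A w r)"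
proof
  show "wip A w r (\<lambda>x. a * f x + b * g x) h = a * wip A w r f h + b * wip A w r g h"
    if "f \<in> V" "g \<in> V" "h \<in> V" for f g h a b
    using assms that by (intro wip_lin) auto
  show "wip A w r f g = wip A w r g f" for f g by (rule wip_sym)
qed (use assms wip_nonneg in blast)+

lemma wip_definite:
  assumes "wip A w r f f = 0" "wsq_summable A w r f" "\<And>s. s \<in> A \<Longrightarrow> 0 < w s" "s \<in> A"
  shows "f (r s) = 0"
proof -
  have "w s * (f (r s))\<^sup>2 = 0"
    using assms by (intro nonneg_infsum_le_0D[where A = A])
      (auto simp: wip_self wsq_summable_def less_imp_le)
  then show ?thesis using assms(3)[OF assms(4)] by simp
qed

lemma wip_finite_sum_le:
  assumes "wsq_summable A w r f" "\<And>s. s \<in> A \<Longrightarrow> 0 \<le> w s" "finite C" "C \<subseteq> A"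
  shows "(\<Sum>s\<in>C. w s * (f (r s))\<^sup>2) \<le> wip A w r f f"
  unfolding wip_self using assms by (intro finite_sum_le_infsum) (auto simp: wsq_summable_def)

lemma wsq_bounded_finite_sums:
  assumes bound: "\<And>C. finite C \<Longrightarrow> C \<subseteq> A \<Longrightarrow> (\<Sum>s\<in>C. w s * (f (r s))\<^sup>2) \<le> b"
    and "\<And>s. s \<in> A \<Longrightarrow> 0 \<le> w s"
  shows "wsq_summable A w r f" "wip A w r f f \<le> b"
proof -
  show summ: "wsq_summable A w r f"
    unfolding wsq_summable_def using assms
    by (intro nonneg_bdd_above_summable_on bdd_aboveI[of _ b]) auto
  show "wip A w r f f \<le> b"
    unfolding wip_self using summ bound by (intro infsum_le_finite_sums) (auto simp: wsq_summable_def)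
qed

lemma wip_coordinate_le:
  assumes "wsq_summable A w r f" "\<And>s. s \<in> A \<Longrightarrow> 0 < w s" "s \<in> A"
  shows "\<bar>f (r s)\<bar> \<le> sqrt (wip A w r f f) / sqrt (w s)"
proof -
  have "w s * (f (r s))\<^sup>2 \<le> wip A w r f f"
    using wip_finite_sum_le[OF assms(1), of "{s}"] assms by (auto simp: less_imp_le)
  then have "(f (r s))\<^sup>2 \<le> wip A w r f f / w s"
    using assms(2)[OF assms(3)] by (simp add: field_simps)
  then show ?thesis
    by (metis real_sqrt_abs real_sqrt_divide real_sqrt_le_iff)
qed

text \<open>A Fatou argument: on each finite index set the Cauchy estimate survives the pointwise
  limit in \<open>m\<close>, and the resulting bound does not depend on the finite set.\<close>

lemma wip_Cauchy_limit:
  fixes F :: "nat \<Rightarrow> 'a \<Rightarrow> real"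
  assumes w: "\<And>s. s \<in> A \<Longrightarrow> 0 < w s" and F: "\<And>n. wsq_summable A w r (F n)"
    and Cauchy: "\<And>e. e > 0 \<Longrightarrow> \<exists>N. \<forall>m\<ge>N. \<forall>n\<ge>N.
      sqrt (wip A w r (\<lambda>x. F m x - F n x) (\<lambda>x. F m x - F n x)) < e"
    and lim: "\<And>s. s \<in> A \<Longrightarrow> (\<lambda>n. F n (r s)) \<longlonglongrightarrow> f (r s)"
  shows "wsq_summable A w r f"
    "\<forall>e>0. \<exists>N. \<forall>n\<ge>N. sqrt (wip A w r (\<lambda>x. F n x - f x) (\<lambda>x. F n x - f x)) < e"
proof -
  have w0: "\<And>s. s \<in> A \<Longrightarrow> 0 \<le> w s" using w less_imp_le by blast
  have diff: "wsq_summable A w r (\<lambda>x. F m x - F n x)" for m n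
    using wsq_summable_lin[OF F F w0, of 1 m "-1" n] by simp
  have key: "\<exists>N. \<forall>n\<ge>N. wsq_summable A w r (\<lambda>x. F n x - f x)
      \<and> wip A w r (\<lambda>x. F n x - f x) (\<lambda>x. F n x - f x) \<le> e\<^sup>2" if e: "e > 0" for e :: real
  proof -
    obtain N where N: "\<And>m n. m \<ge> N \<Longrightarrow> n \<ge> N \<Longrightarrow>
        sqrt (wip A w r (\<lambda>x. F m x - F n x) (\<lambda>x. F m x - F n x)) < e"
      using Cauchy[OF e] by blast
    have fin: "(\<Sum>s\<in>C. w s * (F n (r s) - f (r s))\<^sup>2) \<le> e\<^sup>2"
      if n: "n \<ge> N" and C: "finite C" "C \<subseteq> A" for n C
    proof (rule tendsto_upperbound)
      show "(\<lambda>m. \<Sum>s\<in>C. w s * (F n (r s) - F m (r s))\<^sup>2) \<longlonglongrightarrow> (\<Sum>s\<in>C. w s * (F n (r s) - f (r s))\<^sup>2)"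
        using C lim by (intro tendsto_intros) auto
      have "(\<Sum>s\<in>C. w s * (F n (r s) - F m (r s))\<^sup>2) \<le> e\<^sup>2" if "m \<ge> N" for m
      proof -
        have "(\<Sum>s\<in>C. w s * (F n (r s) - F m (r s))\<^sup>2) \<le> wip A w r (\<lambda>x. F n x - F m x) (\<lambda>x. F n x - F m x)"
          using wip_finite_sum_le[OF diff w0 C] .
        also have "\<dots> \<le> e\<^sup>2"
          using N[OF n that] e by (meson less_imp_le real_less_lsqrt real_sqrt_le_iff sqrt_le_D)
        finally show ?thesis .
      qed
      then show "\<forall>\<^sub>F m in sequentially. (\<Sum>s\<in>C. w s * (F n (r s) - F m (r s))\<^sup>2) \<le> e\<^sup>2"
        by (auto simp: eventually_sequentially)
    qed auto
    have "wsq_summable A w r (\<lambda>x. F n x - f x)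
      \<and> wip A w r (\<lambda>x. F n x - f x) (\<lambda>x. F n x - f x) \<le> e\<^sup>2" if n: "n \<ge> N" for n
      using wsq_bounded_finite_sums[of A w "\<lambda>x. F n x - f x" r "e\<^sup>2", OF fin[OF n] w0] by simp
    then show ?thesis by blast
  qed
  obtain N where "wsq_summable A w r (\<lambda>x. F N x - f x)" using key[of 1] by auto
  from wsq_summable_lin[OF F[of N] this w0, of 1 "-1"] show "wsq_summable A w r f" by simp
  show "\<forall>e>0. \<exists>N. \<forall>n\<ge>N. sqrt (wip A w r (\<lambda>x. F n x - f x) (\<lambda>x. F n x - f x)) < e"
  proof (intro allI impI)
    fix e :: real assume e: "e > 0"
    then obtain N where N: "\<And>n. n \<ge> N \<Longrightarrow> wip A w r (\<lambda>x. F n x - f x) (\<lambda>x. F n x - f x) \<le> (e / 2)\<^sup>2"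
      using key[of "e / 2"] by auto
    have "sqrt (wip A w r (\<lambda>x. F n x - f x) (\<lambda>x. F n x - f x)) < e" if "n \<ge> N" for n
      using real_sqrt_le_mono[OF N[OF that]] e by simp
    then show "\<exists>N. \<forall>n\<ge>N. sqrt (wip A w r (\<lambda>x. F n x - f x) (\<lambda>x. F n x - f x)) < e" by blast
  qed
qed

section \<open>Alternating functions on lists\<close>

text \<open>The sign rule of \<open>is_form\<close> without its support condition, so that it passes
  to functions such as \<open>f (x # _)\<close> and \<open>codiff g\<close>, which belong to no
  complex.\<close>

definition alternating :: "('v list \<Rightarrow> real) \<Rightarrow> bool" where
  "alternating f \<longleftrightarrow>
    (\<forall>xs i j. i < length xs \<and> j < length xs \<and> i \<noteq> j \<longrightarrow> f (lswap xs i j) = - f xs)"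

lemma alternatingD:
  "alternating f \<Longrightarrow> i < length xs \<Longrightarrow> j < length xs \<Longrightarrow> i \<noteq> j \<Longrightarrow> f (lswap xs i j) = - f xs"
  by (simp add: alternating_def)

lemma length_lswap [simp]: "length (lswap xs i j) = length xs"
  by (simp add: lswap_def)

lemma set_lswap [simp]: "i < length xs \<Longrightarrow> j < length xs \<Longrightarrow> set (lswap xs i j) = set xs"
  by (simp add: lswap_def set_swap)

lemma mset_lswap: "i < length xs \<Longrightarrow> j < length xs \<Longrightarrow> mset (lswap xs i j) = mset xs"
  by (simp add: lswap_def mset_swap)

lemma distinct_lswap [simp]:
  "i < length xs \<Longrightarrow> j < length xs \<Longrightarrow> distinct (lswap xs i j) = distinct xs"
  by (simp add: lswap_def distinct_swap)

lemma lswap_Cons [simp]: "lswap (x # xs) (Suc i) (Suc j) = x # lswap xs i j"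
  by (simp add: lswap_def)

lemma lswap_commute: "i < length xs \<Longrightarrow> j < length xs \<Longrightarrow> lswap xs i j = lswap xs j i"
  by (cases "i = j") (auto simp: lswap_def list_update_swap)

lemma nth_lswap:
  "i < length xs \<Longrightarrow> j < length xs \<Longrightarrow> n < length xs \<Longrightarrow>
    lswap xs i j ! n = (if n = i then xs ! j else if n = j then xs ! i else xs ! n)"
  by (auto simp: lswap_def nth_list_update)

lemma map_lswap: "i < length xs \<Longrightarrow> j < length xs \<Longrightarrow> map \<phi> (lswap xs i j) = lswap (map \<phi> xs) i j"
  by (simp add: lswap_def map_update)

lemma alternating_Cons: "alternating f \<Longrightarrow> alternating (\<lambda>ys. f (x # ys))"
  unfolding alternating_def
  by (metis Suc_less_eq length_Cons lswap_Cons nat.inject)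

lemma alternating_swap_first: "alternating f \<Longrightarrow> f (y # x # zs) = - f (x # y # zs)"
  using alternatingD[of f 0 "x # y # zs" 1] by (simp add: lswap_def)

text \<open>The sign depends on the two lists alone and serves every alternating \<open>f\<close> at
  once; hence a product of two alternating functions does not see the ordering. In the induction one
  transposition brings the head of \<open>xs\<close> to the front of \<open>ys\<close>.\<close>

lemma alternating_reorder:
  "mset xs = mset ys \<Longrightarrow>
    \<exists>e::real. (e = 1 \<or> e = -1) \<and> (\<forall>f. alternating f \<longrightarrow> f ys = e * f xs)"
proof (induction xs arbitrary: ys)
  case Nil
  then show ?case by (intro exI[of _ 1]) simp
next
  case (Cons x xs)
  then have "x \<in> set ys" by (metis list.set_intros(1) mset_eq_setD)
  then obtain n where n: "n < length ys" "ys ! n = x" by (metis in_set_conv_nth)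
  define ys' where "ys' = lswap ys 0 n"
  have len: "0 < length ys" using n by auto
  have ys': "mset ys' = mset ys" "ys' ! 0 = x" "length ys' = length ys"
    using n len by (auto simp: ys'_def mset_lswap nth_lswap)
  then obtain zs where zs: "ys' = x # zs" by (metis len length_0_conv less_not_refl neq_Nil_conv nth_Cons_0)
  then have "mset xs = mset zs" using Cons.prems ys' by (metis add_mset_add_single add_right_cancel mset.simps(2))
  from Cons.IH[OF this] obtain e :: real
    where e: "e = 1 \<or> e = -1" "\<And>f. alternating f \<Longrightarrow> f zs = e * f xs" by blast
  have "f ys = (if n = 0 then e else - e) * f (x # xs)" if f: "alternating f" for f
  proof -
    have "f ys' = e * f (x # xs)"
      using e(2)[OF alternating_Cons[OF f]] by (simp add: zs)
    moreover have "f ys' = (if n = 0 then f ys else - f ys)"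
      using alternatingD[OF f len n(1)] by (auto simp: ys'_def lswap_def)
    ultimately show ?thesis by (simp split: if_splits)
  qed
  then show ?case
    using e(1) by (intro exI[of _ "if n = 0 then e else - e"]) auto
qed

lemma alternating_mult_reorder:
  assumes "alternating f" "alternating g" "distinct xs" "distinct ys" "set xs = set ys"
  shows "f xs * g xs = f ys * g ys"
proof -
  have "mset xs = mset ys" using assms(3-5) by (metis set_eq_iff_mset_eq_distinct)
  from alternating_reorder[OF this] obtain e :: real
    where "e = 1 \<or> e = -1" "f ys = e * f xs" "g ys = e * g xs" using assms(1,2) by blast
  then show ?thesis by auto
qed

lemma alternating_power2_reorder:
  assumes "alternating f" "distinct xs" "distinct ys" "set xs = set ys"
  shows "(f xs)\<^sup>2 = (f ys)\<^sup>2"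
  using alternating_mult_reorder[OF assms(1,1) assms(2-)] by (simp add: power2_eq_square)

lemma ldel_Cons_0 [simp]: "ldel 0 (x # xs) = xs"
  and ldel_Cons_Suc [simp]: "ldel (Suc i) (x # xs) = x # ldel i xs"
  by (simp_all add: ldel_def)

lemma length_ldel: "i < length xs \<Longrightarrow> length (ldel i xs) = length xs - 1"
  by (simp add: ldel_def)

lemma distinct_ldel: "distinct xs \<Longrightarrow> distinct (ldel i xs)"
  using set_take_disj_set_drop_if_distinct[of xs i "Suc i"] by (simp add: ldel_def)

lemma set_ldel:
  assumes "distinct xs" "i < length xs"
  shows "set (ldel i xs) = set xs - {xs ! i}"
proof -
  have eq: "xs = take i xs @ xs ! i # drop (Suc i) xs" using assms by (simp add: id_take_nth_drop)
  then have "distinct (take i xs @ xs ! i # drop (Suc i) xs)" using assms(1) by simp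
  moreover have "set xs = set (take i xs @ xs ! i # drop (Suc i) xs)" using eq by simp
  ultimately show ?thesis by (auto simp: ldel_def)
qed

lemma set_ldel_subset: "set (ldel i xs) \<subseteq> set xs"
  by (auto simp: ldel_def dest: in_set_takeD in_set_dropD)

lemma map_ldel: "map \<phi> (ldel i xs) = ldel i (map \<phi> xs)"
  by (simp add: ldel_def take_map drop_map)

text \<open>The entry passes \<open>i\<close> predecessors, at the cost of one sign each. This
  converts the signs of the coboundary into the vertex-first lists over which \<open>bd\<close>
  sums.\<close>

lemma alternating_move_to_front:
  "alternating f \<Longrightarrow> i < length xs \<Longrightarrow> f (xs ! i # ldel i xs) = (-1) ^ i * f xs"
proof (induction i arbitrary: f xs)
  case 0
  then show ?case by (cases xs) auto
next
  case (Suc i)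
  then obtain x ys where xs: "xs = x # ys" by (cases xs) auto
  show ?case
    using Suc.IH[OF alternating_Cons[OF Suc.prems(1), of x], of ys] Suc.prems
      alternating_swap_first[OF Suc.prems(1), of "ys ! i" x "ldel i ys"]
    by (simp add: xs)
qed

text \<open>The common core of both coboundaries: \<open>delta1\<close> multiplies it by the degree,
  \<open>delta2\<close> applies it to the form divided by degrees. It reads the dimension off the
  list, which allows recursion on lists.\<close>

definition codiff :: "('v list \<Rightarrow> real) \<Rightarrow> 'v list \<Rightarrow> real" where
  "codiff g xs = (\<Sum>i<length xs. (-1) ^ i * g (ldel i xs))"

lemma codiff_Nil [simp]: "codiff g [] = 0"
  by (simp add: codiff_def)

lemma codiff_Cons: "codiff g (x # xs) = g xs - codiff (\<lambda>ys. g (x # ys)) xs"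
  unfolding codiff_def length_Cons sum.lessThan_Suc_shift
  by (simp add: sum_negf)

lemma codiff_diff: "codiff (\<lambda>ys. f ys - g ys) xs = codiff f xs - codiff g xs"
  by (simp add: codiff_def sum_subtractf algebra_simps)

text \<open>By \<open>codiff_Cons\<close> the double coboundary of \<open>g\<close> on
  \<open>x # xs\<close> reduces to that of \<open>g (x # _)\<close> on \<open>xs\<close>, so an
  induction replaces the usual cancellation in a double sum.\<close>

lemma codiff_codiff: "codiff (codiff g) xs = 0"
proof (induction xs arbitrary: g)
  case (Cons x xs)
  have "codiff (\<lambda>ys. codiff g (x # ys)) xs = codiff g xs - codiff (codiff (\<lambda>ys. g (x # ys))) xs"
    by (simp add: codiff_Cons codiff_diff)
  then show ?case using Cons by (simp add: codiff_Cons[of "codiff g"])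
qed simp

text \<open>Transpositions that avoid the head follow by induction on the length through
  \<open>codiff_Cons\<close>, the swap of the first two entries by unfolding the recursion twice;
  these generate the rest.\<close>

lemma alternating_codiff:
  assumes "alternating g"
  shows "alternating (codiff g)"
proof -
  have first: "codiff g (lswap ys 0 1) = - codiff g ys"
    if g: "alternating g" and ys: "1 < length ys" for g :: "'a list \<Rightarrow> real" and ys
  proof -
    obtain x y zs where eq: "ys = x # y # zs"
      using ys by (cases ys; cases "tl ys") auto
    have "codiff (\<lambda>u. g (y # x # u)) zs = - codiff (\<lambda>u. g (x # y # u)) zs"
      using alternating_swap_first[OF g, of y x] by (simp add: codiff_def sum_negf)
    then show ?thesis by (simp add: eq lswap_def codiff_Cons)
  qed
  have main: "codiff g (lswap xs i j) = - codiff g xs"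
    if "length xs = n" "alternating g" "i < j" "j < n" for g :: "'a list \<Rightarrow> real" and xs i j n
    using that
  proof (induction n arbitrary: xs g i j)
    case (Suc n)
    have tail: "codiff g (lswap ys (Suc i) (Suc j)) = - codiff g ys"
      if ij: "i < j" "j < n" "length ys = Suc n" for i j ys
    proof -
      obtain x zs where ys: "ys = x # zs" "length zs = n" using ij(3) by (cases ys) auto
      have "codiff (\<lambda>u. g (x # u)) (lswap zs i j) = - codiff (\<lambda>u. g (x # u)) zs"
        using Suc.IH[OF ys(2) alternating_Cons[OF Suc.prems(2)] ij(1,2)] .
      moreover have "g (lswap zs i j) = - g zs"
        using alternatingD[OF Suc.prems(2), of i zs j] ij ys by simp
      ultimately show ?thesis by (simp add: ys codiff_Cons)
    qed
    obtain j' where j': "j = Suc j'" using Suc.prems(3) by (cases j) auto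
    show ?case
    proof (cases i)
      case (Suc i')
      then show ?thesis using tail[of i' j' xs] Suc.prems j' by simp
    next
      case 0
      show ?thesis
      proof (cases "j' = 0")
        case True
        then show ?thesis using first[OF Suc.prems(2), of xs] Suc.prems 0 j' by simp
      next
        case False
        have len: "1 < length xs" using Suc.prems j' by simp
        \<comment> \<open>Conjugating the transposition (1 j) by (0 1) gives (0 j).\<close>
        have "lswap xs 0 j = lswap (lswap (lswap xs 0 1) 1 j) 0 1"
          using Suc.prems j' False by (intro nth_equalityI) (auto simp: nth_lswap)
        then have "codiff g (lswap xs 0 j) = - codiff g (lswap (lswap xs 0 1) 1 j)"
          using first[OF Suc.prems(2), of "lswap (lswap xs 0 1) 1 j"] len by simp
        also have "\<dots> = codiff g (lswap xs 0 1)"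
          using tail[of 0 j' "lswap xs 0 1"] Suc.prems j' False by simp
        also have "\<dots> = - codiff g xs"
          using first[OF Suc.prems(2) len] .
        finally show ?thesis by (simp add: 0)
      qed
    qed
  qed simp
  show ?thesis
    unfolding alternating_def
  proof (intro allI impI)
    fix xs :: "'a list" and i j assume ij: "i < length xs \<and> j < length xs \<and> i \<noteq> j"
    then show "codiff g (lswap xs i j) = - codiff g xs"
      using main[OF refl assms, of i j xs] main[OF refl assms, of j i xs] lswap_commute[of i xs j]
      by (cases "i < j") auto
  qed
qed

section \<open>Boundary and coboundary on forms\<close>

lemma cellrep: "finite s \<Longrightarrow> distinct (cellrep s) \<and> set (cellrep s) = s"
  unfolding cellrep_def by (rule someI_ex) (metis finite_distinct_list)

lemma cells_finite: "simp_complex X \<Longrightarrow> s \<in> cells X k \<Longrightarrow> finite s"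
  by (auto simp: simp_complex_def cells_def)

lemma simp_complex_subset: "simp_complex X \<Longrightarrow> s \<in> X \<Longrightarrow> t \<subseteq> s \<Longrightarrow> t \<in> X"
  unfolding simp_complex_def by blast

lemma cellrep_ocell: "simp_complex X \<Longrightarrow> s \<in> cells X k \<Longrightarrow> ocell X k (cellrep s)"
  using cellrep[OF cells_finite] by (auto simp: ocell_def cells_def simp flip: distinct_card)

lemma ocell_cells: "ocell X k xs \<Longrightarrow> set xs \<in> cells X k"
  by (auto simp: ocell_def cells_def distinct_card)

lemma ocell_lswap [simp]:
  "i < length xs \<Longrightarrow> j < length xs \<Longrightarrow> ocell X k (lswap xs i j) \<longleftrightarrow> ocell X k xs"
  by (simp add: ocell_def)

lemma is_form_iff:
  "is_form X k f \<longleftrightarrow> (\<forall>xs. f xs \<noteq> 0 \<longrightarrow> ocell X k xs) \<and> alternating f"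
  by (simp add: is_form_def alternating_def)

lemma is_form_alternating: "is_form X k f \<Longrightarrow> alternating f"
  by (simp add: is_form_iff)

lemma is_form_zero: "is_form X k (\<lambda>_. 0)"
  by (simp add: is_form_def)

lemma is_form_lin: "is_form X k f \<Longrightarrow> is_form X k g \<Longrightarrow> is_form X k (\<lambda>x. a * f x + b * g x)"
  unfolding is_form_def by (simp add: algebra_simps) (metis add_0 mult_zero_right)

lemma is_form_ext:
  assumes "is_form X k f" "is_form X k g" "\<And>s. s \<in> cells X k \<Longrightarrow> f (cellrep s) = g (cellrep s)"
    and X: "simp_complex X"
  shows "f = g"
proof
  fix xs
  show "f xs = g xs"
  proof (cases "ocell X k xs")
    case True
    let ?r = "cellrep (set xs)"
    have "mset ?r = mset xs"
      using True cellrep[of "set xs"] by (metis List.finite_set ocell_def set_eq_iff_mset_eq_distinct)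
    from alternating_reorder[OF this] obtain e :: real
      where "f xs = e * f ?r" "g xs = e * g ?r" using assms(1,2) is_form_alternating by blast
    then show ?thesis using assms(3)[OF ocell_cells[OF True]] by simp
  next
    case False
    then have "f xs = 0" "g xs = 0" using assms(1,2) unfolding is_form_def by blast+
    then show ?thesis by simp
  qed
qed

definition form_space :: "'v set set \<Rightarrow> nat \<Rightarrow> ('v set \<Rightarrow> real) \<Rightarrow> ('v list \<Rightarrow> real) set" where
  "form_space X k w = {f. is_form X k f \<and> wsq_summable (cells X k) w cellrep f}"

abbreviation form_ip :: "'v set set \<Rightarrow> nat \<Rightarrow> ('v set \<Rightarrow> real) \<Rightarrow> ('v list \<Rightarrow> real) \<Rightarrow> ('v list \<Rightarrow> real) \<Rightarrow> real" where
  "form_ip X k w \<equiv> wip (cells X k) w cellrep"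

lemma form_space_lin:
  assumes "f \<in> form_space X k w" "g \<in> form_space X k w" "\<And>s. s \<in> cells X k \<Longrightarrow> 0 \<le> w s"
  shows "(\<lambda>x. a * f x + b * g x) \<in> form_space X k w"
  using assms by (simp add: form_space_def is_form_lin wsq_summable_lin)

lemma form_space_zero: "(\<lambda>_. 0) \<in> form_space X k w"
  by (simp add: form_space_def is_form_zero wsq_summable_def)

text \<open>The premise \<open>closed\<close> offers both pointwise and norm convergence because the
  subspaces call for different ones: the kernel of \<open>bd\<close> is closed under pointwise
  limits, an orthogonal complement under norm limits.\<close>

lemma hilbert_fun_forms:
  assumes X: "simp_complex X" and w: "\<And>s. s \<in> cells X k \<Longrightarrow> 0 < w s"
    and V: "V \<subseteq> form_space X k w" "(\<lambda>_. 0) \<in> V"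
      "\<And>f g a b. f \<in> V \<Longrightarrow> g \<in> V \<Longrightarrow> (\<lambda>x. a * f x + b * g x) \<in> V"
    and closed: "\<And>F f. (\<And>n::nat. F n \<in> V) \<Longrightarrow> f \<in> form_space X k w \<Longrightarrow>
      (\<And>xs. (\<lambda>n. F n xs) \<longlonglongrightarrow> f xs) \<Longrightarrow>
      (\<forall>e>0. \<exists>N. \<forall>n\<ge>N. sqrt (form_ip X k w (\<lambda>x. F n x - f x) (\<lambda>x. F n x - f x)) < e) \<Longrightarrow> f \<in> V"
  shows "hilbert_fun V (form_ip X k w)"
proof -
  have w0: "\<And>s. s \<in> cells X k \<Longrightarrow> 0 \<le> w s" using w less_imp_le by blast
  have sq: "wsq_summable (cells X k) w cellrep f" if "f \<in> V" for f
    using V(1) that by (auto simp: form_space_def)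
  have form: "is_form X k f" if "f \<in> V" for f
    using V(1) that by (auto simp: form_space_def)
  interpret psd_form V "form_ip X k w"
    using w0 sq V(2,3) by (rule wip_psd_form)
  show ?thesis
  proof
    show "f = (\<lambda>_. 0)" if f: "f \<in> V" "form_ip X k w f f = 0" for f
      using wip_definite[OF f(2) sq[OF f(1)] w]
      by (intro is_form_ext[OF form[OF f(1)] is_form_zero _ X]) auto
  next
    fix F :: "nat \<Rightarrow> 'a list \<Rightarrow> real"
    assume F: "\<And>n. F n \<in> V"
      and Cauchy: "\<And>e. 0 < e \<Longrightarrow> \<exists>N. \<forall>m\<ge>N. \<forall>n\<ge>N.
        sqrt (form_ip X k w (\<lambda>x. F m x - F n x) (\<lambda>x. F m x - F n x)) < e"
    have conv_rep: "convergent (\<lambda>n. F n (cellrep s))" if s: "s \<in> cells X k" for s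
    proof -
      have "Cauchy (\<lambda>n. F n (cellrep s))"
      proof (rule metric_CauchyI)
        fix e :: real assume e: "e > 0"
        have ws: "sqrt (w s) > 0" using w[OF s] by simp
        obtain N where N: "\<And>m n. m \<ge> N \<Longrightarrow> n \<ge> N \<Longrightarrow>
            sqrt (form_ip X k w (\<lambda>x. F m x - F n x) (\<lambda>x. F m x - F n x)) < e * sqrt (w s)"
          using Cauchy[of "e * sqrt (w s)"] e ws by auto
        have "dist (F m (cellrep s)) (F n (cellrep s)) < e" if "m \<ge> N" "n \<ge> N" for m n
        proof -
          have "\<bar>F m (cellrep s) - F n (cellrep s)\<bar>
              \<le> sqrt (form_ip X k w (\<lambda>x. F m x - F n x) (\<lambda>x. F m x - F n x)) / sqrt (w s)"
            using wip_coordinate_le[OF sq[OF diff_mem[OF F[of m] F[of n]]] w s] .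
          also have "\<dots> < e" using N[OF that] ws by (simp add: pos_divide_less_eq)
          finally show ?thesis by (simp add: dist_real_def)
        qed
        then show "\<exists>N. \<forall>m\<ge>N. \<forall>n\<ge>N. dist (F m (cellrep s)) (F n (cellrep s)) < e" by blast
      qed
      then show ?thesis by (simp add: Cauchy_convergent)
    qed
    \<comment> \<open>An ordering of a cell differs from the representative by a sign that is the
      same for all \<open>n\<close>.\<close>
    have conv: "convergent (\<lambda>n. F n xs)" for xs
    proof (cases "ocell X k xs")
      case True
      let ?r = "cellrep (set xs)"
      have "mset ?r = mset xs"
        using True cellrep[of "set xs"] by (metis List.finite_set ocell_def set_eq_iff_mset_eq_distinct)
      from alternating_reorder[OF this] obtain e :: real
        where "\<And>n. F n xs = e * F n ?r" using form[OF F] is_form_alternating by metis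
      then show ?thesis
        using conv_rep[OF ocell_cells[OF True]] convergent_mult[OF convergent_const] by simp
    next
      case False
      then have "F n xs = 0" for n using form[OF F[of n]] by (auto simp: is_form_def)
      then show ?thesis by (simp add: convergent_const)
    qed
    define f where "f xs = lim (\<lambda>n. F n xs)" for xs
    have lim: "(\<lambda>n. F n xs) \<longlonglongrightarrow> f xs" for xs
      using conv by (simp add: f_def convergent_LIMSEQ_iff)
    have "is_form X k f"
      unfolding is_form_def
    proof (intro conjI allI impI)
      fix xs assume "f xs \<noteq> 0"
      show "ocell X k xs"
      proof (rule ccontr)
        assume "\<not> ocell X k xs"
        then have "F n xs = 0" for n using form[OF F[of n]] by (auto simp: is_form_def)
        then show False using lim[of xs] \<open>f xs \<noteq> 0\<close> by (simp add: LIMSEQ_const_iff)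
      qed
    next
      fix xs :: "'a list" and i j assume ij: "i < length xs \<and> j < length xs \<and> i \<noteq> j"
      then have "(\<lambda>n. F n (lswap xs i j)) = (\<lambda>n. - F n xs)"
        using form[OF F] by (simp add: is_form_def)
      then have "(\<lambda>n. - F n xs) \<longlonglongrightarrow> f (lswap xs i j)" using lim[of "lswap xs i j"] by simp
      then show "f (lswap xs i j) = - f xs" using tendsto_minus[OF lim[of xs]] LIMSEQ_unique by blast
    qed
    moreover have "wsq_summable (cells X k) w cellrep f"
      and tends: "\<forall>e>0. \<exists>N. \<forall>n\<ge>N. sqrt (form_ip X k w (\<lambda>x. F n x - f x) (\<lambda>x. F n x - f x)) < e"
      using wip_Cauchy_limit[of "cells X k" w cellrep F f, OF w sq[OF F] Cauchy lim] by blast+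
    ultimately have "f \<in> form_space X k w" by (simp add: form_space_def)
    from closed[OF F this lim tends] tends
    show "\<exists>f\<in>V. \<forall>e>0. \<exists>N. \<forall>n\<ge>N. sqrt (form_ip X k w (\<lambda>x. F n x - f x) (\<lambda>x. F n x - f x)) < e"
      by blast
  qed
qed

section \<open>Incidences between cells of consecutive dimensions; boundary and coboundary as
  adjoints\<close>

definition up :: "'v set set \<Rightarrow> 'v set \<Rightarrow> 'v set" where
  "up X s = {v. v \<notin> s \<and> insert v s \<in> X}"

lemma up_cofaces:
  assumes "finite s"
  shows "bij_betw (\<lambda>v. insert v s) (up X s) (cofaces X s)"
  unfolding bij_betw_def
proof
  show "inj_on (\<lambda>v. insert v s) (up X s)" by (auto simp: inj_on_def up_def)
  show "(\<lambda>v. insert v s) ` up X s = cofaces X s"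
  proof
    show "(\<lambda>v. insert v s) ` up X s \<subseteq> cofaces X s"
      using assms by (auto simp: up_def cofaces_def)
    show "cofaces X s \<subseteq> (\<lambda>v. insert v s) ` up X s"
    proof
      fix t assume t: "t \<in> cofaces X s"
      then have "card (t - s) = 1" using assms by (simp add: cofaces_def card_Diff_subset)
      then obtain v where "t - s = {v}" by (auto simp: card_1_singleton_iff)
      then have "t = insert v s" "v \<notin> s" using t by (auto simp: cofaces_def)
      then show "t \<in> (\<lambda>v. insert v s) ` up X s" using t by (auto simp: up_def cofaces_def)
    qed
  qed
qed

lemma deg_up: "finite s \<Longrightarrow> deg X s = card (up X s)"
  unfolding deg_def by (rule bij_betw_same_card[OF up_cofaces, symmetric])

lemma finite_up: "finite s \<Longrightarrow> finite (up X s) \<longleftrightarrow> finite (cofaces X s)"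
  using bij_betw_finite[OF up_cofaces] .

text \<open>Double counting: a cell with a marked vertex is the same as a facet together with a
  vertex above it. The norm bounds and the adjointness below are reindexings along this
  bijection.\<close>

lemma incidence_bij:
  assumes X: "simp_complex X"
  shows "bij_betw (\<lambda>(t, v). (t - {v}, v)) (Sigma (cells X (Suc k)) (\<lambda>t. t)) (Sigma (cells X k) (up X))"
proof (rule bij_betw_byWitness[where f' = "\<lambda>(s, v). (insert v s, v)"])
  show "(\<lambda>(t, v). (t - {v}, v)) ` Sigma (cells X (Suc k)) (\<lambda>t. t) \<subseteq> Sigma (cells X k) (up X)"
    using simp_complex_subset[OF X] cells_finite[OF X]
    by (auto simp: cells_def up_def insert_absorb)
  show "(\<lambda>(s, v). (insert v s, v)) ` Sigma (cells X k) (up X) \<subseteq> Sigma (cells X (Suc k)) (\<lambda>t. t)"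
    using cells_finite[OF X] by (auto simp: cells_def up_def)
qed (auto simp: up_def)

lemma summable_on_Sigma_finite:
  fixes g :: "'a \<Rightarrow> 'b \<Rightarrow> real"
  assumes "\<And>x. x \<in> A \<Longrightarrow> finite (B x)" "\<And>x y. x \<in> A \<Longrightarrow> y \<in> B x \<Longrightarrow> 0 \<le> g x y"
  shows "(\<lambda>(x, y). g x y) summable_on Sigma A B \<longleftrightarrow> (\<lambda>x. \<Sum>y\<in>B x. g x y) summable_on A"
proof
  assume "(\<lambda>(x, y). g x y) summable_on Sigma A B"
  then have "(\<lambda>x. infsum (\<lambda>y. g x y) (B x)) summable_on A"
    using summable_on_SigmaD[of "\<lambda>(x, y). g x y" A B] assms(1) by simp
  then show "(\<lambda>x. \<Sum>y\<in>B x. g x y) summable_on A"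
    by (rule summable_on_cong[THEN iffD1, rotated]) (simp add: assms(1))
next
  assume "(\<lambda>x. \<Sum>y\<in>B x. g x y) summable_on A"
  then show "(\<lambda>(x, y). g x y) summable_on Sigma A B"
    using assms by (intro summable_on_SigmaI[where g = "\<lambda>x. \<Sum>y\<in>B x. g x y"]) (auto simp: has_sum_finite)
qed

lemma incidence_summable:
  assumes X: "simp_complex X" and fin: "\<And>s. s \<in> cells X k \<Longrightarrow> finite (up X s)"
    and nonneg: "\<And>v s. (0::real) \<le> G v s"
  shows "(\<lambda>t. \<Sum>v\<in>t. G v (t - {v})) summable_on cells X (Suc k) \<longleftrightarrow>
    (\<lambda>s. \<Sum>v\<in>up X s. G v s) summable_on cells X k"
proof -
  have "(\<lambda>t. \<Sum>v\<in>t. G v (t - {v})) summable_on cells X (Suc k) \<longleftrightarrow>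
      (\<lambda>(t, v). G v (t - {v})) summable_on Sigma (cells X (Suc k)) (\<lambda>t. t)"
    using nonneg cells_finite[OF X] by (subst summable_on_Sigma_finite) auto
  also have "\<dots> \<longleftrightarrow> (\<lambda>(s, v). G v s) summable_on Sigma (cells X k) (up X)"
    using summable_on_reindex_bij_betw[OF incidence_bij[OF X, of k], of "\<lambda>(s, v). G v s"]
    by (simp add: case_prod_beta')
  also have "\<dots> \<longleftrightarrow> (\<lambda>s. \<Sum>v\<in>up X s. G v s) summable_on cells X k"
    using nonneg fin by (subst summable_on_Sigma_finite) auto
  finally show ?thesis .
qed

text \<open>Absolute summability permits summing the incidences in either order.\<close>

lemma incidence_infsum:
  fixes G :: "'v \<Rightarrow> 'v set \<Rightarrow> real"
  assumes X: "simp_complex X" and fin: "\<And>s. s \<in> cells X k \<Longrightarrow> finite (up X s)"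
    and summ: "(\<lambda>s. \<Sum>v\<in>up X s. \<bar>G v s\<bar>) summable_on cells X k"
  shows "infsum (\<lambda>t. \<Sum>v\<in>t. G v (t - {v})) (cells X (Suc k)) = infsum (\<lambda>s. \<Sum>v\<in>up X s. G v s) (cells X k)"
proof -
  have "(\<lambda>(s, v). \<bar>G v s\<bar>) summable_on Sigma (cells X k) (up X)"
    using summ fin by (subst summable_on_Sigma_finite) auto
  then have S: "(\<lambda>(s, v). G v s) summable_on Sigma (cells X k) (up X)"
    by (rule Infinite_Sum.abs_summable_summable[OF summable_on_cong[THEN iffD1], rotated]) auto
  then have T: "(\<lambda>(t, v). G v (t - {v})) summable_on Sigma (cells X (Suc k)) (\<lambda>t. t)"
    using summable_on_reindex_bij_betw[OF incidence_bij[OF X, of k], of "\<lambda>(s, v). G v s"]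
    by (simp add: case_prod_beta')
  have "infsum (\<lambda>t. \<Sum>v\<in>t. G v (t - {v})) (cells X (Suc k))
      = infsum (\<lambda>t. infsum (\<lambda>v. G v (t - {v})) t) (cells X (Suc k))"
    by (rule infsum_cong) (simp add: cells_finite[OF X])
  also have "\<dots> = infsum (\<lambda>(t, v). G v (t - {v})) (Sigma (cells X (Suc k)) (\<lambda>t. t))"
    using infsum_Sigma_banach[OF T] by simp
  also have "\<dots> = infsum (\<lambda>(s, v). G v s) (Sigma (cells X k) (up X))"
    using infsum_reindex_bij_betw[OF incidence_bij[OF X, of k], of "\<lambda>(s, v). G v s"]
    by (simp add: case_prod_beta')
  also have "\<dots> = infsum (\<lambda>s. infsum (\<lambda>v. G v s) (up X s)) (cells X k)"
    using infsum_Sigma_banach[OF S] by simp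
  also have "\<dots> = infsum (\<lambda>s. \<Sum>v\<in>up X s. G v s) (cells X k)"
    by (rule infsum_cong) (simp add: fin)
  finally show ?thesis .
qed

lemma bd_cellrep:
  "simp_complex X \<Longrightarrow> s \<in> cells X k \<Longrightarrow> bd X h (cellrep s) = (\<Sum>v\<in>up X s. h (v # cellrep s))"
  using cellrep_ocell[of X s k] cellrep[OF cells_finite, of X s k]
  by (simp add: bd_def up_def ocell_def)

lemma sum_faces:
  assumes "distinct xs"
  shows "(\<Sum>i<length xs. F (xs ! i) (set (ldel i xs))) = (\<Sum>v\<in>set xs. F v (set xs - {v}))"
proof -
  have "(\<Sum>v\<in>set xs. F v (set xs - {v})) = (\<Sum>i<length xs. F (xs ! i) (set xs - {xs ! i}))"
    by (rule sum.reindex_bij_betw[symmetric, OF bij_betw_nth]) (use assms in auto)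
  then show ?thesis using set_ldel[OF assms] by simp
qed

text \<open>Pointwise core of the adjointness: moving the deleted vertex to the front absorbs the
  sign, after which both factors can be reordered to the representative at once.\<close>

lemma mult_codiff:
  assumes h: "alternating h" and g: "alternating g" and xs: "distinct xs"
  shows "h xs * codiff g xs = (\<Sum>v\<in>set xs. h (v # cellrep (set xs - {v})) * g (cellrep (set xs - {v})))"
proof -
  have "h xs * codiff g xs = (\<Sum>i<length xs. h (xs ! i # ldel i xs) * g (ldel i xs))"
    unfolding codiff_def sum_distrib_left
    by (rule sum.cong) (simp_all add: alternating_move_to_front[OF h])
  also have "\<dots> = (\<Sum>i<length xs. h (xs ! i # cellrep (set (ldel i xs))) * g (cellrep (set (ldel i xs))))"
    using cellrep[of "set (ldel _ xs)"] distinct_ldel[OF xs]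
    by (intro sum.cong refl alternating_mult_reorder[OF alternating_Cons[OF h] g]) auto
  also have "\<dots> = (\<Sum>v\<in>set xs. h (v # cellrep (set xs - {v})) * g (cellrep (set xs - {v})))"
    by (rule sum_faces[OF xs])
  finally show ?thesis .
qed

lemma codiff_power2_le:
  assumes g: "alternating g" and xs: "distinct xs"
  shows "(codiff g xs)\<^sup>2 \<le> real (length xs) * (\<Sum>v\<in>set xs. (g (cellrep (set xs - {v})))\<^sup>2)"
proof -
  have "(codiff g xs)\<^sup>2 \<le> (\<Sum>i<length xs. ((-1) ^ i * g (ldel i xs))\<^sup>2) * real (card {..<length xs})"
    unfolding codiff_def by (rule sum_squared_le_sum_of_squares) 
  also have "(\<Sum>i<length xs. ((-1) ^ i * g (ldel i xs))\<^sup>2) = (\<Sum>i<length xs. (g (cellrep (set (ldel i xs))))\<^sup>2)"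
  proof (rule sum.cong[OF refl])
    fix i
    have "(g (ldel i xs))\<^sup>2 = (g (cellrep (set (ldel i xs))))\<^sup>2"
      using cellrep[of "set (ldel i xs)"] distinct_ldel[OF xs, of i]
      by (intro alternating_power2_reorder[OF g]) auto
    then show "((-1) ^ i * g (ldel i xs))\<^sup>2 = (g (cellrep (set (ldel i xs))))\<^sup>2"
      by (simp add: power_mult_distrib flip: power_mult)
  qed
  also have "\<dots> = (\<Sum>v\<in>set xs. (g (cellrep (set xs - {v})))\<^sup>2)"
    by (rule sum_faces[OF xs])
  finally show ?thesis by (simp add: mult.commute)
qed

text \<open>Cauchy-Schwarz over the \<open>Suc k\<close> facets of a cell. In the sum over all cells
  each facet is counted once per coface, which produces the weight on the right.\<close>

lemma codiff_bound:
  assumes X: "simp_complex X" and fin: "\<And>s. s \<in> cells X k \<Longrightarrow> finite (up X s)" and g: "alternating g"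
    and summ: "wsq_summable (cells X k) (\<lambda>s. real (card (up X s))) cellrep g"
  shows "wsq_summable (cells X (Suc k)) (\<lambda>_. 1) cellrep (codiff g)"
    "form_ip X (Suc k) (\<lambda>_. 1) (codiff g) (codiff g)
      \<le> real (Suc k) * form_ip X k (\<lambda>s. real (card (up X s))) g g"
proof -
  let ?G = "\<lambda>v s. (g (cellrep s))\<^sup>2"
  have le: "(codiff g (cellrep t))\<^sup>2 \<le> real (Suc k) * (\<Sum>v\<in>t. ?G v (t - {v}))"
    if t: "t \<in> cells X (Suc k)" for t
    using codiff_power2_le[OF g, of "cellrep t"] cellrep[OF cells_finite[OF X t]]
      cellrep_ocell[OF X t] by (simp add: ocell_def)
  have S: "(\<lambda>s. \<Sum>v\<in>up X s. ?G v s) summable_on cells X k"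
    using summ by (simp add: wsq_summable_def)
  then have T: "(\<lambda>t. real (Suc k) * (\<Sum>v\<in>t. ?G v (t - {v}))) summable_on cells X (Suc k)"
    using incidence_summable[OF X fin, where G = ?G] by (intro summable_on_cmult_right) auto
  show summ': "wsq_summable (cells X (Suc k)) (\<lambda>_. 1) cellrep (codiff g)"
    unfolding wsq_summable_def using le by (intro summable_on_nonneg_comparison[OF T]) auto
  have "form_ip X (Suc k) (\<lambda>_. 1) (codiff g) (codiff g)
      \<le> infsum (\<lambda>t. real (Suc k) * (\<Sum>v\<in>t. ?G v (t - {v}))) (cells X (Suc k))"
    unfolding wip_self using summ' le T by (intro infsum_mono) (auto simp: wsq_summable_def)
  also have "\<dots> = real (Suc k) * infsum (\<lambda>s. \<Sum>v\<in>up X s. ?G v s) (cells X k)"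
    using incidence_infsum[OF X fin, where G = ?G] S by (simp add: infsum_cmult_right')
  also have "infsum (\<lambda>s. \<Sum>v\<in>up X s. ?G v s) (cells X k) = form_ip X k (\<lambda>s. real (card (up X s))) g g"
    unfolding wip_self by simp
  finally show "form_ip X (Suc k) (\<lambda>_. 1) (codiff g) (codiff g)
      \<le> real (Suc k) * form_ip X k (\<lambda>s. real (card (up X s))) g g" .
qed

text \<open>Squares do not see the ordering, so each cell with \<open>Suc k\<close> vertices is
  counted once for every vertex that can be removed.\<close>

lemma up_square_sum:
  assumes X: "simp_complex X" and fin: "\<And>s. s \<in> cells X k \<Longrightarrow> finite (up X s)" and h: "alternating h"
    and summ: "wsq_summable (cells X (Suc k)) (\<lambda>_. 1) cellrep h"
  shows "(\<lambda>s. \<Sum>v\<in>up X s. (h (v # cellrep s))\<^sup>2) summable_on cells X k"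
    "infsum (\<lambda>s. \<Sum>v\<in>up X s. (h (v # cellrep s))\<^sup>2) (cells X k)
      = real (Suc k) * form_ip X (Suc k) (\<lambda>_. 1) h h"
proof -
  let ?G = "\<lambda>v s. (h (cellrep (insert v s)))\<^sup>2"
  have sq: "(h (v # cellrep s))\<^sup>2 = ?G v s" if s: "s \<in> cells X k" and v: "v \<in> up X s" for s v
    using cellrep[OF cells_finite[OF X s]] cellrep[of "insert v s"] cells_finite[OF X s] v
    by (intro alternating_power2_reorder[OF h]) (auto simp: up_def)
  have t: "(\<Sum>v\<in>t. ?G v (t - {v})) = real (Suc k) * (h (cellrep t))\<^sup>2"
    if "t \<in> cells X (Suc k)" for t
  proof -
    have "(\<Sum>v\<in>t. ?G v (t - {v})) = (\<Sum>v\<in>t. (h (cellrep t))\<^sup>2)"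
      by (rule sum.cong) (auto simp: insert_absorb)
    then show ?thesis using that by (simp add: cells_def)
  qed
  have T: "(\<lambda>t. \<Sum>v\<in>t. ?G v (t - {v})) summable_on cells X (Suc k)"
    using summ t unfolding wsq_summable_def
    by (subst summable_on_cong[OF t]) (auto intro: summable_on_cmult_right)
  then have S: "(\<lambda>s. \<Sum>v\<in>up X s. ?G v s) summable_on cells X k"
    using incidence_summable[OF X fin, where G = ?G] by auto
  then show "(\<lambda>s. \<Sum>v\<in>up X s. (h (v # cellrep s))\<^sup>2) summable_on cells X k"
    by (rule summable_on_cong[THEN iffD1, rotated]) (simp add: sq)
  have "infsum (\<lambda>s. \<Sum>v\<in>up X s. (h (v # cellrep s))\<^sup>2) (cells X k) = infsum (\<lambda>s. \<Sum>v\<in>up X s. ?G v s) (cells X k)"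
    by (rule infsum_cong) (simp add: sq)
  also have "\<dots> = infsum (\<lambda>t. \<Sum>v\<in>t. ?G v (t - {v})) (cells X (Suc k))"
    using incidence_infsum[OF X fin, where G = ?G] S by simp
  also have "\<dots> = infsum (\<lambda>t. real (Suc k) * (h (cellrep t))\<^sup>2) (cells X (Suc k))"
    by (rule infsum_cong) (rule t)
  also have "\<dots> = real (Suc k) * form_ip X (Suc k) (\<lambda>_. 1) h h"
    by (simp add: wip_self infsum_cmult_right')
  finally show "infsum (\<lambda>s. \<Sum>v\<in>up X s. (h (v # cellrep s))\<^sup>2) (cells X k)
      = real (Suc k) * form_ip X (Suc k) (\<lambda>_. 1) h h" .
qed

text \<open>Cauchy-Schwarz over the vertices above \<open>s\<close> costs a factor
  \<open>card (up X s)\<close>, which the weight cancels; the constant is therefore free of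
  degrees.\<close>

lemma bd_bound:
  assumes X: "simp_complex X" and fin: "\<And>s. s \<in> cells X k \<Longrightarrow> finite (up X s)" and h: "alternating h"
    and summ: "wsq_summable (cells X (Suc k)) (\<lambda>_. 1) cellrep h"
  shows "wsq_summable (cells X k) (\<lambda>s. 1 / real (card (up X s))) cellrep (bd X h)"
    "form_ip X k (\<lambda>s. 1 / real (card (up X s))) (bd X h) (bd X h)
      \<le> real (Suc k) * form_ip X (Suc k) (\<lambda>_. 1) h h"
proof -
  note sums = up_square_sum[OF X fin h summ]
  have le: "1 / real (card (up X s)) * (bd X h (cellrep s))\<^sup>2 \<le> (\<Sum>v\<in>up X s. (h (v # cellrep s))\<^sup>2)"
    if s: "s \<in> cells X k" for s
  proof (cases "up X s = {}")
    \<comment> \<open>The weight is \<open>1 / 0 = 0\<close> here.\<close>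
    case True
    then show ?thesis by simp
  next
    case False
    then have "real (card (up X s)) > 0" using fin[OF s] by (simp add: card_gt_0_iff)
    moreover have "(bd X h (cellrep s))\<^sup>2 \<le> (\<Sum>v\<in>up X s. (h (v # cellrep s))\<^sup>2) * real (card (up X s))"
      unfolding bd_cellrep[OF X s] by (rule sum_squared_le_sum_of_squares)
    ultimately show ?thesis by (simp add: field_simps)
  qed
  show summ': "wsq_summable (cells X k) (\<lambda>s. 1 / real (card (up X s))) cellrep (bd X h)"
    unfolding wsq_summable_def using le by (intro summable_on_nonneg_comparison[OF sums(1)]) auto
  have "form_ip X k (\<lambda>s. 1 / real (card (up X s))) (bd X h) (bd X h)
      \<le> infsum (\<lambda>s. \<Sum>v\<in>up X s. (h (v # cellrep s))\<^sup>2) (cells X k)"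
    unfolding wip_self using summ' sums(1) le unfolding wsq_summable_def by (intro infsum_mono) auto
  then show "form_ip X k (\<lambda>s. 1 / real (card (up X s))) (bd X h) (bd X h)
      \<le> real (Suc k) * form_ip X (Suc k) (\<lambda>_. 1) h h" using sums(2) by simp
qed

text \<open>Both sides sum \<open>h (v # cellrep s) * g (cellrep s)\<close> over all incidences;
  bounding products by squares gives the absolute summability that the reindexing requires.\<close>

lemma bd_codiff_adjoint:
  assumes X: "simp_complex X" and fin: "\<And>s. s \<in> cells X k \<Longrightarrow> finite (up X s)"
    and h: "alternating h" "wsq_summable (cells X (Suc k)) (\<lambda>_. 1) cellrep h"
    and g: "alternating g" "wsq_summable (cells X k) (\<lambda>s. real (card (up X s))) cellrep g"
  shows "form_ip X (Suc k) (\<lambda>_. 1) h (codiff g) = form_ip X k (\<lambda>_. 1) (bd X h) g"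
proof -
  let ?G = "\<lambda>v s. h (v # cellrep s) * g (cellrep s)"
  have "(\<lambda>s. \<Sum>v\<in>up X s. \<bar>?G v s\<bar>) summable_on cells X k"
  proof (rule summable_on_nonneg_comparison)
    show "(\<lambda>s. (\<Sum>v\<in>up X s. (h (v # cellrep s))\<^sup>2) + real (card (up X s)) * (g (cellrep s))\<^sup>2) summable_on cells X k"
      using up_square_sum(1)[OF X fin h] g(2) unfolding wsq_summable_def by (intro summable_on_add) auto
    fix s assume "s \<in> cells X k"
    have ab: "\<bar>a * b\<bar> \<le> a\<^sup>2 + b\<^sup>2" for a b :: real
    proof -
      have "2 * (\<bar>a\<bar> * \<bar>b\<bar>) \<le> a\<^sup>2 + b\<^sup>2"
        using sum_squares_bound[of "\<bar>a\<bar>" "\<bar>b\<bar>"] by (simp add: mult.assoc)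
      moreover have "0 \<le> \<bar>a\<bar> * \<bar>b\<bar>" by simp
      ultimately show ?thesis unfolding abs_mult by linarith
    qed
    have "(\<Sum>v\<in>up X s. \<bar>?G v s\<bar>) \<le> (\<Sum>v\<in>up X s. (h (v # cellrep s))\<^sup>2 + (g (cellrep s))\<^sup>2)"
      by (intro sum_mono ab)
    then show "(\<Sum>v\<in>up X s. \<bar>?G v s\<bar>)
        \<le> (\<Sum>v\<in>up X s. (h (v # cellrep s))\<^sup>2) + real (card (up X s)) * (g (cellrep s))\<^sup>2"
      by (simp add: sum.distrib)
  qed (simp add: sum_nonneg)
  from incidence_infsum[OF X fin this]
  have eq: "infsum (\<lambda>t. \<Sum>v\<in>t. ?G v (t - {v})) (cells X (Suc k)) = infsum (\<lambda>s. \<Sum>v\<in>up X s. ?G v s) (cells X k)"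
    by simp
  have "form_ip X (Suc k) (\<lambda>_. 1) h (codiff g) = infsum (\<lambda>t. \<Sum>v\<in>t. ?G v (t - {v})) (cells X (Suc k))"
    unfolding wip_def
  proof (rule infsum_cong)
    fix t assume t: "t \<in> cells X (Suc k)"
    show "1 * (h (cellrep t) * codiff g (cellrep t)) = (\<Sum>v\<in>t. ?G v (t - {v}))"
      using mult_codiff[OF h(1) g(1), of "cellrep t"] cellrep[OF cells_finite[OF X t]] by simp
  qed
  also note eq
  also have "infsum (\<lambda>s. \<Sum>v\<in>up X s. ?G v s) (cells X k) = form_ip X k (\<lambda>_. 1) (bd X h) g"
    unfolding wip_def by (rule infsum_cong) (simp add: bd_cellrep[OF X] sum_distrib_right)
  finally show ?thesis .
qed

lemma alternating_bd:
  assumes "alternating h"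
  shows "alternating (bd X h)"
  unfolding alternating_def
proof (intro allI impI)
  fix xs :: "'a list" and i j assume ij: "i < length xs \<and> j < length xs \<and> i \<noteq> j"
  have "h (v # lswap xs i j) = - h (v # xs)" for v
    using alternatingD[OF alternating_Cons[OF assms], of i xs j] ij by blast
  then show "bd X h (lswap xs i j) = - bd X h xs"
    using ij by (simp add: bd_def sum_negf)
qed

lemma is_form_bd:
  assumes "is_form X (Suc k) h"
  shows "is_form X k (bd X h)"
  unfolding is_form_iff
proof (intro conjI allI impI alternating_bd is_form_alternating[OF assms])
  fix xs assume nz: "bd X h xs \<noteq> 0"
  then have oc: "ocell X (length xs) xs" by (auto simp: bd_def split: if_splits)
  from nz obtain v where "h (v # xs) \<noteq> 0"
    unfolding bd_def by (metis (mono_tags, lifting) sum.neutral)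
  then have "length xs = k" using assms unfolding is_form_def ocell_def by fastforce
  then show "ocell X k xs" using oc by simp
qed

lemma is_form_codiff:
  assumes "alternating g"
  shows "is_form X k (\<lambda>xs. if ocell X k xs then codiff g xs else 0)"
  using alternating_codiff[OF assms] by (simp add: is_form_def alternating_def)

lemma alternating_divide_set: "alternating f \<Longrightarrow> alternating (\<lambda>ys. f ys / c (set ys))"
  by (simp add: alternating_def)

lemma delta2_eq:
  "delta2 X d f = (\<lambda>xs. if ocell X (Suc d) xs then codiff (\<lambda>ys. f ys / real (deg X (set ys))) xs else 0)"
  by (auto simp: delta2_def codiff_def ocell_def fun_eq_iff)

lemma delta1_eq:
  "delta1 X d g = (\<lambda>xs. if ocell X d xs then real (deg X (set xs)) * codiff g xs else 0)"
  by (auto simp: delta1_def codiff_def ocell_def fun_eq_iff)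

lemma is_form_delta2: "is_form X d f \<Longrightarrow> is_form X (Suc d) (delta2 X d f)"
  unfolding delta2_eq by (intro is_form_codiff alternating_divide_set is_form_alternating)

lemma is_form_delta1: "is_form X k g \<Longrightarrow> is_form X d (delta1 X d g)"
  using alternating_codiff[OF is_form_alternating[of X k g]]
  by (simp add: delta1_eq is_form_def alternating_def)

lemma bd_lin: "bd X (\<lambda>x. a * f x + b * g x) = (\<lambda>x. a * bd X f x + b * bd X g x)"
  by (auto simp: bd_def sum.distrib sum_distrib_left fun_eq_iff)

lemma codiff_lin: "codiff (\<lambda>x. a * f x + b * g x) xs = a * codiff f xs + b * codiff g xs"
  by (simp add: codiff_def sum.distrib sum_distrib_left algebra_simps)

lemma delta2_lin: "delta2 X d (\<lambda>x. a * f x + b * g x) = (\<lambda>x. a * delta2 X d f x + b * delta2 X d g x)"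
  by (auto simp: delta2_eq fun_eq_iff add_divide_distrib simp flip: codiff_lin)

lemma delta1_lin: "delta1 X d (\<lambda>x. a * f x + b * g x) = (\<lambda>x. a * delta1 X d f x + b * delta1 X d g x)"
  by (auto simp: delta1_eq fun_eq_iff codiff_lin algebra_simps)

lemma upper_lap_lin:
  "upper_lap X d (\<lambda>x. a * f x + b * g x) = (\<lambda>x. a * upper_lap X d f x + b * upper_lap X d g x)"
  by (simp add: upper_lap_def delta2_lin bd_lin)

lemma codiff_cong:
  "(\<And>i. i < length xs \<Longrightarrow> f (ldel i xs) = g (ldel i xs)) \<Longrightarrow> codiff f xs = codiff g xs"
  by (simp add: codiff_def)

lemma ocell_ldel:
  assumes "simp_complex X" "ocell X (Suc k) xs" "i < Suc k"
  shows "ocell X k (ldel i xs)"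
  using assms simp_complex_subset[OF assms(1) _ set_ldel_subset[of i xs]]
  by (auto simp: ocell_def distinct_ldel length_ldel)

lemma wip_cong:
  "(\<And>s. s \<in> A \<Longrightarrow> w s * (f (r s) * g (r s)) = w' s * (f' (r s) * g' (r s))) \<Longrightarrow> wip A w r f g = wip A w' r f' g'"
  unfolding wip_def by (rule infsum_cong)

lemma wsq_summable_cong:
  "(\<And>s. s \<in> A \<Longrightarrow> w s * (f (r s))\<^sup>2 = w' s * (f' (r s))\<^sup>2) \<Longrightarrow> wsq_summable A w r f \<longleftrightarrow> wsq_summable A w' r f'"
  unfolding wsq_summable_def by (rule summable_on_cong)

lemma lswap_permute_list:
  "i < length xs \<Longrightarrow> j < length xs \<Longrightarrow> lswap xs i j = permute_list (Transposition.transpose i j) xs"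
  by (intro nth_equalityI) (auto simp: nth_lswap permute_list_def Transposition.transpose_def)

text \<open>The signed indicator of one cell. Summing signs over all permutations that carry
  \<open>c\<close> to \<open>xs\<close> avoids choosing a sign: the sum is empty unless
  \<open>xs\<close> reorders \<open>c\<close>, and then it has exactly one term.\<close>

lemma elementary_form:
  assumes s: "s \<in> cells X k" "finite s"
  obtains f where "is_form X k f" "\<And>xs. f xs \<noteq> 0 \<Longrightarrow> set xs = s"
    "\<And>xs. distinct xs \<Longrightarrow> set xs = s \<Longrightarrow> (f xs)\<^sup>2 = 1"
proof -
  define c where "c = cellrep s"
  have c: "distinct c" "set c = s" "length c = k"
    using cellrep[OF s(2)] s distinct_card[of c] by (auto simp: c_def cells_def)
  define P where "P xs = {p. p permutes {..<k} \<and> xs = permute_list p c}" for xs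
  define f :: "'a list \<Rightarrow> real" where "f xs = (\<Sum>p\<in>P xs. of_int (sign p))" for xs
  have P_props: "length xs = k \<and> distinct xs \<and> set xs = s" if "P xs \<noteq> {}" for xs
    using that c by (auto simp: P_def)
  have supp: "length xs = k \<and> distinct xs \<and> set xs = s" if "f xs \<noteq> 0" for xs
    using P_props[of xs] that by (metis f_def sum.empty)
  have alt: "f (lswap xs i j) = - f xs" if ij: "i < length xs" "j < length xs" "i \<noteq> j" for xs i j
  proof (cases "length xs = k")
    case True
    let ?t = "Transposition.transpose i j"
    have t: "?t permutes {..<k}" using ij True by (intro permutes_swap_id) auto
    have mem: "p \<circ> ?t \<in> P (lswap ys i j)" if "p \<in> P ys" "length ys = k" for p ys
    proof -
      have "permute_list (p \<circ> ?t) c = permute_list ?t (permute_list p c)"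
        using t c by (intro permute_list_compose) auto
      then show ?thesis
        using that t ij True by (auto simp: P_def lswap_permute_list intro: permutes_compose)
    qed
    have inv: "lswap (lswap xs i j) i j = xs"
      using ij by (intro nth_equalityI) (auto simp: nth_lswap)
    \<comment> \<open>Composition with the transposition is a bijection between the permutations
      belonging to the two lists, and it reverses every sign.\<close>
    have "f (lswap xs i j) = (\<Sum>p\<in>P xs. of_int (sign (p \<circ> ?t)))"
      unfolding f_def
      by (rule sum.reindex_bij_witness[where i = "\<lambda>p. p \<circ> ?t" and j = "\<lambda>p. p \<circ> ?t"])
        (use mem[of _ xs] mem[of _ "lswap xs i j"] inv True in \<open>auto simp: o_assoc[symmetric]\<close>)
    also have "\<dots> = (\<Sum>p\<in>P xs. - of_int (sign p))"
    proof (rule sum.cong[OF refl])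
      fix p assume "p \<in> P xs"
      then have "permutation p" "permutation ?t"
        using t by (auto simp: P_def intro: permutation_permutes[THEN iffD2])
      then show "of_int (sign (p \<circ> ?t)) = - (of_int (sign p) :: real)"
        using ij(3) by (simp add: sign_compose sign_swap_id)
    qed
    finally show ?thesis by (simp add: f_def sum_negf)
  next
    case False
    then show ?thesis using supp[of xs] supp[of "lswap xs i j"] by force
  qed
  have form: "is_form X k f"
    unfolding is_form_def using supp alt s by (auto simp: ocell_def cells_def)
  have "P c = {id}"
  proof
    show "{id} \<subseteq> P c" by (simp add: P_def permutes_id)
    show "P c \<subseteq> {id}"
    proof
      fix p assume p: "p \<in> P c"
      have "p i = i" for i
      proof (cases "i < k")
        case True
        then have "c ! i = c ! p i" "p i < k"
          using p c permute_list_nth[of p c i] permutes_in_image[of p "{..<k}" i] by (auto simp: P_def)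
        then show ?thesis using c True nth_eq_iff_index_eq by metis
      next
        case False
        then show ?thesis using p by (auto simp: P_def permutes_def)
      qed
      then show "p \<in> {id}" by auto
    qed
  qed
  then have "f c = 1" by (simp add: f_def)
  then have "(f xs)\<^sup>2 = 1" if "distinct xs" "set xs = s" for xs
    using alternating_power2_reorder[OF is_form_alternating[OF form], of xs c] that c by simp
  then show ?thesis using that[OF form] supp by blast
qed

section \<open>The upper Laplacian on weighted square summable forms\<close>

locale upper_complex =
  fixes X :: "'v set set" and d :: nat
  assumes X: "simp_complex X"
    and fin_up: "s \<in> cells X d \<Longrightarrow> finite (up X s)"
    and up_ne: "s \<in> cells X d \<Longrightarrow> up X s \<noteq> {}"
begin

abbreviation w where "w \<equiv> \<lambda>s. 1 / real (deg X s)"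
abbreviation one :: "'v set \<Rightarrow> real" where "one \<equiv> \<lambda>_. 1"

lemma deg_eq: "s \<in> cells X d \<Longrightarrow> deg X s = card (up X s)"
  using deg_up cells_finite[OF X] by blast

text \<open>\<open>card\<close> of an infinite set is 0, so it takes finiteness and nonemptiness of
  \<open>up\<close> together to keep the weight \<open>1 / deg\<close> positive.\<close>

lemma deg_pos: "s \<in> cells X d \<Longrightarrow> 0 < real (deg X s)"
  using fin_up up_ne by (simp add: deg_eq card_gt_0_iff)

lemma inner_w_eq: "inner_w X d = form_ip X d w"
  by (simp add: inner_w_def wip_def fun_eq_iff)

lemma norm_w_eq: "norm_w X d = (\<lambda>f. sqrt (form_ip X d w f f))"
  by (simp add: norm_w_def wip_self fun_eq_iff)

lemma L2w_eq: "L2w X d = form_space X d w"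
  by (simp add: L2w_def form_space_def wsq_summable_def)

lemma w_pos: "s \<in> cells X d \<Longrightarrow> 0 < w s"
  using deg_pos by simp

sublocale L: hilbert_fun "form_space X d w" "form_ip X d w"
  by (rule hilbert_fun_forms[OF X w_pos]) (auto intro: form_space_zero form_space_lin)

text \<open>Since \<open>deg * (f / deg)\<^sup>2 = f\<^sup>2 / deg\<close>, dividing by degrees
  turns the weight required by \<open>codiff_bound\<close> into the weight of the space. This makes
  the bound for \<open>delta2\<close> independent of the degrees.\<close>

lemma scaled_summable:
  assumes "f \<in> form_space X d w"
  shows "wsq_summable (cells X d) (\<lambda>s. real (card (up X s))) cellrep (\<lambda>ys. f ys / real (deg X (set ys)))"
    "form_ip X d (\<lambda>s. real (card (up X s))) (\<lambda>ys. f ys / real (deg X (set ys))) (\<lambda>ys. f ys / real (deg X (set ys)))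
      = form_ip X d w f f"
proof -
  have eq: "real (card (up X s)) * (f (cellrep s) / real (deg X (set (cellrep s))))\<^sup>2 = w s * (f (cellrep s))\<^sup>2"
    if "s \<in> cells X d" for s
    using deg_pos[OF that] cellrep[OF cells_finite[OF X that]] deg_eq[OF that]
    by (simp add: power_divide power2_eq_square)
  show "wsq_summable (cells X d) (\<lambda>s. real (card (up X s))) cellrep (\<lambda>ys. f ys / real (deg X (set ys)))"
  proof -
    have "wsq_summable (cells X d) (\<lambda>s. real (card (up X s))) cellrep (\<lambda>ys. f ys / real (deg X (set ys)))
        \<longleftrightarrow> wsq_summable (cells X d) w cellrep f"
      by (rule wsq_summable_cong) (rule eq)
    then show ?thesis using assms by (simp add: form_space_def)
  qed
  show "form_ip X d (\<lambda>s. real (card (up X s))) (\<lambda>ys. f ys / real (deg X (set ys))) (\<lambda>ys. f ys / real (deg X (set ys)))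
      = form_ip X d w f f"
    using eq by (intro wip_cong) (simp add: power2_eq_square)
qed

lemma form_space_alternating: "f \<in> form_space X k v \<Longrightarrow> alternating f"
  by (auto simp: form_space_def intro: is_form_alternating)

lemma delta2_cellrep:
  "t \<in> cells X (Suc d) \<Longrightarrow>
    delta2 X d f (cellrep t) = codiff (\<lambda>ys. f ys / real (deg X (set ys))) (cellrep t)"
  using cellrep_ocell[OF X] by (simp add: delta2_eq)

lemma delta2_mem:
  assumes f: "f \<in> form_space X d w"
  shows "delta2 X d f \<in> form_space X (Suc d) one"
    "form_ip X (Suc d) one (delta2 X d f) (delta2 X d f) \<le> real (Suc d) * form_ip X d w f f"
proof -
  let ?g = "\<lambda>ys. f ys / real (deg X (set ys))"
  have g: "alternating ?g"
    using alternating_divide_set[OF form_space_alternating[OF f], of "\<lambda>s. real (deg X s)"] .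
  note bound = codiff_bound[OF X fin_up g scaled_summable(1)[OF f]]
  have "wsq_summable (cells X (Suc d)) one cellrep (delta2 X d f)"
    using bound(1) by (subst wsq_summable_cong[where w' = one and f' = "codiff ?g"]) (simp_all add: delta2_cellrep)
  then show "delta2 X d f \<in> form_space X (Suc d) one"
    using f by (simp add: form_space_def is_form_delta2)
  have "form_ip X (Suc d) one (delta2 X d f) (delta2 X d f) = form_ip X (Suc d) one (codiff ?g) (codiff ?g)"
    by (rule wip_cong) (simp add: delta2_cellrep)
  then show "form_ip X (Suc d) one (delta2 X d f) (delta2 X d f) \<le> real (Suc d) * form_ip X d w f f"
    using bound(2) scaled_summable(2)[OF f] by simp
qed

lemma bd_mem:
  assumes h: "h \<in> form_space X (Suc d) one"
  shows "bd X h \<in> form_space X d w"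
    "form_ip X d w (bd X h) (bd X h) \<le> real (Suc d) * form_ip X (Suc d) one h h"
proof -
  have "wsq_summable (cells X (Suc d)) one cellrep h" using h by (simp add: form_space_def)
  note bound = bd_bound[OF X fin_up form_space_alternating[OF h] this]
  have "wsq_summable (cells X d) w cellrep (bd X h)"
    using bound(1) by (subst wsq_summable_cong[where w' = "\<lambda>s. 1 / real (card (up X s))" and f' = "bd X h"])
      (simp_all add: deg_eq)
  then show "bd X h \<in> form_space X d w"
    using h by (simp add: form_space_def is_form_bd)
  have "form_ip X d w (bd X h) (bd X h) = form_ip X d (\<lambda>s. 1 / real (card (up X s))) (bd X h) (bd X h)"
    by (rule wip_cong) (simp add: deg_eq)
  then show "form_ip X d w (bd X h) (bd X h) \<le> real (Suc d) * form_ip X (Suc d) one h h"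
    using bound(2) by simp
qed

text \<open>The division by degrees inside \<open>delta2\<close> and the weight
  \<open>1 / deg\<close> are the same factor, which reduces the claim to unweighted
  adjointness.\<close>

lemma bd_delta2_adjoint:
  assumes h: "h \<in> form_space X (Suc d) one" and f: "f \<in> form_space X d w"
  shows "form_ip X d w (bd X h) f = form_ip X (Suc d) one h (delta2 X d f)"
proof -
  let ?g = "\<lambda>ys. f ys / real (deg X (set ys))"
  have g: "alternating ?g"
    using alternating_divide_set[OF form_space_alternating[OF f], of "\<lambda>s. real (deg X s)"] .
  have hs: "wsq_summable (cells X (Suc d)) one cellrep h" using h by (simp add: form_space_def)
  have "form_ip X (Suc d) one h (delta2 X d f) = form_ip X (Suc d) one h (codiff ?g)"
    by (rule wip_cong) (simp add: delta2_cellrep)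
  also have "\<dots> = form_ip X d one (bd X h) ?g"
    by (rule bd_codiff_adjoint[OF X fin_up form_space_alternating[OF h] hs g scaled_summable(1)[OF f]])
  also have "\<dots> = form_ip X d w (bd X h) f"
    using cellrep[OF cells_finite[OF X]] by (intro wip_cong) simp
  finally show ?thesis ..
qed

lemma upper_lap_mem: "f \<in> form_space X d w \<Longrightarrow> upper_lap X d f \<in> form_space X d w"
  unfolding upper_lap_def by (intro bd_mem(1) delta2_mem(1))

lemma upper_lap_form:
  "f \<in> form_space X d w \<Longrightarrow> g \<in> form_space X d w \<Longrightarrow>
    form_ip X d w (upper_lap X d f) g = form_ip X (Suc d) one (delta2 X d f) (delta2 X d g)"
  unfolding upper_lap_def by (intro bd_delta2_adjoint delta2_mem(1))

lemma upper_lap_sym: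
  "f \<in> form_space X d w \<Longrightarrow> g \<in> form_space X d w \<Longrightarrow>
    form_ip X d w (upper_lap X d f) g = form_ip X d w f (upper_lap X d g)"
  using upper_lap_form[of f g] upper_lap_form[of g f] L.form_sym[OF _ upper_lap_mem, of f g]
    wip_sym[of "cells X (Suc d)" one cellrep "delta2 X d f"] by simp

lemma upper_lap_nonneg: "f \<in> form_space X d w \<Longrightarrow> 0 \<le> form_ip X d w (upper_lap X d f) f"
  by (simp add: upper_lap_form wip_nonneg)

lemma upper_lap_bounded:
  assumes f: "f \<in> form_space X d w"
  shows "sqrt (form_ip X d w (upper_lap X d f) (upper_lap X d f)) \<le> real (Suc d) * sqrt (form_ip X d w f f)"
proof -
  have "form_ip X d w (upper_lap X d f) (upper_lap X d f) \<le> real (Suc d) * (real (Suc d) * form_ip X d w f f)"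
    unfolding upper_lap_def
    using bd_mem(2)[OF delta2_mem(1)[OF f]] mult_left_mono[OF delta2_mem(2)[OF f], of "real (Suc d)"] by linarith
  then have "sqrt (form_ip X d w (upper_lap X d f) (upper_lap X d f)) \<le> sqrt ((real (Suc d))\<^sup>2 * form_ip X d w f f)"
    by (intro real_sqrt_le_mono) (simp add: power2_eq_square mult.assoc)
  then show ?thesis by (simp add: real_sqrt_mult)
qed

text \<open>The whole space is treated besides \<open>Zspace X d\<close> because truncated forms
  leave the latter.\<close>

sublocale L: positive_operator "form_space X d w" "form_ip X d w" "upper_lap X d" "real (Suc d)"
  by unfold_locales (use upper_lap_mem upper_lap_sym upper_lap_nonneg upper_lap_bounded in \<open>auto simp: upper_lap_lin\<close>)

text \<open>The degree factor of \<open>delta1\<close> cancels the division in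
  \<open>delta2\<close>, leaving a double \<open>codiff\<close>.\<close>

lemma delta2_delta1: "delta2 X d (delta1 X d g) = (\<lambda>_. 0)"
proof
  fix xs
  show "delta2 X d (delta1 X d g) xs = 0"
  proof (cases "ocell X (Suc d) xs")
    case True
    have "codiff (\<lambda>ys. delta1 X d g ys / real (deg X (set ys))) xs = codiff (codiff g) xs"
    proof (rule codiff_cong)
      fix i assume "i < length xs"
      then have oc: "ocell X d (ldel i xs)" using ocell_ldel[OF X True] True by (simp add: ocell_def)
      then show "delta1 X d g (ldel i xs) / real (deg X (set (ldel i xs))) = codiff g (ldel i xs)"
        using deg_pos[OF ocell_cells[OF oc]] by (simp add: delta1_eq)
    qed
    then show ?thesis using True by (simp add: delta2_eq codiff_codiff)
  qed (simp add: delta2_eq)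
qed

lemma Zspace_subset: "Zspace X d \<subseteq> form_space X d w"
  by (auto simp: Zspace_def L2w_eq)

lemma Bspace_subset: "Bspace X d \<subseteq> form_space X d w"
  by (auto simp: Bspace_def L2w_eq)

text \<open>Adjointness moves the boundary onto the coboundary \<open>b\<close>, where
  \<open>delta2_delta1\<close> annihilates it.\<close>

lemma bd_in_Zspace:
  assumes h: "h \<in> form_space X (Suc d) one"
  shows "bd X h \<in> Zspace X d"
proof -
  have "form_ip X d w (bd X h) b = 0" if b: "b \<in> Bspace X d" for b
  proof -
    have "delta2 X d b = (\<lambda>_. 0)" using b delta2_delta1 by (auto simp: Bspace_def)
    then show ?thesis
      using bd_delta2_adjoint[OF h, of b] b Bspace_subset by (auto simp: wip_def)
  qed
  then show ?thesis using bd_mem(1)[OF h] by (simp add: Zspace_def L2w_eq inner_w_eq)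
qed

lemma upper_lap_in_Zspace: "f \<in> form_space X d w \<Longrightarrow> upper_lap X d f \<in> Zspace X d"
  unfolding upper_lap_def by (intro bd_in_Zspace delta2_mem(1))

sublocale Z: positive_operator "Zspace X d" "form_ip X d w" "upper_lap X d" "real (Suc d)"
proof -
  have lin: "(\<lambda>x. a * f x + b * g x) \<in> Zspace X d" if "f \<in> Zspace X d" "g \<in> Zspace X d" for f g a b
  proof -
    have fg: "f \<in> form_space X d w" "g \<in> form_space X d w" using that Zspace_subset by auto
    then have "form_ip X d w (\<lambda>x. a * f x + b * g x) c = 0" if "c \<in> Bspace X d" for c
      using L.form_lin[OF fg, of c a b] that \<open>f \<in> Zspace X d\<close> \<open>g \<in> Zspace X d\<close> Bspace_subset
      by (auto simp: Zspace_def inner_w_eq)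
    then show ?thesis using L.lin_mem[OF fg] by (simp add: Zspace_def L2w_eq inner_w_eq)
  qed
  have zero: "(\<lambda>_. 0) \<in> Zspace X d"
    by (simp add: Zspace_def L2w_eq form_space_zero inner_w_eq wip_def)
  have hilbert: "hilbert_fun (Zspace X d) (form_ip X d w)"
  proof (rule hilbert_fun_forms[OF X w_pos Zspace_subset zero lin])
    fix F :: "nat \<Rightarrow> 'v list \<Rightarrow> real" and f
    assume F: "\<And>n. F n \<in> Zspace X d" and f: "f \<in> form_space X d w"
      and tends: "\<forall>e>0. \<exists>N. \<forall>n\<ge>N. sqrt (form_ip X d w (\<lambda>x. F n x - f x) (\<lambda>x. F n x - f x)) < e"
    have "form_ip X d w f b = 0" if b: "b \<in> Bspace X d" for b
    proof (rule ccontr)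
      assume nz: "form_ip X d w f b \<noteq> 0"
      \<comment> \<open>One is added so that division by \<open>K\<close> makes sense even when
        \<open>b\<close> has norm 0.\<close>
      define K where "K = sqrt (form_ip X d w b b) + 1"
      have bL: "b \<in> form_space X d w" using b Bspace_subset by blast
      have K: "K > 0" using L.form_nonneg[OF bL] by (simp add: K_def add_nonneg_pos)
      obtain n where n: "sqrt (form_ip X d w (\<lambda>x. F n x - f x) (\<lambda>x. F n x - f x)) < \<bar>form_ip X d w f b\<bar> / K"
        using tends[rule_format, of "\<bar>form_ip X d w f b\<bar> / K"] nz K by auto
      have Fn: "F n \<in> form_space X d w" "form_ip X d w (F n) b = 0"
        using F[of n] b Zspace_subset by (auto simp: Zspace_def inner_w_eq)
      have "\<bar>form_ip X d w f b\<bar> = \<bar>form_ip X d w (\<lambda>x. F n x - f x) b\<bar>"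
        using L.form_diff_left[OF Fn(1) f bL, of 1] Fn(2) by simp
      also have "\<dots> \<le> sqrt (form_ip X d w (\<lambda>x. F n x - f x) (\<lambda>x. F n x - f x)) * sqrt (form_ip X d w b b)"
        using L.cauchy_schwarz_sqrt[OF L.diff_mem[OF Fn(1) f] bL] .
      also have "\<dots> \<le> sqrt (form_ip X d w (\<lambda>x. F n x - f x) (\<lambda>x. F n x - f x)) * K"
        using L.form_nonneg[OF L.diff_mem[OF Fn(1) f]] by (intro mult_left_mono) (auto simp: K_def)
      also have "\<dots> < \<bar>form_ip X d w f b\<bar>"
        using n K by (simp add: pos_less_divide_eq)
      finally show False by simp
    qed
    then show "f \<in> Zspace X d" using f by (simp add: Zspace_def L2w_eq inner_w_eq)
  qed
  interpret hilbert_fun "Zspace X d" "form_ip X d w" by (rule hilbert)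
  show "positive_operator (Zspace X d) (form_ip X d w) (upper_lap X d) (real (Suc d))"
  proof
    show "upper_lap X d f \<in> Zspace X d" if "f \<in> Zspace X d" for f
      using that Zspace_subset upper_lap_in_Zspace by blast
    show "form_ip X d w (upper_lap X d f) g = form_ip X d w f (upper_lap X d g)"
      if "f \<in> Zspace X d" "g \<in> Zspace X d" for f g
      using that Zspace_subset by (intro upper_lap_sym) auto
    show "0 \<le> form_ip X d w (upper_lap X d f) f" if "f \<in> Zspace X d" for f
      using that Zspace_subset by (intro upper_lap_nonneg) auto
    show "sqrt (form_ip X d w (upper_lap X d f) (upper_lap X d f)) \<le> real (Suc d) * sqrt (form_ip X d w f f)"
      if "f \<in> Zspace X d" for f
      using that Zspace_subset by (intro upper_lap_bounded) auto
  qed (simp_all add: upper_lap_lin)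
qed

lemma spec_Z_eq: "spec_Z X d = Z.spec"
  by (simp add: spec_Z_def norm_w_eq)

lemma spectral_gap_le_rayleigh:
  "f \<in> Zspace X d \<Longrightarrow> spectral_gap X d * form_ip X d w f f \<le> form_ip X d w (upper_lap X d f) f"
  using Z.Inf_spec_le_rayleigh by (simp add: spectral_gap_def spec_Z_eq)

text \<open>The boundary of the signed indicator of a d-cell takes the value 1 or -1 on a facet, as
  no other coface of the facet carries the indicator. This secures a nonempty spectrum, without
  which its \<open>Inf\<close> would carry no information.\<close>

lemma Zspace_nontrivial:
  assumes "cells X (Suc d) \<noteq> {}"
  obtains f where "f \<in> Zspace X d" "f \<noteq> (\<lambda>_. 0)"
proof -
  obtain t where t: "t \<in> cells X (Suc d)" using assms by blast
  obtain h where h: "is_form X (Suc d) h" "\<And>xs. h xs \<noteq> 0 \<Longrightarrow> set xs = t"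
    "\<And>xs. distinct xs \<Longrightarrow> set xs = t \<Longrightarrow> (h xs)\<^sup>2 = 1"
    using elementary_form[OF t cells_finite[OF X t]] by blast
  have "(\<lambda>s. one s * (h (cellrep s))\<^sup>2) summable_on cells X (Suc d) \<longleftrightarrow>
      (\<lambda>s. one s * (h (cellrep s))\<^sup>2) summable_on {t}"
  proof (rule summable_on_cong_neutral)
    show "one s * (h (cellrep s))\<^sup>2 = 0" if s: "s \<in> cells X (Suc d) - {t}" for s
    proof -
      have "set (cellrep s) \<noteq> t" using cellrep[OF cells_finite[OF X, of s]] s by auto
      then show ?thesis using h(2) by auto
    qed
  qed (use t in auto)
  then have "h \<in> form_space X (Suc d) one"
    using h(1) by (simp add: form_space_def wsq_summable_def)
  then have mem: "bd X h \<in> Zspace X d" by (rule bd_in_Zspace)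
  have "card t = Suc d" using t by (simp add: cells_def)
  then obtain v where v: "v \<in> t" by fastforce
  define s where "s = t - {v}"
  have "(s, v) \<in> Sigma (cells X d) (up X)"
    using incidence_bij[OF X, of d] t v by (auto simp: bij_betw_def s_def)
  then have s: "s \<in> cells X d" "v \<in> up X s" by auto
  have rep: "distinct (cellrep s)" "set (cellrep s) = s" using cellrep[OF cells_finite[OF X s(1)]] by auto
  have "bd X h (cellrep s) = (\<Sum>u\<in>{v}. h (u # cellrep s))"
    unfolding bd_cellrep[OF X s(1)]
  proof (rule sum.mono_neutral_right[OF fin_up[OF s(1)]])
    show "\<forall>u\<in>up X s - {v}. h (u # cellrep s) = 0"
    proof (rule ballI, rule ccontr)
      fix u assume u: "u \<in> up X s - {v}" "h (u # cellrep s) \<noteq> 0"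
      then have "insert u s = t" using h(2)[OF u(2)] rep by simp
      then show False using u v by (auto simp: s_def up_def)
    qed
  qed (use s in auto)
  moreover have "(h (v # cellrep s))\<^sup>2 = 1" using rep v by (intro h(3)) (auto simp: s_def)
  ultimately have "bd X h (cellrep s) \<noteq> 0" by auto
  then have "bd X h \<noteq> (\<lambda>_. 0)" by auto
  then show ?thesis using that[OF mem] by simp
qed

lemma spec_Z_nonempty:
  assumes "cells X (Suc d) \<noteq> {}"
  shows "spec_Z X d \<noteq> {}"
proof -
  obtain f where "f \<in> Zspace X d" "f \<noteq> (\<lambda>_. 0)" using Zspace_nontrivial[OF assms] .
  from Z.spec_below_rayleigh[OF this] show ?thesis unfolding spec_Z_eq by blast
qed

end

context upper_complex
begin

text \<open>The squared norm of \<open>delta1 X d g\<close> carries the weight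
  \<open>deg\<^sup>2 / deg = deg\<close>, at most \<open>K\<close>; the factor \<open>d\<close>
  counts facets and \<open>L\<close> bounds the degrees one dimension below.\<close>

lemma delta1_bound:
  assumes d: "d = Suc k" and low: "\<And>s. s \<in> cells X k \<Longrightarrow> finite (up X s) \<and> card (up X s) \<le> L"
    and K: "\<And>s. s \<in> cells X d \<Longrightarrow> card (up X s) \<le> K"
    and g: "g \<in> form_space X k one"
  shows "delta1 X d g \<in> form_space X d w"
    "form_ip X d w (delta1 X d g) (delta1 X d g) \<le> real K * (real d * (real L * form_ip X k one g g))"
proof -
  have alt: "alternating g" using form_space_alternating[OF g] .
  have gs: "(\<lambda>s. 1 * (g (cellrep s))\<^sup>2) summable_on cells X k"
    using g by (simp add: form_space_def wsq_summable_def)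
  have le: "real (card (up X s)) * (g (cellrep s))\<^sup>2 \<le> real L * (1 * (g (cellrep s))\<^sup>2)" if "s \<in> cells X k" for s
    using low[OF that] by (simp add: mult_right_mono)
  have gs': "wsq_summable (cells X k) (\<lambda>s. real (card (up X s))) cellrep g"
    unfolding wsq_summable_def using le
    by (intro summable_on_nonneg_comparison[OF summable_on_cmult_right[OF gs, of "real L"]]) auto
  have gle: "form_ip X k (\<lambda>s. real (card (up X s))) g g \<le> real L * form_ip X k one g g"
  proof -
    have "form_ip X k (\<lambda>s. real (card (up X s))) g g \<le> infsum (\<lambda>s. real L * (1 * (g (cellrep s))\<^sup>2)) (cells X k)"
      unfolding wip_self using gs' le summable_on_cmult_right[OF gs, of "real L"]
      by (intro infsum_mono) (auto simp: wsq_summable_def)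
    then show ?thesis by (simp add: wip_self infsum_cmult_right')
  qed
  note bound = codiff_bound[OF X _ alt gs', folded d]
  have cs: "wsq_summable (cells X d) one cellrep (codiff g)" using bound(1) low by blast
  have eq: "w s * (delta1 X d g (cellrep s))\<^sup>2 = real (card (up X s)) * (codiff g (cellrep s))\<^sup>2"
    if s: "s \<in> cells X d" for s
    using deg_pos[OF s] deg_eq[OF s] cellrep[OF cells_finite[OF X s]] cellrep_ocell[OF X s]
    by (simp add: delta1_eq power_mult_distrib power2_eq_square)
  have le2: "w s * (delta1 X d g (cellrep s))\<^sup>2 \<le> real K * (1 * (codiff g (cellrep s))\<^sup>2)"
    if "s \<in> cells X d" for s
    unfolding eq[OF that] using K[OF that] by (simp add: mult_right_mono)
  have cs': "(\<lambda>s. real K * (1 * (codiff g (cellrep s))\<^sup>2)) summable_on cells X d"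
    using cs by (intro summable_on_cmult_right) (simp add: wsq_summable_def)
  have ds: "wsq_summable (cells X d) w cellrep (delta1 X d g)"
    unfolding wsq_summable_def using le2 by (intro summable_on_nonneg_comparison[OF cs']) auto
  then show "delta1 X d g \<in> form_space X d w"
    using g by (auto simp: form_space_def intro: is_form_delta1)
  have "form_ip X d w (delta1 X d g) (delta1 X d g) \<le> real K * form_ip X d one (codiff g) (codiff g)"
  proof -
    have "form_ip X d w (delta1 X d g) (delta1 X d g) \<le> infsum (\<lambda>s. real K * (1 * (codiff g (cellrep s))\<^sup>2)) (cells X d)"
      unfolding wip_self using ds le2 cs' by (intro infsum_mono) (auto simp: wsq_summable_def)
    then show ?thesis by (simp add: wip_self infsum_cmult_right')
  qed
  also have "\<dots> \<le> real K * (real d * form_ip X k (\<lambda>s. real (card (up X s))) g g)"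
    using bound(2) low by (intro mult_left_mono) auto
  also have "\<dots> \<le> real K * (real d * (real L * form_ip X k one g g))"
    using gle by (intro mult_left_mono) auto
  finally show "form_ip X d w (delta1 X d g) (delta1 X d g) \<le> real K * (real d * (real L * form_ip X k one g g))" .
qed

end

section \<open>Finite complexes and the Laplacian on (d-2)-forms\<close>

lemma bd_bd:
  assumes X: "simp_complex X" "finite X" and f: "alternating f"
  shows "bd X (bd X f) = (\<lambda>_. 0)"
proof
  fix xs
  show "bd X (bd X f) xs = 0"
  proof (cases "ocell X (length xs) xs")
    case True
    let ?s = "set xs"
    have fin: "finite (up X s)" if "finite s" for s
      using finite_up[OF that, of X] X(2) by (simp add: cofaces_def)
    define P where "P = Sigma (up X ?s) (\<lambda>v. up X (insert v ?s))"
    have "bd X (bd X f) xs = (\<Sum>v\<in>up X ?s. \<Sum>u\<in>up X (insert v ?s). f (u # v # xs))"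
      using True by (auto simp: bd_def up_def ocell_def intro!: sum.cong)
    also have "\<dots> = (\<Sum>(v, u)\<in>P. f (u # v # xs))"
      unfolding P_def by (rule sum.Sigma) (auto intro: fin)
    finally have eq: "bd X (bd X f) xs = (\<Sum>(v, u)\<in>P. f (u # v # xs))" .
    have swap: "(u, v) \<in> P" if "(v, u) \<in> P" for u v
      using that simp_complex_subset[OF X(1), of "insert u (insert v ?s)" "insert u ?s"]
      by (auto simp: P_def up_def insert_commute)
    \<comment> \<open>Exchanging the two added vertices is an involution of \<open>P\<close> that
      reverses the sign, so the sum equals its own negative.\<close>
    have "(\<Sum>(v, u)\<in>P. f (u # v # xs)) = (\<Sum>(v, u)\<in>P. f (v # u # xs))"
      by (rule sum.reindex_bij_witness[where i = prod.swap and j = prod.swap]) (auto intro: swap)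
    also have "\<dots> = - (\<Sum>(v, u)\<in>P. f (u # v # xs))"
      unfolding sum_negf[symmetric] by (rule sum.cong) (auto intro: alternating_swap_first[OF f])
    finally show ?thesis using eq by simp
  qed (simp add: bd_def)
qed

text \<open>Writing the dimension as \<open>Suc k\<close> avoids the truncated \<open>d - 1\<close>;
  cells with \<open>k\<close> vertices are the (d-2)-cells.\<close>

locale finite_complex = upper_complex X "Suc k" for X :: "'v set set" and k +
  assumes finite_X: "finite X"
begin

lemma finite_cells: "finite (cells X j)"
  using finite_X by (simp add: cells_def)

lemma form_in_space: "is_form X j f \<Longrightarrow> f \<in> form_space X j v"
  using finite_cells by (simp add: form_space_def wsq_summable_def)

lemma up_bound: "finite s \<Longrightarrow> finite (up X s) \<and> card (up X s) \<le> card X"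
  using finite_up[of s X] deg_up[of s X] finite_X card_mono[of X "cofaces X s"]
  by (auto simp: deg_def cofaces_def)

abbreviation low_space :: "('v list \<Rightarrow> real) set" where
  "low_space \<equiv> {g. is_form X k g \<and> bd X g = (\<lambda>_. 0)}"

abbreviation low_lap :: "('v list \<Rightarrow> real) \<Rightarrow> 'v list \<Rightarrow> real" where
  "low_lap g \<equiv> bd X (delta1 X (Suc k) g)"

lemma bd_delta1_adjoint:
  assumes "is_form X (Suc k) z" "is_form X k g"
  shows "form_ip X (Suc k) w z (delta1 X (Suc k) g) = form_ip X k one (bd X z) g"
proof -
  have "form_ip X (Suc k) w z (delta1 X (Suc k) g) = form_ip X (Suc k) one z (codiff g)"
  proof (rule wip_cong)
    fix s assume s: "s \<in> cells X (Suc k)"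
    show "w s * (z (cellrep s) * delta1 X (Suc k) g (cellrep s)) = one s * (z (cellrep s) * codiff g (cellrep s))"
      using deg_pos[OF s] cellrep[OF cells_finite[OF X s]] cellrep_ocell[OF X s] by (simp add: delta1_eq)
  qed
  also have "\<dots> = form_ip X k one (bd X z) g"
    using assms finite_cells up_bound cells_finite[OF X]
    by (intro bd_codiff_adjoint[OF X]) (auto intro: is_form_alternating simp: wsq_summable_def)
  finally show ?thesis .
qed

lemma low_lap_form:
  "is_form X k f \<Longrightarrow> is_form X k g \<Longrightarrow>
    form_ip X k one (low_lap f) g = form_ip X (Suc k) w (delta1 X (Suc k) f) (delta1 X (Suc k) g)"
  by (simp add: bd_delta1_adjoint is_form_delta1)

text \<open>Crude estimates by the number of cells suffice: the constant only has to exist for each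
  single complex and enters no uniform estimate.\<close>

lemma low_lap_bounded:
  "\<exists>C>0. \<forall>g. is_form X k g \<longrightarrow> sqrt (form_ip X k one (low_lap g) (low_lap g)) \<le> C * sqrt (form_ip X k one g g)"
proof -
  define N where "N = real (card X) + 1"
  have N: "N > 0" "N \<ge> real (card X)" by (auto simp: N_def)
  define C where "C = N * (real (Suc k) * (N * (N * (real (Suc k) * (N * 1)))))"
  have C: "C > 0" using N by (simp add: C_def)
  have "form_ip X k one (low_lap g) (low_lap g) \<le> C * form_ip X k one g g" if g: "is_form X k g" for g
  proof -
    let ?h = "delta1 X (Suc k) g"
    have h: "is_form X (Suc k) ?h" using is_form_delta1[OF g] .
    have "form_ip X k one (low_lap g) (low_lap g)
        \<le> N * form_ip X k (\<lambda>s. 1 / real (card (up X s))) (low_lap g) (low_lap g)"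
    proof -
      have le: "(bd X ?h (cellrep s))\<^sup>2 \<le> N * (1 / real (card (up X s)) * (bd X ?h (cellrep s))\<^sup>2)"
        if s: "s \<in> cells X k" for s
      proof (cases "up X s = {}")
        case True
        then show ?thesis by (simp add: bd_cellrep[OF X s])
      next
        case False
        then have pos: "real (card (up X s)) > 0"
          using up_bound[OF cells_finite[OF X s]] by (simp add: card_gt_0_iff)
        moreover have "real (card (up X s)) \<le> N"
          using up_bound[OF cells_finite[OF X s]] N by linarith
        ultimately have "1 * (bd X ?h (cellrep s))\<^sup>2 \<le> (N / real (card (up X s))) * (bd X ?h (cellrep s))\<^sup>2"
          by (intro mult_right_mono) auto
        then show ?thesis by simp
      qed
      then show ?thesis
        using finite_cells by (auto simp: wip_self sum_distrib_left intro!: sum_mono)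
    qed
    also have "\<dots> \<le> N * (real (Suc k) * form_ip X (Suc k) one ?h ?h)"
      using bd_bound(2)[OF X, of k ?h] up_bound cells_finite[OF X] is_form_alternating[OF h] N finite_cells
      by (intro mult_left_mono) (auto simp: wsq_summable_def)
    also have "form_ip X (Suc k) one ?h ?h \<le> N * form_ip X (Suc k) w ?h ?h"
    proof -
      have "(?h (cellrep s))\<^sup>2 \<le> N * (w s * (?h (cellrep s))\<^sup>2)" if s: "s \<in> cells X (Suc k)" for s
      proof -
        have "real (deg X s) \<le> N"
          using up_bound[OF cells_finite[OF X s]] N deg_eq[OF s] by simp
        then have "1 * (?h (cellrep s))\<^sup>2 \<le> (N * w s) * (?h (cellrep s))\<^sup>2"
          using deg_pos[OF s] by (intro mult_right_mono) auto
        then show ?thesis by simp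
      qed
      then show ?thesis
        using finite_cells by (auto simp: wip_self sum_distrib_left intro!: sum_mono)
    qed
    also have "form_ip X (Suc k) w ?h ?h \<le> N * (real (Suc k) * (N * form_ip X k one g g))"
    proof -
      have "form_ip X (Suc k) w ?h ?h \<le> real (card X) * (real (Suc k) * (real (card X) * form_ip X k one g g))"
        using up_bound cells_finite[OF X] form_in_space[OF g] by (intro delta1_bound) auto
      also have "\<dots> \<le> N * (real (Suc k) * (N * form_ip X k one g g))"
        using N wip_nonneg[of "cells X k" one cellrep g] by (intro mult_mono) auto
      finally show ?thesis .
    qed
    finally show ?thesis using N by (simp add: C_def mult_ac)
  qed
  then have "sqrt (form_ip X k one (low_lap g) (low_lap g)) \<le> sqrt C * sqrt (form_ip X k one g g)"
    if "is_form X k g" for g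
    using that by (metis real_sqrt_le_iff real_sqrt_mult)
  then show ?thesis using C by (intro exI[of _ "sqrt C"]) auto
qed

lemma low_positive_operator: "\<exists>C. positive_operator low_space (form_ip X k one) low_lap C"
proof -
  obtain C where C: "C > 0"
    "\<And>g. is_form X k g \<Longrightarrow> sqrt (form_ip X k one (low_lap g) (low_lap g)) \<le> C * sqrt (form_ip X k one g g)"
    using low_lap_bounded by blast
  interpret hilbert_fun low_space "form_ip X k one"
  proof (rule hilbert_fun_forms[OF X])
    fix F :: "nat \<Rightarrow> 'v list \<Rightarrow> real" and f
    assume F: "\<And>n. F n \<in> low_space" and f: "f \<in> form_space X k one"
      and lim: "\<And>xs. (\<lambda>n. F n xs) \<longlonglongrightarrow> f xs"
    have "bd X f xs = 0" for xs
    proof -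
      have "(\<lambda>n. bd X (F n) xs) \<longlonglongrightarrow> bd X f xs"
        unfolding bd_def using lim by (cases "ocell X (length xs) xs") (auto intro!: tendsto_intros)
      then show ?thesis using F by (simp add: LIMSEQ_const_iff)
    qed
    then show "f \<in> low_space" using f by (auto simp: form_space_def)
  qed (auto simp: form_in_space is_form_zero is_form_lin bd_lin, simp add: bd_def fun_eq_iff)
  have "positive_operator low_space (form_ip X k one) low_lap C"
  proof
    show "low_lap f \<in> low_space" if "f \<in> low_space" for f
      using that bd_bd[OF X finite_X is_form_alternating[OF is_form_delta1]] by (auto intro: is_form_bd is_form_delta1)
    show "form_ip X k one (low_lap f) g = form_ip X k one f (low_lap g)" if "f \<in> low_space" "g \<in> low_space" for f g
      using that low_lap_form[of f g] low_lap_form[of g f]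
        wip_sym[of "cells X k" one cellrep f] wip_sym[of "cells X (Suc k)" w cellrep "delta1 X (Suc k) f"] by simp
    show "0 \<le> form_ip X k one (low_lap f) f" if "f \<in> low_space" for f
      using that by (simp add: low_lap_form wip_nonneg)
  qed (use C in \<open>auto simp: delta1_lin bd_lin\<close>)
  then show ?thesis ..
qed

text \<open>\<open>g\<close> solves \<open>low_lap g = bd X f\<close>: the right side lies in the
  kernel of \<open>bd\<close>, and 0 is not spectral there because the infimum of the spectrum is at
  least \<open>c\<close>. The difference then has zero boundary, hence is orthogonal to all
  coboundaries. The last bound is the Rayleigh estimate for \<open>low_lap\<close> at
  \<open>g\<close>.\<close>

lemma Z_projection:
  assumes c: "c > 0" "c \<le> lambda_low X (Suc k)" and f: "f \<in> form_space X (Suc k) w"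
  obtains g where "is_form X k g" "(\<lambda>x. f x - delta1 X (Suc k) g x) \<in> Zspace X (Suc k)"
    "c * form_ip X k one g g \<le> form_ip X (Suc k) w (delta1 X (Suc k) g) (delta1 X (Suc k) g)"
proof -
  obtain C where "positive_operator low_space (form_ip X k one) low_lap C"
    using low_positive_operator ..
  then interpret Lo: positive_operator low_space "form_ip X k one" low_lap C .
  have form_f: "is_form X (Suc k) f" using f by (simp add: form_space_def)
  have "norm_u X k = (\<lambda>f. sqrt (form_ip X k one f f))"
    by (simp add: norm_u_def wip_self fun_eq_iff)
  then have low: "lambda_low X (Suc k) = Inf Lo.spec" by (simp add: lambda_low_def)
  have "0 \<notin> Lo.spec"
  proof
    assume "0 \<in> Lo.spec"
    then have "Inf Lo.spec \<le> 0" using Lo.spec_nonneg by (intro cInf_lower bdd_belowI[of _ 0])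
    then show False using c low by simp
  qed
  then obtain S where S: "\<And>f. f \<in> low_space \<Longrightarrow> S f \<in> low_space"
      "\<And>f. f \<in> low_space \<Longrightarrow> (\<lambda>x. low_lap (S f) x - 0 * S f x) = f"
    unfolding spec_on_def by blast
  have bdf: "bd X f \<in> low_space"
    using is_form_bd[OF form_f] bd_bd[OF X finite_X is_form_alternating[OF form_f]] by simp
  define g where "g = S (bd X f)"
  have g: "is_form X k g" "low_lap g = bd X f"
    using S[OF bdf] by (simp_all add: g_def)
  have dg: "delta1 X (Suc k) g \<in> form_space X (Suc k) w"
    by (rule form_in_space[OF is_form_delta1[OF g(1)]])
  let ?z = "\<lambda>x. f x - delta1 X (Suc k) g x"
  have z: "?z \<in> form_space X (Suc k) w" using L.diff_mem[OF f dg] .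
  then have form_z: "is_form X (Suc k) ?z" by (simp add: form_space_def)
  have "bd X ?z = (\<lambda>_. 0)"
    using bd_lin[of X 1 f "-1" "delta1 X (Suc k) g"] g(2) by simp
  then have "form_ip X (Suc k) w ?z b = 0" if "b \<in> Bspace X (Suc k)" for b
    using that bd_delta1_adjoint[OF form_z] by (auto simp: Bspace_def L2u_def wip_def)
  then have "?z \<in> Zspace X (Suc k)"
    using z by (simp add: Zspace_def L2w_eq inner_w_eq)
  moreover have "c * form_ip X k one g g \<le> form_ip X (Suc k) w (delta1 X (Suc k) g) (delta1 X (Suc k) g)"
  proof -
    have gV: "g \<in> low_space" using S(1)[OF bdf] by (simp add: g_def)
    have "c * form_ip X k one g g \<le> Inf Lo.spec * form_ip X k one g g"
      using c low wip_nonneg[of "cells X k" one cellrep g] by (intro mult_right_mono) auto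
    also have "\<dots> \<le> form_ip X k one (low_lap g) g" using Lo.Inf_spec_le_rayleigh[OF gV] .
    finally show ?thesis using low_lap_form[OF g(1) g(1)] by simp
  qed
  ultimately show ?thesis using that g(1) by blast
qed

end

section \<open>Balls and transplantation of forms\<close>

lemma dist_le_self: "s \<in> cells X d \<Longrightarrow> dist_le X d R s s"
  unfolding dist_le_def by (intro conjI exI[of _ 0]) auto

lemma dist_le_mono: "dist_le X d m s t \<Longrightarrow> m \<le> n \<Longrightarrow> dist_le X d n s t"
  unfolding dist_le_def by (meson order_trans)

lemma dist_le_step:
  assumes "dist_le X d m s t" "adjc X d t u"
  shows "dist_le X d (Suc m) s u"
proof -
  obtain j where "j \<le> m" "(adjc X d ^^ j) s t" using assms(1) by (auto simp: dist_le_def)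
  then have "Suc j \<le> Suc m" "(adjc X d ^^ Suc j) s u" using assms(2) by auto
  then show ?thesis using assms unfolding dist_le_def adjc_def by blast
qed

text \<open>\<open>dist_le\<close> bounds the distance only from above, so an induction along it
  needs a case for enlarging the bound.\<close>

lemma dist_le_induct [consumes 1, case_names self step mono]:
  assumes "dist_le X d m c t"
    and "\<And>m. P m c" "\<And>m s u. dist_le X d m c s \<Longrightarrow> P m s \<Longrightarrow> adjc X d s u \<Longrightarrow> P (Suc m) u"
    and "\<And>m n s. P m s \<Longrightarrow> m \<le> n \<Longrightarrow> P n s"
  shows "P m t"
proof -
  obtain j where j: "j \<le> m" "(adjc X d ^^ j) c t" and c: "c \<in> cells X d"
    using assms(1) by (auto simp: dist_le_def)
  have "P j t \<and> dist_le X d j c t" using j(2)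
  proof (induction j arbitrary: t)
    case 0
    then show ?case using assms(2) dist_le_self[OF c] by simp
  next
    case (Suc j)
    then obtain s where "(adjc X d ^^ j) c s" "adjc X d s t" by auto
    then show ?case using Suc.IH assms(3) dist_le_step by blast
  qed
  then show ?thesis using assms(4) j(1) by blast
qed

text \<open>Two different facets of a d-cell have the whole cell as their union, hence are
  adjacent.\<close>

lemma facet_dist:
  assumes X: "simp_complex X" and s: "dist_le X d m c s" and t: "t \<in> cells X (Suc d)"
    and sub: "s \<subseteq> t" "u \<subseteq> t" "card u = d"
  shows "dist_le X d (Suc m) c u"
proof (cases "u = s")
  case True
  then show ?thesis using dist_le_mono[OF s] by simp
next
  case False
  have fin: "finite t" using cells_finite[OF X t] .
  have sc: "s \<in> cells X d" using s by (simp add: dist_le_def)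
  have u: "u \<in> cells X d" using sub t simp_complex_subset[OF X] by (auto simp: cells_def)
  have "s \<subset> s \<union> u"
  proof -
    have "\<not> u \<subseteq> s"
    proof
      assume "u \<subseteq> s"
      then have "u = s" using sub sc fin by (intro card_subset_eq) (auto simp: cells_def intro: finite_subset)
      then show False using False by simp
    qed
    then show ?thesis by blast
  qed
  then have "d < card (s \<union> u)"
    using psubset_card_mono[of "s \<union> u" s] sc sub fin finite_subset[of _ t] by (auto simp: cells_def)
  then have "s \<union> u = t"
    using sub t fin card_mono[of t "s \<union> u"] by (intro card_subset_eq) (auto simp: cells_def)
  then have "adjc X d s u" using sc u t by (simp add: adjc_def)
  then show ?thesis using dist_le_step[OF s] by blast
qed

lemma ball_subset:
  assumes "simp_complex X"
  shows "ball X d R c \<subseteq> X"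
  using simp_complex_subset[OF assms] by (auto simp: ball_def cells_def)

lemma ball_memD: "simp_complex X \<Longrightarrow> u \<in> ball X d R c \<Longrightarrow> u \<in> X"
  using ball_subset by blast

lemma ball_mono: "u \<in> ball X d R c \<Longrightarrow> v \<subseteq> u \<Longrightarrow> v \<in> ball X d R c"
  unfolding ball_def by blast

lemma ball_subset_Union: "u \<in> ball X d R c \<Longrightarrow> u \<subseteq> \<Union> (ball X d R c)"
  by blast

text \<open>By definition the facets of a d-cell in the ball are within distance \<open>R\<close>,
  so the d-cells contribute no further (d-1)-cells.\<close>

lemma ball_cells:
  assumes X: "simp_complex X" and "card u = d"
  shows "u \<in> ball X d R c \<longleftrightarrow> dist_le X d R c u"
proof
  assume "u \<in> ball X d R c"
  then obtain t where t: "u \<subseteq> t" "(t \<in> cells X d \<and> dist_le X d R c t) \<or>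
      (t \<in> cells X (d + 1) \<and> (\<forall>s. s \<subseteq> t \<and> card s = d \<longrightarrow> dist_le X d R c s))"
    by (auto simp: ball_def)
  then show "dist_le X d R c u"
  proof (elim disjE)
    assume "t \<in> cells X d \<and> dist_le X d R c t"
    moreover then have "u = t"
      using t(1) assms cells_finite[OF X, of t] by (intro card_subset_eq) (auto simp: cells_def)
    ultimately show ?thesis by simp
  qed (use t assms in auto)
next
  assume "dist_le X d R c u"
  then show "u \<in> ball X d R c" unfolding ball_def dist_le_def by blast
qed

text \<open>The facets of a coface of \<open>s\<close> are at most one step farther out than
  \<open>s\<close>. This is the source of the margins in the radii below.\<close>

lemma coface_in_ball:
  assumes X: "simp_complex X" and "dist_le X d m c s" "t \<in> cells X (Suc d)" "s \<subseteq> t" "Suc m \<le> R"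
  shows "t \<in> ball X d R c"
proof -
  have "dist_le X d R c u" if "u \<subseteq> t" "card u = d" for u
    using dist_le_mono[OF facet_dist[OF X assms(2-4) that] assms(5)] .
  then show ?thesis
    unfolding ball_def mem_Collect_eq using assms(3) by (intro exI[of _ t]) simp
qed

section \<open>Isomorphisms between balls\<close>

lemma simp_iso_inv:
  assumes "simp_iso A B phi"
  shows "simp_iso B A (inv_into (\<Union>A) phi)"
  unfolding simp_iso_def
proof (intro conjI allI impI)
  have bij: "bij_betw phi (\<Union>A) (\<Union>B)" using assms by (simp add: simp_iso_def)
  then show "bij_betw (inv_into (\<Union>A) phi) (\<Union>B) (\<Union>A)" by (rule bij_betw_inv_into)
  fix u assume u: "u \<subseteq> \<Union>B"
  have "phi ` inv_into (\<Union>A) phi ` u = u"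
    using u bij image_inv_into_cancel[of phi "\<Union>A" "\<Union>B" u] by (simp add: bij_betw_def)
  moreover have "inv_into (\<Union>A) phi ` u \<subseteq> \<Union>A"
    using u bij_betw_inv_into[OF bij] by (metis bij_betw_def image_mono)
  ultimately
  show "u \<in> B \<longleftrightarrow> inv_into (\<Union>A) phi ` u \<in> A"
    using assms unfolding simp_iso_def by metis
qed

text \<open>\<open>Y\<close> stands for an approximating complex and \<open>X\<close> for the limit,
  so that forms on \<open>X\<close> are pulled back along \<open>phi\<close>.\<close>

locale ball_iso =
  fixes Y :: "'a set set" and X :: "'b set set" and d R :: nat and b :: "'a set" and c :: "'b set"
    and phi :: "'a \<Rightarrow> 'b"
  assumes Y: "simp_complex Y" and X: "simp_complex X"
    and b: "b \<in> cells Y d" and c: "c \<in> cells X d"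
    and iso: "simp_iso (ball Y d R b) (ball X d R c) phi" and phi_b: "phi ` b = c"
begin

abbreviation "BY \<equiv> ball Y d R b"
abbreviation "BX \<equiv> ball X d R c"

lemma phi_inj: "inj_on phi (\<Union>BY)"
  using iso by (auto simp: simp_iso_def bij_betw_def)

lemma phi_ball: "u \<in> BY \<Longrightarrow> phi ` u \<in> BX"
  using iso ball_subset_Union unfolding simp_iso_def by metis

lemma phi_card: "u \<in> BY \<Longrightarrow> card (phi ` u) = card u"
  by (rule card_image) (rule inj_on_subset[OF phi_inj ball_subset_Union])

text \<open>Distances are measured in the whole complexes, but a path of length at most
  \<open>R\<close> from the centre stays in the ball together with the d-cells joining its steps, by
  \<open>coface_in_ball\<close>.\<close>

lemma phi_dist:
  assumes "dist_le Y d m b s" "m \<le> R"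
  shows "dist_le X d m c (phi ` s)"
  using assms
proof (induction rule: dist_le_induct)
  case (self m)
  then show ?case using dist_le_self[OF c] phi_b by simp
next
  case (step m s u)
  have s: "dist_le X d m c (phi ` s)" using step.IH step.prems by simp
  have su: "card u = d" "card (s \<union> u) = Suc d" "s \<union> u \<in> cells Y (Suc d)"
    using step.hyps(2) by (auto simp: adjc_def cells_def)
  have t: "s \<union> u \<in> BY"
    using step.prems su by (intro coface_in_ball[OF Y step.hyps(1)]) auto
  have u: "u \<in> BY" using ball_mono[OF t] by simp
  have "phi ` u \<in> cells X d"
    using ball_memD[OF X phi_ball[OF u]] phi_card[OF u] su by (simp add: cells_def)
  moreover have "phi ` s \<union> phi ` u \<in> cells X (Suc d)"
    using ball_memD[OF X phi_ball[OF t]] phi_card[OF t] su by (simp add: cells_def image_Un)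
  ultimately have "adjc X d (phi ` s) (phi ` u)"
    using s by (simp add: adjc_def dist_le_def)
  then show ?case using dist_le_step[OF s] by blast
next
  case (mono m n s)
  then show ?case using dist_le_mono by (metis order_trans)
qed

lemma phi_up:
  assumes s: "dist_le Y d m b s" "Suc m \<le> R" and v: "v \<in> up Y s"
  shows "insert v s \<in> BY" "phi v \<in> up X (phi ` s)"
proof -
  have sc: "s \<in> cells Y d" using s by (simp add: dist_le_def)
  have "insert v s \<in> cells Y (Suc d)"
    using v sc cells_finite[OF Y sc] by (auto simp: up_def cells_def)
  then show ball: "insert v s \<in> BY"
    by (rule coface_in_ball[OF Y s(1) _ _ s(2)]) auto
  have "phi v \<notin> phi ` s"
    using phi_inj ball v unfolding inj_on_def up_def by blast
  then show "phi v \<in> up X (phi ` s)"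
    using ball_memD[OF X phi_ball[OF ball]] by (simp add: up_def)
qed

definition psi :: "'b \<Rightarrow> 'a" where "psi = inv_into (\<Union>BY) phi"

lemma psi_phi: "v \<in> \<Union>BY \<Longrightarrow> psi (phi v) = v"
  unfolding psi_def by (rule inv_into_f_f[OF phi_inj])

lemma phi_psi: "v \<in> \<Union>BX \<Longrightarrow> phi (psi v) = v"
  using iso unfolding psi_def simp_iso_def bij_betw_def by (metis f_inv_into_f)

lemma psi_phi_image: "u \<in> BY \<Longrightarrow> psi ` phi ` u = u"
  using psi_phi ball_subset_Union[of u] by (force simp: image_image)

lemma b_ball: "b \<in> BY"
  using ball_cells[OF Y] b dist_le_self[OF b] by (auto simp: cells_def)

text \<open>The data are symmetric, so each fact about \<open>phi\<close> becomes available for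
  \<open>psi\<close>.\<close>

lemma inverse_iso: "ball_iso X Y d R c b psi"
proof
  show "simp_iso BX BY psi" unfolding psi_def by (rule simp_iso_inv[OF iso])
  show "psi ` c = b" using psi_phi_image[OF b_ball] phi_b by simp
qed (fact X Y b c)+

lemma psi_dist: "dist_le X d m c t \<Longrightarrow> m \<le> R \<Longrightarrow> dist_le Y d m b (psi ` t)"
  by (rule ball_iso.phi_dist[OF inverse_iso])

lemma phi_dist_iff:
  assumes "s \<in> BY" "m \<le> R"
  shows "dist_le X d m c (phi ` s) \<longleftrightarrow> dist_le Y d m b s"
  using phi_dist[OF _ assms(2)] psi_dist[OF _ assms(2), of "phi ` s"] psi_phi_image[OF assms(1)] by metis

lemma dist_ball: "dist_le Y d m b s \<Longrightarrow> m \<le> R \<Longrightarrow> s \<in> BY"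
  using ball_cells[OF Y, of s d R b] dist_le_mono[of Y d m b s R] by (auto simp: dist_le_def cells_def)

text \<open>The margin of one step puts all cofaces of \<open>s\<close> inside the ball; for a cell
  on the rim some could be missing from it, and degrees might differ.\<close>

lemma phi_up_bij:
  assumes s: "dist_le Y d m b s" "Suc m \<le> R"
  shows "bij_betw phi (up Y s) (up X (phi ` s))"
proof (rule bij_betw_byWitness[where f' = psi])
  have s': "dist_le X d m c (phi ` s)" using phi_dist[OF s(1)] s(2) by simp
  have sB: "s \<in> BY" using dist_ball[OF s(1)] s(2) by simp
  note inv = ball_iso.phi_up[OF inverse_iso s' s(2)]
  show "\<forall>v\<in>up Y s. psi (phi v) = v" using phi_up(1)[OF s] psi_phi by blast
  show "\<forall>v\<in>up X (phi ` s). phi (psi v) = v" using inv(1) phi_psi by blast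
  show "phi ` up Y s \<subseteq> up X (phi ` s)" using phi_up(2)[OF s] by blast
  show "psi ` up X (phi ` s) \<subseteq> up Y s" using inv(2) psi_phi_image[OF sB] by auto
qed

lemma phi_deg:
  assumes s: "dist_le Y d m b s" "Suc m \<le> R"
  shows "deg X (phi ` s) = deg Y s"
proof -
  have "finite s" using s cells_finite[OF Y] by (auto simp: dist_le_def)
  then show ?thesis using bij_betw_same_card[OF phi_up_bij[OF s]] by (simp add: deg_up)
qed

lemma phi_dist_bij:
  assumes "m \<le> R"
  shows "bij_betw (image phi) {s. dist_le Y d m b s} {t. dist_le X d m c t}"
proof (rule bij_betw_byWitness[where f' = "image psi"])
  show "\<forall>s\<in>{s. dist_le Y d m b s}. psi ` phi ` s = s"
    using psi_phi_image dist_ball[OF _ assms] by blast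
  show "\<forall>t\<in>{t. dist_le X d m c t}. phi ` psi ` t = t"
  proof
    fix t assume "t \<in> {t. dist_le X d m c t}"
    then have "t \<in> BX" using ball_iso.dist_ball[OF inverse_iso _ assms] by simp
    then show "phi ` psi ` t = t" using phi_psi ball_subset_Union[of t] by (force simp: image_image)
  qed
qed (use phi_dist psi_dist assms in auto)

end

section \<open>Transplanting forms between isomorphic balls\<close>

definition transplant :: "'a set set \<Rightarrow> ('a \<Rightarrow> 'b) \<Rightarrow> nat \<Rightarrow> ('b list \<Rightarrow> real) \<Rightarrow> 'a list \<Rightarrow> real" where
  "transplant A phi k f xs = (if ocell A k xs then f (map phi xs) else 0)"

lemma is_form_transplant:
  assumes "A \<subseteq> Y" "alternating f"
  shows "is_form Y k (transplant A phi k f)"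
  unfolding is_form_def
proof (intro conjI allI impI)
  show "ocell Y k xs" if "transplant A phi k f xs \<noteq> 0" for xs
    using that assms(1) by (auto simp: transplant_def ocell_def split: if_splits)
  fix xs :: "'a list" and i j assume ij: "i < length xs \<and> j < length xs \<and> i \<noteq> j"
  then show "transplant A phi k f (lswap xs i j) = - transplant A phi k f xs"
    using alternatingD[OF assms(2), of i "map phi xs" j] by (simp add: transplant_def map_lswap)
qed

definition supported :: "'v set set \<Rightarrow> nat \<Rightarrow> nat \<Rightarrow> 'v set \<Rightarrow> ('v list \<Rightarrow> real) \<Rightarrow> bool" where
  "supported X d m c f \<longleftrightarrow> (\<forall>xs. f xs \<noteq> 0 \<longrightarrow> dist_le X d m c (set xs))"

lemma upper_lap_nonzeroD:
  assumes "upper_lap X d f xs \<noteq> 0"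
  obtains v i where "ocell X d xs" "v \<in> up X (set xs)" "i < Suc d" "f (ldel i (v # xs)) \<noteq> 0"
proof -
  have nz: "bd X (delta2 X d f) xs \<noteq> 0" using assms by (simp add: upper_lap_def)
  obtain v where v: "v \<in> up X (set xs)" "delta2 X d f (v # xs) \<noteq> 0"
    using nz unfolding bd_def up_def by (metis (mono_tags, lifting) sum.neutral)
  then have oc: "ocell X (Suc d) (v # xs)" by (auto simp: delta2_eq split: if_splits)
  have "\<exists>i<length (v # xs). f (ldel i (v # xs)) \<noteq> 0"
  proof (rule ccontr)
    assume none: "\<not> (\<exists>i<length (v # xs). f (ldel i (v # xs)) \<noteq> 0)"
    have "codiff (\<lambda>ys. f ys / real (deg X (set ys))) (v # xs) = 0"
      unfolding codiff_def by (intro sum.neutral) (use none in auto)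
    then show False using v oc by (simp add: delta2_eq)
  qed
  moreover have "ocell X (length xs) xs" using nz by (auto simp: bd_def split: if_splits)
  ultimately show ?thesis using that v(1) oc by (auto simp: ocell_def)
qed

text \<open>The Laplacian couples only facets of a common d-cell, so the support grows by one
  step.\<close>

lemma supported_upper_lap:
  assumes X: "simp_complex X" and f: "supported X d m c f"
  shows "supported X d (Suc m) c (upper_lap X d f)"
  unfolding supported_def
proof (intro allI impI)
  fix xs assume "upper_lap X d f xs \<noteq> 0"
  then obtain v i where v: "ocell X d xs" "v \<in> up X (set xs)" "i < Suc d" "f (ldel i (v # xs)) \<noteq> 0"
    by (rule upper_lap_nonzeroD)
  have "insert v (set xs) \<in> cells X (Suc d)"
    using v(1,2) by (auto simp: up_def ocell_def cells_def distinct_card)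
  moreover have "dist_le X d m c (set (ldel i (v # xs)))" using f v(4) by (simp add: supported_def)
  moreover have "set (ldel i (v # xs)) \<subseteq> insert v (set xs)" using set_ldel_subset[of i "v # xs"] by simp
  ultimately show "dist_le X d (Suc m) c (set xs)"
    using v(1) by (intro facet_dist[OF X]) (auto simp: ocell_def distinct_card)
qed

context ball_iso
begin

abbreviation "pull \<equiv> transplant BY phi d"

lemma is_form_pull: "is_form X d f \<Longrightarrow> is_form Y d (pull f)"
  by (intro is_form_transplant ball_subset[OF Y] is_form_alternating)

lemma ocell_ball: "dist_le Y d m b (set xs) \<Longrightarrow> m \<le> R \<Longrightarrow> ocell Y d xs \<Longrightarrow> ocell BY d xs"
  using dist_ball by (auto simp: ocell_def)

lemma supported_pull:
  assumes f: "supported X d m c f" and m: "m \<le> R"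
  shows "supported Y d m b (pull f)"
  unfolding supported_def
proof (intro allI impI)
  fix xs assume "pull f xs \<noteq> 0"
  then have xs: "set xs \<in> BY" "f (map phi xs) \<noteq> 0"
    by (auto simp: transplant_def ocell_def split: if_splits)
  then have "dist_le X d m c (phi ` set xs)" using f unfolding supported_def by (metis list.set_map)
  then show "dist_le Y d m b (set xs)" using phi_dist_iff[OF xs(1) m] by simp
qed

lemma ocell_map_phi:
  assumes "ocell BY k xs"
  shows "ocell X k (map phi xs)"
  using assms phi_ball[of "set xs"] ball_subset[OF X] inj_on_subset[OF phi_inj ball_subset_Union[of "set xs"]]
  by (auto simp: ocell_def distinct_map)

text \<open>The Laplacian of \<open>f\<close> lives within distance \<open>m + 1\<close>, and
  evaluating it there involves cofaces that reach radius \<open>m + 2\<close>.\<close>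

lemma upper_lap_pull:
  assumes f: "is_form X d f" and supp: "supported X d m c f" and m: "Suc (Suc m) \<le> R"
  shows "upper_lap Y d (pull f) = pull (upper_lap X d f)"
proof
  fix xs
  have suppY: "supported Y d m b (pull f)" using supported_pull[OF supp] m by simp
  have suppL: "supported Y d (Suc m) b (upper_lap Y d (pull f))"
    using supported_upper_lap[OF Y suppY] .
  have suppR: "supported Y d (Suc m) b (pull (upper_lap X d f))"
    using supported_pull[OF supported_upper_lap[OF X supp]] m by simp
  show "upper_lap Y d (pull f) xs = pull (upper_lap X d f) xs"
  \<comment> \<open>Beyond distance \<open>m + 1\<close> both sides vanish by their
    supports.\<close>
  proof (cases "ocell Y d xs \<and> dist_le Y d (Suc m) b (set xs)")
    case True
    then have oc: "ocell Y d xs" and dist: "dist_le Y d (Suc m) b (set xs)" by auto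
    have ocB: "ocell BY d xs" using ocell_ball[OF dist _ oc] m by simp
    have ocX: "ocell X d (map phi xs)" using ocell_map_phi[OF ocB] .
    have len: "length xs = d" using oc by (simp add: ocell_def)
    have "upper_lap Y d (pull f) xs = (\<Sum>v\<in>up Y (set xs). delta2 Y d (pull f) (v # xs))"
      using oc len by (simp add: upper_lap_def bd_def up_def)
    also have "\<dots> = (\<Sum>v\<in>up Y (set xs). delta2 X d f (phi v # map phi xs))"
    proof (rule sum.cong[OF refl])
      fix v assume v: "v \<in> up Y (set xs)"
      let ?t = "v # xs"
      have tB: "set ?t \<in> BY" using phi_up(1)[OF dist m v] by simp
      have ocT: "ocell Y (Suc d) ?t" using v oc by (auto simp: up_def ocell_def)
      have ocT': "ocell BY (Suc d) ?t" using ocT tB by (simp add: ocell_def)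
      have ocTX: "ocell X (Suc d) (map phi ?t)" using ocell_map_phi[OF ocT'] .
      have "pull f (ldel i ?t) / real (deg Y (set (ldel i ?t)))
          = f (ldel i (map phi ?t)) / real (deg X (set (ldel i (map phi ?t))))"
        if i: "i < length ?t" for i
      proof -
        let ?u = "ldel i ?t"
        have u: "ocell BY d ?u"
          using ocell_ldel[OF Y ocT, of i] i len ball_mono[OF tB set_ldel_subset[of i ?t]]
          by (simp add: ocell_def)
        have map: "ldel i (map phi ?t) = map phi ?u" by (simp only: map_ldel)
        \<comment> \<open>Agreement of degrees is available near the support of \<open>f\<close>;
          elsewhere both quotients are 0.\<close>
        show ?thesis
        proof (cases "f (map phi ?u) = 0")
          case True
          then show ?thesis unfolding map by (simp add: transplant_def)
        next
          case False
          then have "dist_le X d m c (phi ` set ?u)" using supp unfolding supported_def by (metis list.set_map)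
          then have "dist_le Y d m b (set ?u)" using phi_dist_iff[of "set ?u" m] u m by (simp add: ocell_def)
          then have "deg X (phi ` set ?u) = deg Y (set ?u)" using phi_deg m by simp
          then show ?thesis unfolding map using u by (simp add: transplant_def)
        qed
      qed
      then have "codiff (\<lambda>ys. pull f ys / real (deg Y (set ys))) ?t
          = codiff (\<lambda>ys. f ys / real (deg X (set ys))) (map phi ?t)"
        unfolding codiff_def length_map by (intro sum.cong refl) simp
      then show "delta2 Y d (pull f) (v # xs) = delta2 X d f (phi v # map phi xs)"
        using ocT ocTX by (simp add: delta2_eq)
    qed
    also have "\<dots> = (\<Sum>u\<in>up X (phi ` set xs). delta2 X d f (u # map phi xs))"
      by (rule sum.reindex_bij_betw[OF phi_up_bij[OF dist m]])
    also have "\<dots> = upper_lap X d f (map phi xs)"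
      using ocX len by (simp add: upper_lap_def bd_def up_def)
    finally show ?thesis using ocB by (simp add: transplant_def)
  next
    case False
    have "upper_lap Y d (pull f) xs = 0"
    proof (rule ccontr)
      assume nz: "upper_lap Y d (pull f) xs \<noteq> 0"
      then show False using False suppL upper_lap_nonzeroD[OF nz] unfolding supported_def by blast
    qed
    moreover have "pull (upper_lap X d f) xs = 0"
    proof (rule ccontr)
      assume nz: "pull (upper_lap X d f) xs \<noteq> 0"
      then have "ocell Y d xs" using ball_subset[OF Y] by (auto simp: transplant_def ocell_def split: if_splits)
      then show False using False suppR nz unfolding supported_def by blast
    qed
    ultimately show ?thesis by simp
  qed
qed

text \<open>Products vanish off the support of the first factor, so only that factor is localised.
  The second may then be an arbitrary coboundary, as in \<open>pull_delta1_push\<close>.\<close>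

lemma pull_isometry:
  assumes f: "is_form X d f" and g: "alternating g" and supp: "supported X d m c f" and m: "Suc m \<le> R"
  shows "form_ip Y d (\<lambda>s. 1 / real (deg Y s)) (pull f) (pull g) = form_ip X d (\<lambda>s. 1 / real (deg X s)) f g"
proof -
  have mR: "m \<le> R" using m by simp
  have suppY: "supported Y d m b (pull f)" using supported_pull[OF supp mR] .
  let ?F = "\<lambda>t. 1 / real (deg X t) * (f (cellrep t) * g (cellrep t))"
  have "form_ip Y d (\<lambda>s. 1 / real (deg Y s)) (pull f) (pull g) = infsum (\<lambda>s. ?F (phi ` s)) {s. dist_le Y d m b s}"
    unfolding wip_def
  proof (rule infsum_cong_neutral)
    fix s assume "s \<in> cells Y d - {s. dist_le Y d m b s}"
    then have "pull f (cellrep s) = 0"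
      using suppY cellrep[OF cells_finite[OF Y, of s]] unfolding supported_def by force
    then show "1 / real (deg Y s) * (pull f (cellrep s) * pull g (cellrep s)) = 0" by simp
  next
    fix s assume s: "s \<in> cells Y d \<inter> {s. dist_le Y d m b s}"
    let ?r = "cellrep s"
    have rep: "distinct ?r" "set ?r = s" using cellrep[OF cells_finite[OF Y, of s]] s by auto
    have oc: "ocell BY d ?r"
      using ocell_ball[of m ?r] cellrep_ocell[OF Y, of s d] s rep mR by auto
    have ocX: "ocell X d (map phi ?r)" using ocell_map_phi[OF oc] .
    have "pull f ?r * pull g ?r = f (map phi ?r) * g (map phi ?r)" using oc by (simp add: transplant_def)
    also have "\<dots> = f (cellrep (phi ` s)) * g (cellrep (phi ` s))"
      using ocX rep cellrep[of "phi ` s"] cells_finite[OF Y, of s] s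
      by (intro alternating_mult_reorder[OF is_form_alternating[OF f] g]) (auto simp: ocell_def)
    finally show "1 / real (deg Y s) * (pull f ?r * pull g ?r) = ?F (phi ` s)"
      using phi_deg[of m s] s m by simp
  qed (auto simp: dist_le_def)
  also have "\<dots> = infsum ?F {t. dist_le X d m c t}"
    by (rule infsum_reindex_bij_betw[OF phi_dist_bij[OF mR]])
  also have "\<dots> = form_ip X d (\<lambda>s. 1 / real (deg X s)) f g"
    unfolding wip_def
  proof (rule infsum_cong_neutral)
    fix t assume "t \<in> cells X d - {t. dist_le X d m c t}"
    then have "f (cellrep t) = 0"
      using supp cellrep[OF cells_finite[OF X, of t]] unfolding supported_def by force
    then show "?F t = 0" by simp
  qed (auto simp: dist_le_def)
  finally show ?thesis .
qed

text \<open>Forms one dimension lower travel in the opposite direction: the correction is found on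
  \<open>Y\<close>, while the orthogonality it is tested against lives on \<open>X\<close>.\<close>

abbreviation "push k \<equiv> transplant BX psi k"

text \<open>Taking images under \<open>psi\<close> is injective on cells of the ball, so finite sums
  of squares on \<open>X\<close> are partial sums of the norm on \<open>Y\<close>.\<close>

lemma push_norm_le:
  assumes finY: "finite Y" and g: "alternating g"
  shows "push k g \<in> form_space X k (\<lambda>_. 1)"
    "form_ip X k (\<lambda>_. 1) (push k g) (push k g) \<le> form_ip Y k (\<lambda>_. 1) g g"
proof -
  interpret inv: ball_iso X Y d R c b psi by (rule inverse_iso)
  have finC: "finite (cells Y k)" using finY by (simp add: cells_def)
  have bound: "(\<Sum>u\<in>C. 1 * (push k g (cellrep u))\<^sup>2) \<le> form_ip Y k (\<lambda>_. 1) g g"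
    if C: "finite C" "C \<subseteq> cells X k" for C
  proof -
    have "(\<Sum>u\<in>C. 1 * (push k g (cellrep u))\<^sup>2) = (\<Sum>u\<in>C \<inter> BX. (g (cellrep (psi ` u)))\<^sup>2)"
    proof (rule sum.mono_neutral_cong_right[OF C(1)])
      show "\<forall>u\<in>C - C \<inter> BX. 1 * (push k g (cellrep u))\<^sup>2 = 0"
        using cellrep[OF cells_finite[OF X]] C by (auto simp: transplant_def ocell_def subset_iff)
      fix u assume u: "u \<in> C \<inter> BX"
      then have uc: "u \<in> cells X k" using C by blast
      have rep: "distinct (cellrep u)" "set (cellrep u) = u" using cellrep[OF cells_finite[OF X uc]] by auto
      have oc: "ocell BX k (cellrep u)"
        using cellrep_ocell[OF X uc] rep u by (simp add: ocell_def)
      have "ocell Y k (map psi (cellrep u))" using inv.ocell_map_phi[OF oc] .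
      then show "1 * (push k g (cellrep u))\<^sup>2 = (g (cellrep (psi ` u)))\<^sup>2"
        using oc rep cellrep[of "psi ` u"] cells_finite[OF X uc]
          alternating_power2_reorder[OF g, of "map psi (cellrep u)" "cellrep (psi ` u)"]
        by (simp add: transplant_def ocell_def)
    qed auto
    also have "\<dots> = (\<Sum>s\<in>image psi ` (C \<inter> BX). (g (cellrep s))\<^sup>2)"
    proof -
      have "inj_on (image psi) (C \<inter> BX)"
        using inv.psi_phi_image by (metis IntD2 inj_on_inverseI)
      from sum.reindex[OF this, of "\<lambda>s. (g (cellrep s))\<^sup>2"] show ?thesis by (simp add: o_def)
    qed
    also have "\<dots> \<le> (\<Sum>s\<in>cells Y k. (g (cellrep s))\<^sup>2)"
    proof (rule sum_mono2[OF finC])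
      show "image psi ` (C \<inter> BX) \<subseteq> cells Y k"
        using ball_memD[OF Y inv.phi_ball] inv.phi_card C by (auto simp: cells_def)
    qed auto
    also have "\<dots> = form_ip Y k (\<lambda>_. 1) g g" using finC by (simp add: wip_self)
    finally show ?thesis .
  qed
  show "form_ip X k (\<lambda>_. 1) (push k g) (push k g) \<le> form_ip Y k (\<lambda>_. 1) g g"
    by (rule wsq_bounded_finite_sums(2)[where w = "\<lambda>_. 1" and f = "push k g" and r = cellrep, OF bound]) auto
  have "wsq_summable (cells X k) (\<lambda>_. 1) cellrep (push k g)"
    by (rule wsq_bounded_finite_sums(1)[where w = "\<lambda>_. 1" and f = "push k g" and r = cellrep, OF bound]) auto
  then show "push k g \<in> form_space X k (\<lambda>_. 1)"
    using is_form_transplant[OF ball_subset[OF X] g] by (simp add: form_space_def)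
qed

text \<open>Wherever \<open>pull f\<close> is nonzero, the facets of the cell lie in the ball and
  the degrees agree, so \<open>delta1 Y d g\<close> equals there the pullback of the coboundary of
  \<open>push k g\<close>.\<close>

lemma pull_delta1_push:
  assumes f: "is_form X d f" and g: "is_form Y k g" and supp: "supported X d m c f"
    and m: "Suc m \<le> R" and d: "d = Suc k"
  shows "form_ip Y d (\<lambda>s. 1 / real (deg Y s)) (pull f) (delta1 Y d g)
    = form_ip X d (\<lambda>s. 1 / real (deg X s)) f (delta1 X d (push k g))"
proof -
  have mR: "m \<le> R" using m by simp
  have suppY: "supported Y d m b (pull f)" using supported_pull[OF supp mR] .
  have push_form: "is_form X k (push k g)"
    using is_form_transplant[OF ball_subset[OF X] is_form_alternating[OF g]] .
  have "form_ip Y d (\<lambda>s. 1 / real (deg Y s)) (pull f) (delta1 Y d g)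
      = form_ip Y d (\<lambda>s. 1 / real (deg Y s)) (pull f) (pull (delta1 X d (push k g)))"
  proof (rule wip_cong)
    fix s assume s: "s \<in> cells Y d"
    let ?r = "cellrep s"
    have rep: "distinct ?r" "set ?r = s" using cellrep[OF cells_finite[OF Y s]] by auto
    have "delta1 Y d g ?r = pull (delta1 X d (push k g)) ?r" if "pull f ?r \<noteq> 0"
    proof -
      have dist: "dist_le Y d m b s" using that suppY rep unfolding supported_def by metis
      have oc: "ocell Y d ?r" using cellrep_ocell[OF Y s] .
      have ocB: "ocell BY d ?r" using ocell_ball[of m ?r] oc dist rep mR by simp
      have ocX: "ocell X d (map phi ?r)" using ocell_map_phi[OF ocB] .
      have "push k g (ldel i (map phi ?r)) = g (ldel i ?r)" if i: "i < length ?r" for i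
      proof -
        let ?u = "ldel i ?r"
        have u: "ocell Y k ?u" using ocell_ldel[OF Y oc[unfolded d], of i] i oc d by (simp add: ocell_def)
        have uB: "set ?u \<in> BY" using ball_mono[of s Y d R b "set ?u"] dist_ball[OF dist mR] set_ldel_subset[of i ?r] rep by simp
        then have ub: "ocell BY k ?u" using u by (simp add: ocell_def)
        have "ocell BX k (map phi ?u)" using ocell_map_phi[OF ub] phi_ball[OF uB] by (simp add: ocell_def)
        moreover have "map psi (map phi ?u) = ?u"
          unfolding map_map by (rule map_idI) (use uB in \<open>simp add: psi_phi[OF UnionI]\<close>)
        ultimately show ?thesis by (simp add: transplant_def flip: map_ldel)
      qed
      then have "codiff g ?r = codiff (push k g) (map phi ?r)" by (simp add: codiff_def)
      then show ?thesis
        using oc ocB ocX phi_deg[OF dist m] rep by (simp add: delta1_eq transplant_def)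
    qed
    then show "1 / real (deg Y s) * (pull f ?r * delta1 Y d g ?r)
        = 1 / real (deg Y s) * (pull f ?r * pull (delta1 X d (push k g)) ?r)" by auto
  qed
  also have "\<dots> = form_ip X d (\<lambda>s. 1 / real (deg X s)) f (delta1 X d (push k g))"
    by (rule pull_isometry[OF f is_form_alternating[OF is_form_delta1[OF push_form]] supp m])
  finally show ?thesis .
qed

text \<open>Transfers degree bounds from \<open>Y\<close> to \<open>X\<close>. A finite
  \<open>F\<close> is used because \<open>up X u\<close> is not yet known to be finite or to fit
  into one ball.\<close>

lemma up_card_le:
  assumes F: "finite F" "F \<subseteq> up X u" "\<And>v. v \<in> F \<Longrightarrow> insert v u \<in> BX"
    and bound: "\<And>s. s \<in> cells Y k \<Longrightarrow> finite (up Y s) \<and> card (up Y s) \<le> K" and u: "u \<in> cells X k"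
  shows "card F \<le> K"
proof (cases "F = {}")
  case False
  interpret inv: ball_iso X Y d R c b psi by (rule inverse_iso)
  have uB: "u \<in> BX" using False F(3) ball_mono[of _ X d R c u] by blast
  have psi_u: "psi ` u \<in> cells Y k"
    using ball_memD[OF Y inv.phi_ball[OF uB]] inv.phi_card[OF uB] u by (simp add: cells_def)
  have "psi ` F \<subseteq> up Y (psi ` u)"
  proof
    fix y assume "y \<in> psi ` F"
    then obtain v where v: "v \<in> F" "y = psi v" by blast
    have iB: "insert v u \<in> BX" using F(3)[OF v(1)] .
    have "psi v \<notin> psi ` u"
      using inv.phi_inj iB F(2) v(1) unfolding inj_on_def up_def by blast
    then show "y \<in> up Y (psi ` u)"
      using ball_memD[OF Y inv.phi_ball[OF iB]] v(2) by (simp add: up_def)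
  qed
  moreover have "inj_on psi F" using F(3) by (intro inj_on_subset[OF inv.phi_inj]) blast
  ultimately have "card F \<le> card (up Y (psi ` u))"
    using bound[OF psi_u] by (metis card_image card_mono)
  then show ?thesis using bound[OF psi_u] by simp
qed simp

end

section \<open>Connectedness and exhaustion by balls\<close>

lemma perm_rel_set: "perm_rel xs ys q \<Longrightarrow> set ys = set xs"
  unfolding perm_rel_def by (metis permute_list_def set_permute_list)

text \<open>Neighbours are facets of one d-cell whatever their orientations, so a chain of oriented
  neighbours yields a finite distance.\<close>

lemma connected_dist:
  assumes X: "simp_complex X" and conn: "codim1_connected X d"
    and c: "c \<in> cells X d" and s: "s \<in> cells X d"
  obtains R where "dist_le X d R c s"
proof -
  have rep: "set (cellrep c) = c" "set (cellrep s) = s"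
    using cellrep cells_finite[OF X] c s by blast+
  have "(nbr X d)\<^sup>*\<^sup>* (cellrep c) (cellrep s)"
    using conn cellrep_ocell[OF X c] cellrep_ocell[OF X s] by (simp add: codim1_connected_def)
  then have "\<exists>R. dist_le X d R c (set (cellrep s))"
  proof (induction rule: rtranclp_induct)
    case base
    then show ?case using dist_le_self[OF c] rep by auto
  next
    case (step ys zs)
    then obtain R where R: "dist_le X d R c (set ys)" by blast
    obtain tau i j where tau: "ocell X (d + 1) tau"
      "perm_rel (ldel i tau) ys (even i)" "perm_rel (ldel j tau) zs (\<not> even j)"
      using step.hyps(2) by (auto simp: nbr_def)
    have "ocell X d zs" using step.hyps(2) by (simp add: nbr_def)
    then have "card (set zs) = d" by (simp add: ocell_def distinct_card)
    moreover have "set ys \<subseteq> set tau" "set zs \<subseteq> set tau"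
      using perm_rel_set[OF tau(2)] perm_rel_set[OF tau(3)] set_ldel_subset by metis+
    ultimately have "dist_le X d (Suc R) c (set zs)"
      using ocell_cells[OF tau(1)] by (intro facet_dist[OF X R, of "set tau"]) auto
    then show ?case by blast
  qed
  then show ?thesis using rep that by auto
qed

section \<open>Comparison of spectral gaps\<close>

lemma upper_complexI:
  assumes "dim_complex X d" "uniform X d" "deg_bounded X d K"
  shows "upper_complex X d"
proof
  show X: "simp_complex X" using assms(1) by (simp add: dim_complex_def)
  fix s assume s: "s \<in> cells X d"
  have fin: "finite s" using cells_finite[OF X s] .
  show "finite (up X s)" using finite_up[OF fin] assms(3) s by (simp add: deg_bounded_def)
  obtain t where "t \<in> cells X (d + 1)" "s \<subseteq> t"
    using assms(2) s by (auto simp: uniform_def cells_def)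
  then have "t \<in> cofaces X s" using s by (auto simp: cofaces_def cells_def)
  then show "up X s \<noteq> {}" using bij_betw_imp_surj_on[OF up_cofaces[OF fin, of X]] by auto
qed

lemma deg_bounded_up:
  assumes "simp_complex X" "deg_bounded X k K" "s \<in> cells X k"
  shows "finite (up X s) \<and> card (up X s) \<le> K"
  using assms finite_up[OF cells_finite[OF assms(1,3)], of X] deg_up[OF cells_finite[OF assms(1,3)], of X]
  by (auto simp: deg_bounded_def deg_def)

lemma dist_le_uniform:
  assumes "finite F" "\<And>s. s \<in> F \<Longrightarrow> \<exists>m. dist_le X d m c s"
  shows "\<exists>m. \<forall>s\<in>F. dist_le X d m c s"
proof -
  obtain r where r: "\<And>s. s \<in> F \<Longrightarrow> dist_le X d (r s) c s" using assms(2) by metis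
  have "dist_le X d (Max (r ` F)) c s" if "s \<in> F" for s
    using dist_le_mono[OF r[OF that]] assms(1) that by simp
  then show ?thesis by blast
qed

section \<open>Truncated approximate eigenforms\<close>

context upper_complex
begin

text \<open>A finite set of cells carries almost the whole norm, and connectedness puts it into a
  ball. Cutting by the distance of \<open>set xs\<close> ignores the ordering, so the result is
  still a form.\<close>

lemma truncation:
  assumes f: "f \<in> form_space X d w" and c: "c \<in> cells X d" and conn: "codim1_connected X d" and e: "e > 0"
  obtains m f' where "f' \<in> form_space X d w" "supported X d m c f'"
    "sqrt (form_ip X d w (\<lambda>x. f x - f' x) (\<lambda>x. f x - f' x)) < e"
proof -
  let ?S = "\<lambda>s. w s * (f (cellrep s))\<^sup>2"
  \<comment> \<open>Half of \<open>e\<^sup>2\<close>, since the finite sums only give a weak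
    inequality and a strict one is claimed.\<close>
  define E where "E = e\<^sup>2 / 2"
  have E: "E > 0" "E < e\<^sup>2" using e by (auto simp: E_def)
  have summ: "?S summable_on cells X d" using f by (simp add: form_space_def wsq_summable_def)
  then have "(sum ?S \<longlongrightarrow> infsum ?S (cells X d)) (finite_subsets_at_top (cells X d))"
    using has_sum_infsum by (auto simp: has_sum_def)
  then have "\<forall>\<^sub>F F in finite_subsets_at_top (cells X d). infsum ?S (cells X d) - E < sum ?S F"
    using E by (intro order_tendstoD) auto
  then obtain F where F: "finite F" "F \<subseteq> cells X d" "infsum ?S (cells X d) - E < sum ?S F"
    unfolding eventually_finite_subsets_at_top by blast
  obtain m where m: "\<And>s. s \<in> F \<Longrightarrow> dist_le X d m c s"
  proof -
    have "\<exists>m. dist_le X d m c s" if "s \<in> F" for s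
      using connected_dist[OF X conn c, of s] F(2) that by blast
    then show ?thesis using dist_le_uniform[OF F(1)] that by blast
  qed
  define f' where "f' xs = (if dist_le X d m c (set xs) then f xs else 0)" for xs
  have form: "is_form X d f'"
    using f by (auto simp: form_space_def is_form_def f'_def)
  have sq: "w s * (f' (cellrep s))\<^sup>2 \<le> ?S s" if "s \<in> cells X d" for s
    by (simp add: f'_def)
  have "wsq_summable (cells X d) w cellrep f'"
    unfolding wsq_summable_def using sq by (intro summable_on_nonneg_comparison[OF summ]) auto
  then have mem: "f' \<in> form_space X d w" using form by (simp add: form_space_def)
  have "form_ip X d w (\<lambda>x. f x - f' x) (\<lambda>x. f x - f' x) \<le> E"
  proof (rule wsq_bounded_finite_sums(2))
    fix C assume C: "finite C" "C \<subseteq> cells X d"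
    have "(\<Sum>s\<in>C. w s * (f (cellrep s) - f' (cellrep s))\<^sup>2) \<le> (\<Sum>s\<in>C - F. ?S s)"
    proof -
      have zero: "w s * (f (cellrep s) - f' (cellrep s))\<^sup>2 = 0" if "s \<in> F" for s
      proof -
        have "s \<in> cells X d" using that F(2) by blast
        then have "set (cellrep s) = s" using cellrep[OF cells_finite[OF X]] by blast
        then show ?thesis using m[OF that] by (simp add: f'_def)
      qed
      have "(\<Sum>s\<in>C. w s * (f (cellrep s) - f' (cellrep s))\<^sup>2) = (\<Sum>s\<in>C - F. w s * (f (cellrep s) - f' (cellrep s))\<^sup>2)"
        using C(1) zero by (intro sum.mono_neutral_right) auto
      also have "\<dots> \<le> (\<Sum>s\<in>C - F. ?S s)"
        by (intro sum_mono) (simp add: f'_def)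
      finally show ?thesis .
    qed
    also have "\<dots> = (\<Sum>s\<in>C \<union> F. ?S s) - (\<Sum>s\<in>F. ?S s)"
    proof -
      have "(\<Sum>s\<in>C \<union> F. ?S s) = (\<Sum>s\<in>C - F. ?S s) + (\<Sum>s\<in>F. ?S s)"
        using C(1) F(1) by (subst sum.union_disjoint[symmetric]) auto
      then show ?thesis by simp
    qed
    also have "(\<Sum>s\<in>C \<union> F. ?S s) \<le> infsum ?S (cells X d)"
      using summ C F by (intro finite_sum_le_infsum) auto
    finally show "(\<Sum>s\<in>C. w s * (f (cellrep s) - f' (cellrep s))\<^sup>2) \<le> E"
      using F(3) by linarith
  qed simp
  then have "form_ip X d w (\<lambda>x. f x - f' x) (\<lambda>x. f x - f' x) < e\<^sup>2" using E by linarith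
  then have "sqrt (form_ip X d w (\<lambda>x. f x - f' x) (\<lambda>x. f x - f' x)) < e"
    using e by (simp add: real_less_lsqrt)
  moreover have "supported X d m c f'" by (simp add: supported_def f'_def)
  ultimately show ?thesis using that mem by blast
qed

text \<open>The constant collects \<open>e\<close> from the spectral approximation and, from the
  cut-off, \<open>e\<close> times the bound \<open>d + 1 + |mu|\<close> of the shifted operator. The
  uncut \<open>f\<close> is kept because it retains the orthogonality to coboundaries.\<close>

lemma approximate_eigenform:
  assumes mu: "mu \<in> spec_Z X d" and c: "c \<in> cells X d" and conn: "codim1_connected X d" and e: "e > 0"
  obtains f f' m where "f \<in> Zspace X d" "L.nrm f > 0" "f' \<in> form_space X d w" "supported X d m c f'"
    "L.nrm (\<lambda>x. f x - f' x) < e * L.nrm f"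
    "L.nrm (L.shifted mu f') \<le> e * (1 + real (Suc d) + \<bar>mu\<bar>) * L.nrm f"
proof -
  obtain f where f: "f \<in> Zspace X d" "L.nrm (L.shifted mu f) < e * L.nrm f"
    using Z.spec_imp_approximate_eigenvector[of mu e] mu e unfolding spec_Z_eq Z.shifted_def L.shifted_def by blast
  have fL: "f \<in> form_space X d w" using f(1) Zspace_subset by blast
  have "0 \<le> L.nrm (L.shifted mu f)" using L.form_nonneg[OF L.shifted_mem[OF fL]] by simp
  then have "0 < e * L.nrm f" using f(2) by linarith
  then have pos: "L.nrm f > 0" using e by (simp only: zero_less_mult_iff) linarith
  obtain m f' where f': "f' \<in> form_space X d w" "supported X d m c f'"
    "L.nrm (\<lambda>x. f x - f' x) < e * L.nrm f"
    using truncation[OF fL c conn, of "e * L.nrm f"] \<open>0 < e * L.nrm f\<close> by blast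
  have "L.nrm (L.shifted mu f') = L.nrm (\<lambda>x. L.shifted mu f x - 1 * L.shifted mu (\<lambda>x. f x - f' x) x)"
    using L.shifted_diff[OF fL f'(1)] by simp
  also have "\<dots> \<le> L.nrm (L.shifted mu f) + \<bar>1\<bar> * L.nrm (L.shifted mu (\<lambda>x. f x - f' x))"
    by (rule L.seminorm_triangle[OF L.shifted_mem[OF fL] L.shifted_mem[OF L.diff_mem[OF fL f'(1)]]])
  also have "\<dots> \<le> e * L.nrm f + (real (Suc d) + \<bar>mu\<bar>) * (e * L.nrm f)"
  proof -
    have "L.nrm (L.shifted mu (\<lambda>x. f x - f' x)) \<le> (real (Suc d) + \<bar>mu\<bar>) * L.nrm (\<lambda>x. f x - f' x)"
      by (rule L.shifted_bounded[OF L.diff_mem[OF fL f'(1)]])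
    also have "\<dots> \<le> (real (Suc d) + \<bar>mu\<bar>) * (e * L.nrm f)"
      using f'(3) by (intro mult_left_mono) auto
    finally show ?thesis using f(2) by simp
  qed
  also have "\<dots> = e * (1 + real (Suc d) + \<bar>mu\<bar>) * L.nrm f" by (simp add: algebra_simps)
  finally show ?thesis using that f(1) pos f' by blast
qed

lemma positive_spectrum_test_form:
  assumes mu: "mu \<in> spec_Z X d" "mu > 0" and c: "c \<in> cells X d" and conn: "codim1_connected X d" and eta: "eta > 0"
  obtains f m where "f \<in> form_space X d w" "supported X d m c f"
    "form_ip X d w (upper_lap X d (upper_lap X d f)) (upper_lap X d f)
      < (mu + eta) * form_ip X d w (upper_lap X d f) (upper_lap X d f)"
proof -
  let ?T = "upper_lap X d"
  define M where "M = real (Suc d)"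
  have M: "M > 0" by (simp add: M_def)
  \<comment> \<open>The error factor \<open>1 + M + mu\<close> of
    \<open>approximate_eigenform\<close>, plus another \<open>mu\<close> for the loss
    \<open>e * N\<close> in the norm of \<open>f\<close>, which gets multiplied by
    \<open>mu\<close>.\<close>
  define Q where "Q = 1 + M + 2 * mu"
  have Q: "Q > 0" using M mu by (simp add: Q_def)
  \<comment> \<open>The first bound keeps the norm of \<open>?T f\<close> above
    \<open>mu / 2 * N\<close>; the second makes its eigenform defect, at most
    \<open>M * (e * Q * N)\<close>, no larger than \<open>eta / 2\<close> times that norm.\<close>
  define e where "e = min (mu / (2 * Q)) (eta * mu / (4 * M * Q))"
  have e: "e > 0" "e * Q \<le> mu / 2" "M * (e * Q) \<le> eta * mu / 4"
  proof -
    show "e > 0" using M Q mu eta by (simp add: e_def)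
    have "e \<le> mu / (2 * Q)" by (simp add: e_def)
    then show "e * Q \<le> mu / 2" using Q by (simp add: field_simps)
    have "e \<le> eta * mu / (4 * M * Q)" by (simp add: e_def)
    then show "M * (e * Q) \<le> eta * mu / 4" using Q M by (simp add: field_simps)
  qed
  obtain f0 f m where f0: "f0 \<in> Zspace X d" "L.nrm f0 > 0" and f: "f \<in> form_space X d w" "supported X d m c f"
    and close: "L.nrm (\<lambda>x. f0 x - f x) < e * L.nrm f0"
    and approx: "L.nrm (L.shifted mu f) \<le> e * (1 + M + \<bar>mu\<bar>) * L.nrm f0"
    using approximate_eigenform[OF mu(1) c conn e(1)] unfolding M_def by blast
  define N where "N = L.nrm f0"
  have N: "N > 0" using f0 by (simp add: N_def)
  have f0L: "f0 \<in> form_space X d w" using f0(1) Zspace_subset by blast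
  have fN: "L.nrm f \<ge> (1 - e) * N"
    using L.seminorm_triangle_reverse[OF f0L L.diff_mem[OF f0L f(1)], of 1] close
    by (simp add: N_def algebra_simps)
  have sh: "L.nrm (L.shifted mu f) \<le> e * (1 + M + mu) * N" using approx mu by (simp add: N_def)
  have Tf: "?T f \<in> form_space X d w" using upper_lap_mem[OF f(1)] .
  have z: "L.nrm (?T f) \<ge> mu / 2 * N"
  proof -
    have "L.nrm (\<lambda>x. mu * f x) = mu * L.nrm f"
      using L.form_diff_self[OF L.zero_mem f(1), of "- mu"] mu
        L.form_lin[OF L.zero_mem L.zero_mem L.zero_mem, of 0 0] L.form_lin[OF L.zero_mem L.zero_mem f(1), of 0 0]
      by (simp add: real_sqrt_mult)
    then have "mu * L.nrm f - L.nrm (L.shifted mu f) \<le> L.nrm (?T f)"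
      using L.seminorm_triangle[OF Tf L.shifted_mem[OF f(1), of mu], of 1] by (simp add: L.shifted_def)
    moreover have "mu * L.nrm f \<ge> mu * ((1 - e) * N)" using fN mu by (intro mult_left_mono) auto
    moreover have "mu * ((1 - e) * N) - e * (1 + M + mu) * N = (mu - e * Q) * N"
      by (simp add: Q_def algebra_simps)
    moreover have "(mu - e * Q) * N \<ge> mu / 2 * N" using e(2) N by (intro mult_right_mono) auto
    ultimately show ?thesis using sh by linarith
  qed
  have zpos: "L.nrm (?T f) > 0"
    using z mu N by (smt (verit) divide_pos_pos mult_pos_pos)
  \<comment> \<open>The Laplacian commutes with its shift, so \<open>?T f\<close> is an approximate
    eigenform as well.\<close>
  have "L.shifted mu (?T f) = ?T (L.shifted mu f)"
    using upper_lap_lin[of X d 1 "?T f" "- mu" f] by (simp add: L.shifted_def)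
  then have "L.nrm (L.shifted mu (?T f)) \<le> M * L.nrm (L.shifted mu f)"
    using L.op_bounded[OF L.shifted_mem[OF f(1)]] by (simp add: M_def)
  also have "\<dots> \<le> M * (e * Q * N)"
  proof -
    have "e * (1 + M + mu) * N \<le> e * Q * N" using e(1) N mu by (simp add: Q_def)
    then show ?thesis using sh M by (intro mult_left_mono) auto
  qed
  also have "\<dots> \<le> eta * mu / 4 * N" using mult_right_mono[OF e(3), of N] N by (simp add: mult.assoc)
  also have "\<dots> \<le> eta / 2 * L.nrm (?T f)"
    using mult_left_mono[OF z, of "eta / 2"] eta by (simp add: mult.assoc)
  finally have small: "L.nrm (L.shifted mu (?T f)) \<le> eta / 2 * L.nrm (?T f)" .
  have split: "form_ip X d w (?T (?T f)) (?T f)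
      = mu * form_ip X d w (?T f) (?T f) + form_ip X d w (L.shifted mu (?T f)) (?T f)"
    using L.form_diff_left[OF upper_lap_mem[OF Tf] Tf Tf, of mu] by (simp add: L.shifted_def)
  have "form_ip X d w (L.shifted mu (?T f)) (?T f) \<le> L.nrm (L.shifted mu (?T f)) * L.nrm (?T f)"
    using L.cauchy_schwarz_sqrt[OF L.shifted_mem[OF Tf] Tf, of mu] by linarith
  also have "\<dots> \<le> eta / 2 * L.nrm (?T f) * L.nrm (?T f)"
    by (rule mult_right_mono[OF small less_imp_le[OF zpos]])
  also have "\<dots> = eta / 2 * form_ip X d w (?T f) (?T f)"
    using L.form_nonneg[OF Tf] by simp
  also have "\<dots> < eta * form_ip X d w (?T f) (?T f)"
    using zpos eta by simp
  finally have "form_ip X d w (?T (?T f)) (?T f) < (mu + eta) * form_ip X d w (?T f) (?T f)"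
    unfolding split distrib_right by simp
  then show ?thesis using that f by blast
qed

end

text \<open>The radius \<open>m + 3\<close> arises because the transplanted form is already a
  Laplacian, supported within \<open>m + 1\<close>, and \<open>upper_lap_pull\<close> asks for two
  further steps.\<close>

lemma spectral_gap_transplant:
  assumes YC: "upper_complex Y d" and finY: "finite Y" and XC: "upper_complex X d" and iso: "ball_iso Y X d R b c phi"
    and f: "f \<in> form_space X d (\<lambda>s. 1 / real (deg X s))" "supported X d m c f" and R: "m + 3 \<le> R"
    and test: "form_ip X d (\<lambda>s. 1 / real (deg X s)) (upper_lap X d (upper_lap X d f)) (upper_lap X d f)
      < a * form_ip X d (\<lambda>s. 1 / real (deg X s)) (upper_lap X d f) (upper_lap X d f)"
  shows "spectral_gap Y d \<le> a"
proof -
  interpret X: upper_complex X d by (rule XC)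
  interpret Y: upper_complex Y d by (rule YC)
  interpret I: ball_iso Y X d R b c phi by (rule iso)
  let ?T = "upper_lap X d"
  have form: "is_form X d f" "is_form X d (?T f)" "is_form X d (?T (?T f))"
    using f(1) X.upper_lap_mem by (auto simp: form_space_def)
  have supp: "supported X d (Suc m) c (?T f)" "supported X d (Suc (Suc m)) c (?T (?T f))"
    using supported_upper_lap[OF X.X] f(2) by blast+
  define z where "z = I.pull (?T f)"
  have Tz: "upper_lap Y d z = I.pull (?T (?T f))"
    unfolding z_def using I.upper_lap_pull[OF form(2) supp(1)] R by simp
  have "z = upper_lap Y d (I.pull f)"
    unfolding z_def using I.upper_lap_pull[OF form(1) f(2)] R by simp
  moreover have "I.pull f \<in> form_space Y d Y.w"
    using I.is_form_pull[OF form(1)] finY by (simp add: form_space_def wsq_summable_def cells_def)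
  ultimately have "z \<in> Zspace Y d" using Y.upper_lap_in_Zspace by simp
  from Y.spectral_gap_le_rayleigh[OF this]
  have "spectral_gap Y d * form_ip X d X.w (?T f) (?T f) \<le> form_ip X d X.w (?T (?T f)) (?T f)"
    unfolding Tz unfolding z_def
    using I.pull_isometry[OF form(2) is_form_alternating[OF form(2)] supp(1)]
      I.pull_isometry[OF form(3) is_form_alternating[OF form(2)] supp(2)] R by simp
  then have less: "spectral_gap Y d * form_ip X d X.w (?T f) (?T f) < a * form_ip X d X.w (?T f) (?T f)"
    using test by linarith
  \<comment> \<open>Nonnegativity suffices for cancelling, because the strict inequality
    \<open>less\<close> excludes the value 0.\<close>
  have "0 \<le> form_ip X d X.w (?T f) (?T f)"
    using X.L.form_nonneg[OF X.upper_lap_mem[OF f(1)]] .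
  with less show ?thesis using mult_less_cancel_right_disj by (smt (verit))
qed

text \<open>With \<open>D\<close> the norm of the correction and
  \<open>A = sqrt (K * (Suc k * K') / lam)\<close>, the pairing gives
  \<open>D * D \<le> e * N * A * D\<close>. The corrected form then has norm at least
  \<open>N / 2\<close>, and the resulting \<open>N\<^sup>2 / 4\<close> matches the
  \<open>a / 4\<close> in the premise \<open>small\<close>.\<close>

lemma spectral_gap_harmonic:
  assumes YC: "finite_complex Y k" and XC: "upper_complex X (Suc k)" and iso: "ball_iso Y X (Suc k) R b c phi"
    and K: "\<And>s. s \<in> cells X (Suc k) \<Longrightarrow> card (up X s) \<le> K"
    and low: "\<And>s. s \<in> cells X k \<Longrightarrow> finite (up X s) \<and> card (up X s) \<le> K'"
    and gap: "lam > 0" "lam \<le> lambda_low Y (Suc k)"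
    and f0: "f0 \<in> Zspace X (Suc k)"
    and f: "f \<in> form_space X (Suc k) (\<lambda>s. 1 / real (deg X s))" "supported X (Suc k) m c f" and R: "m + 2 \<le> R"
    and N: "N = sqrt (form_ip X (Suc k) (\<lambda>s. 1 / real (deg X s)) f0 f0)" "N > 0"
    and close: "sqrt (form_ip X (Suc k) (\<lambda>s. 1 / real (deg X s)) (\<lambda>x. f0 x - f x) (\<lambda>x. f0 x - f x)) \<le> e * N"
    and small: "form_ip X (Suc k) (\<lambda>s. 1 / real (deg X s)) (upper_lap X (Suc k) f) f \<le> a / 4 * N\<^sup>2"
    and e: "e > 0" "e * (1 + sqrt (real K * (real (Suc k) * real K') / lam)) \<le> 1 / 2" and a: "a > 0"
  shows "spectral_gap Y (Suc k) \<le> a"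
proof -
  let ?d = "Suc k"
  interpret X: upper_complex X ?d by (rule XC)
  interpret Y: finite_complex Y k by (rule YC)
  interpret I: ball_iso Y X ?d R b c phi by (rule iso)
  have f0L: "f0 \<in> form_space X ?d X.w" using f0 X.Zspace_subset by blast
  have form: "is_form X ?d f" "is_form X ?d (upper_lap X ?d f)"
    using f(1) X.upper_lap_mem by (auto simp: form_space_def)
  have pf: "I.pull f \<in> form_space Y ?d Y.w" using Y.form_in_space[OF I.is_form_pull[OF form(1)]] .
  obtain g where g: "is_form Y k g" and z: "(\<lambda>x. I.pull f x - delta1 Y ?d g x) \<in> Zspace Y ?d"
    and coercive: "lam * form_ip Y k (\<lambda>_. 1) g g \<le> form_ip Y ?d Y.w (delta1 Y ?d g) (delta1 Y ?d g)"
    using Y.Z_projection[OF gap pf] .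
  let ?z = "\<lambda>x. I.pull f x - delta1 Y ?d g x"
  have dg: "delta1 Y ?d g \<in> form_space Y ?d Y.w" using Y.form_in_space[OF is_form_delta1[OF g]] .
  have zL: "?z \<in> form_space Y ?d Y.w" using z Y.Zspace_subset by blast
  have "g \<in> L2u Y (?d - 1)"
    using Y.finite_cells g by (simp add: L2u_def)
  then have "delta1 Y ?d g \<in> Bspace Y ?d"
    using dg by (auto simp: Bspace_def Y.L2w_eq)
  then have orth: "form_ip Y ?d Y.w ?z (delta1 Y ?d g) = 0"
    using z by (simp add: Zspace_def Y.inner_w_eq)
  \<comment> \<open>The corrected form is orthogonal to the correction, so the correction has the
    same product with the transplant as with itself.\<close>
  have nd: "form_ip Y ?d Y.w (delta1 Y ?d g) (delta1 Y ?d g) = form_ip Y ?d Y.w (I.pull f) (delta1 Y ?d g)"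
    using Y.L.form_diff_left[OF pf dg dg, of 1] orth by simp
  define g' where "g' = I.push k g"
  have g': "g' \<in> form_space X k (\<lambda>_. 1)" "form_ip X k (\<lambda>_. 1) g' g' \<le> form_ip Y k (\<lambda>_. 1) g g"
    unfolding g'_def using I.push_norm_le[OF Y.finite_X is_form_alternating[OF g]] by auto
  note dg' = X.delta1_bound[OF refl low K g'(1)]
  have "g' \<in> L2u X (?d - 1)" using g'(1) by (simp add: L2u_def form_space_def wsq_summable_def)
  then have "delta1 X ?d g' \<in> Bspace X ?d" using dg'(1) by (auto simp: Bspace_def X.L2w_eq)
  then have orth0: "form_ip X ?d X.w f0 (delta1 X ?d g') = 0"
    using f0 by (simp add: Zspace_def X.inner_w_eq)
  define D where "D = sqrt (form_ip Y ?d Y.w (delta1 Y ?d g) (delta1 Y ?d g))"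
  define A where "A = sqrt (real K * (real ?d * real K') / lam)"
  have D0: "D \<ge> 0" using Y.L.form_nonneg[OF dg] by (simp add: D_def)
  have A0: "A \<ge> 0" using gap by (simp add: A_def)
  have D2: "D\<^sup>2 = form_ip Y ?d Y.w (delta1 Y ?d g) (delta1 Y ?d g)"
    using Y.L.form_nonneg[OF dg] by (simp add: D_def)
  have "D\<^sup>2 = form_ip X ?d X.w f (delta1 X ?d g')"
    unfolding D2 nd g'_def using I.pull_delta1_push[OF form(1) g f(2) _ refl] R by simp
  \<comment> \<open>\<open>f0\<close> is orthogonal to the coboundary, so only the small difference
    \<open>f0 - f\<close> contributes.\<close>
  also have "\<dots> = - form_ip X ?d X.w (\<lambda>x. f0 x - f x) (delta1 X ?d g')"
    using X.L.form_diff_left[OF f0L f(1) dg'(1), of 1] orth0 by simp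
  also have "\<dots> \<le> X.L.nrm (\<lambda>x. f0 x - f x) * X.L.nrm (delta1 X ?d g')"
    using X.L.cauchy_schwarz_sqrt[OF X.L.diff_mem[OF f0L f(1)] dg'(1)] by linarith
  also have "\<dots> \<le> (e * N) * (A * D)"
  proof (rule mult_mono[OF close])
    \<comment> \<open>\<open>K * (Suc k * K')\<close> bounds \<open>delta1\<close> on
      \<open>X\<close>; that pushing does not increase norms, together with coercivity on
      \<open>Y\<close>, supplies \<open>D\<^sup>2 / lam\<close>.\<close>
    have "form_ip X ?d X.w (delta1 X ?d g') (delta1 X ?d g') \<le> real K * (real ?d * (real K' * form_ip X k (\<lambda>_. 1) g' g'))"
      using dg'(2) .
    also have "\<dots> \<le> real K * (real ?d * (real K' * (D\<^sup>2 / lam)))"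
    proof -
      have "form_ip X k (\<lambda>_. 1) g' g' \<le> D\<^sup>2 / lam"
        using g'(2) coercive gap(1) unfolding D2 by (simp add: field_simps) (smt (verit) mult_left_mono)
      then show ?thesis by (intro mult_left_mono) auto
    qed
    also have "\<dots> = (real K * (real ?d * real K') / lam) * D\<^sup>2" by simp
    finally show "X.L.nrm (delta1 X ?d g') \<le> A * D"
      unfolding A_def using D0 real_sqrt_le_mono[of _ "(real K * (real ?d * real K') / lam) * D\<^sup>2"]
      by (simp only: real_sqrt_mult real_sqrt_abs abs_of_nonneg)
  qed (use N e D0 A0 X.L.form_nonneg[OF dg'(1)] in auto)
  finally have "D * D \<le> (e * N * A) * D" by (simp add: power2_eq_square mult.assoc)
  then have D: "D \<le> e * N * A"
    using D0 e N A0 by (cases "D = 0") auto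
  have fN: "X.L.nrm f \<ge> N - e * N"
    using X.L.seminorm_triangle_reverse[OF f0L X.L.diff_mem[OF f0L f(1)], of 1] close by (simp add: N)
  have pull_norm: "form_ip Y ?d Y.w (I.pull f) (I.pull f) = form_ip X ?d X.w f f"
    using I.pull_isometry[OF form(1) is_form_alternating[OF form(1)] f(2)] R by simp
  have "Y.L.nrm ?z \<ge> X.L.nrm f - D"
    using Y.L.seminorm_triangle_reverse[OF pf dg, of 1] by (simp add: pull_norm D_def)
  \<comment> \<open>The loss \<open>e * N\<close> is due to the truncation, \<open>e * N * A\<close>
    to the correction.\<close>
  then have "Y.L.nrm ?z \<ge> N - (e * (1 + A)) * N" using D fN by (simp add: algebra_simps)
  moreover have "(e * (1 + A)) * N \<le> 1 / 2 * N" using e(2) N by (intro mult_right_mono) (auto simp: A_def)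
  ultimately have "Y.L.nrm ?z \<ge> N / 2" by linarith
  then have zN: "form_ip Y ?d Y.w ?z ?z \<ge> N\<^sup>2 / 4"
    using power_mono[of "N / 2" "Y.L.nrm ?z" 2] N Y.L.form_nonneg[OF zL] by (simp add: power_divide)
  have Tz: "upper_lap Y ?d ?z = upper_lap Y ?d (I.pull f)"
  proof -
    have "upper_lap Y ?d (delta1 Y ?d g) = (\<lambda>_. 0)"
      by (simp add: upper_lap_def Y.delta2_delta1 bd_def fun_eq_iff)
    then show ?thesis using upper_lap_lin[of Y ?d 1 "I.pull f" "- 1" "delta1 Y ?d g"] by simp
  qed
  \<comment> \<open>\<open>Tz\<close> removes the correction from one argument at a time; symmetry
    moves the Laplacian to the other argument in between.\<close>
  have "form_ip Y ?d Y.w (upper_lap Y ?d ?z) ?z = form_ip Y ?d Y.w (I.pull f) (upper_lap Y ?d ?z)"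
    unfolding Tz by (rule Y.upper_lap_sym[OF pf zL, unfolded Tz])
  also have "\<dots> = form_ip Y ?d Y.w (I.pull (upper_lap X ?d f)) (I.pull f)"
    unfolding Tz using I.upper_lap_pull[OF form(1) f(2)] R by (simp add: wip_sym)
  also have "\<dots> = form_ip X ?d X.w (upper_lap X ?d f) f"
    using I.pull_isometry[OF form(2) is_form_alternating[OF form(1)] supported_upper_lap[OF X.X f(2)]] R by simp
  finally have "form_ip Y ?d Y.w (upper_lap Y ?d ?z) ?z \<le> a / 4 * N\<^sup>2" using small by simp
  also have "\<dots> \<le> a * form_ip Y ?d Y.w ?z ?z" using mult_left_mono[OF zN, of a] a by simp
  finally have "spectral_gap Y ?d * form_ip Y ?d Y.w ?z ?z \<le> a * form_ip Y ?d Y.w ?z ?z"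
    using Y.spectral_gap_le_rayleigh[OF z] by linarith
  moreover have "form_ip Y ?d Y.w ?z ?z > 0" using zN N by (smt (verit) divide_pos_pos zero_less_power)
  ultimately show ?thesis by simp
qed

lemma eventually_le_imp_liminf_le:
  fixes x :: "nat \<Rightarrow> real"
  assumes "\<And>\<eta>. \<eta> > 0 \<Longrightarrow> \<forall>\<^sub>F n in sequentially. x n \<le> a + \<eta>"
  shows "liminf (\<lambda>n. ereal (x n)) \<le> ereal a"
proof (rule ereal_le_epsilon2)
  fix \<eta> :: real assume "\<eta> > 0"
  have "liminf (\<lambda>n. ereal (x n)) \<le> limsup (\<lambda>n. ereal (x n))"
    by (rule Liminf_le_Limsup) simp
  also have "\<dots> \<le> ereal (a + \<eta>)"
    using assms[OF \<open>\<eta> > 0\<close>] by (intro Limsup_bounded) simp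
  finally show "liminf (\<lambda>n. ereal (x n)) \<le> ereal a + ereal \<eta>" by simp
qed

theorem mainTheorem10:
  fixes d :: nat and Xs :: "nat \<Rightarrow> 'a set set" and X :: "'b set set"
  assumes "d \<ge> 2"
    and "\<And>n. dim_complex (Xs n) d \<and> finite (Xs n) \<and> uniform (Xs n) d
               \<and> codim1_connected (Xs n) d"
    and "dim_complex X d" and "countable X" and "uniform X d" and "codim1_connected X d"
    and "\<exists>K. (\<forall>n. deg_bounded (Xs n) d K) \<and> deg_bounded X d K"
    and "converges_to Xs X d"
    and "0 \<notin> spec_Z X d
         \<or> (0 \<in> spec_Z X d \<and> 0 islimpt spec_Z X d)
         \<or> ((\<exists>K. \<forall>n. deg_bounded (Xs n) (d - 1) K)
             \<and> (\<exists>c>0. \<forall>n. c \<le> lambda_low (Xs n) d))"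
  shows "liminf (\<lambda>n. ereal (spectral_gap (Xs n) d)) \<le> ereal (spectral_gap X d)"
proof -
  let ?w = "\<lambda>s. 1 / real (deg X s)"
  obtain K where K: "\<And>n. deg_bounded (Xs n) d K" "deg_bounded X d K" using assms(7) by blast
  have XC: "upper_complex X d" using upper_complexI[OF assms(3,5) K(2)] .
  have YC: "upper_complex (Xs n) d" for n using upper_complexI assms(2) K(1) by blast
  have finY: "finite (Xs n)" for n using assms(2) by blast
  interpret upper_complex X d by (rule XC)
  obtain b c where b: "\<And>n. b n \<in> cells (Xs n) d" and c: "c \<in> cells X d"
    and conv: "\<And>R. \<exists>N. \<forall>n\<ge>N. \<exists>phi. simp_iso (ball (Xs n) d R (b n)) (ball X d R c) phi \<and> phi ` b n = c"
    using assms(8) unfolding converges_to_def by blast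
  have iso: "\<forall>\<^sub>F n in sequentially. \<exists>phi. ball_iso (Xs n) X d R (b n) c phi" for R
  proof -
    obtain N where N: "\<And>n. n \<ge> N \<Longrightarrow> \<exists>phi. simp_iso (ball (Xs n) d R (b n)) (ball X d R c) phi \<and> phi ` b n = c"
      using conv by blast
    have "\<exists>phi. ball_iso (Xs n) X d R (b n) c phi" if "n \<ge> N" for n
      using N[OF that] b c X upper_complex.X[OF YC] by (auto intro: ball_iso.intro)
    then show ?thesis unfolding eventually_sequentially by blast
  qed
  have nonneg: "mu \<ge> 0" if "mu \<in> spec_Z X d" for mu
    using that Z.spec_nonneg unfolding spec_Z_eq by blast
  have positive: "\<forall>\<^sub>F n in sequentially. spectral_gap (Xs n) d \<le> mu + \<eta>"
    if mu: "mu \<in> spec_Z X d" "mu > 0" and \<eta>: "\<eta> > 0" for mu \<eta>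
  proof -
    obtain f m where f: "f \<in> form_space X d ?w" "supported X d m c f"
      "form_ip X d ?w (upper_lap X d (upper_lap X d f)) (upper_lap X d f)
        < (mu + \<eta>) * form_ip X d ?w (upper_lap X d f) (upper_lap X d f)"
      using positive_spectrum_test_form[OF mu c assms(6) \<eta>] by blast
    from iso[of "m + 3"] show ?thesis
    proof (rule eventually_mono)
      fix n assume "\<exists>phi. ball_iso (Xs n) X d (m + 3) (b n) c phi"
      then show "spectral_gap (Xs n) d \<le> mu + \<eta>"
        using spectral_gap_transplant[OF YC finY XC _ f(1,2) le_refl f(3)] by blast
    qed
  qed
  have zero: "\<forall>\<^sub>F n in sequentially. spectral_gap (Xs n) d \<le> 0 + \<eta>"
    if mu: "0 \<in> spec_Z X d" and \<eta>: "\<eta> > 0" for \<eta>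
    using assms(9)
  proof (elim disjE)
    assume "0 \<notin> spec_Z X d"
    then show ?thesis using mu by simp
  next
    assume "0 \<in> spec_Z X d \<and> 0 islimpt spec_Z X d"
    \<comment> \<open>\<open>\<eta>\<close> is split between the distance of \<open>mu'\<close> from
      0 and the accuracy asked of \<open>positive\<close>.\<close>
    then obtain mu' where mu': "mu' \<in> spec_Z X d" "mu' \<noteq> 0" "dist mu' 0 < \<eta> / 2"
      unfolding islimpt_approachable using \<eta> by (metis half_gt_zero)
    then have pos: "mu' > 0" "mu' + \<eta> / 2 \<le> 0 + \<eta>" using nonneg[OF mu'(1)] by auto
    show ?thesis
      by (rule eventually_mono[OF positive[OF mu'(1) pos(1), of "\<eta> / 2"]]) (use \<eta> pos(2) in auto)
  next
    assume low: "(\<exists>K. \<forall>n. deg_bounded (Xs n) (d - 1) K) \<and> (\<exists>c>0. \<forall>n. c \<le> lambda_low (Xs n) d)"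
    define k where "k = d - 1"
    have d: "d = Suc k" using assms(1) by (simp add: k_def)
    obtain L lam where L: "\<And>n. deg_bounded (Xs n) k L" and lam: "lam > 0" "\<And>n. lam \<le> lambda_low (Xs n) d"
      using low unfolding k_def by blast
    have upY: "finite (up (Xs n) s) \<and> card (up (Xs n) s) \<le> L" if "s \<in> cells (Xs n) k" for n s
      using deg_bounded_up[OF upper_complex.X[OF YC] L that] .
    \<comment> \<open>Finitely many vertices above \<open>u\<close> give cells in one ball, which is
      isomorphic to a ball in some \<open>Xs n\<close>. Finiteness of \<open>up X u\<close> results
      from the common bound on the sizes of its finite subsets.\<close>
    have upX: "finite (up X u) \<and> card (up X u) \<le> L" if u: "u \<in> cells X k" for u
    proof (rule finite_if_finite_subsets_card_bdd)
      fix F assume F: "F \<subseteq> up X u" "finite F"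
      have cell: "insert v u \<in> cells X d" if "v \<in> F" for v
        using that F u cells_finite[OF X u] by (auto simp: up_def cells_def d)
      have "\<exists>R. dist_le X d R c s" if "s \<in> (\<lambda>v. insert v u) ` F" for s
        using connected_dist[OF X assms(6) c, of s] that cell by blast
      then obtain R where R: "\<And>v. v \<in> F \<Longrightarrow> dist_le X d R c (insert v u)"
        using dist_le_uniform[of "(\<lambda>v. insert v u) ` F" X d c] F(2) by auto
      obtain n phi where "ball_iso (Xs n) X d R (b n) c phi"
        using eventually_happens[OF iso[of R]] by auto
      then interpret I: ball_iso "Xs n" X d R "b n" c phi .
      have "insert v u \<in> ball X d R c" if "v \<in> F" for v
        using R[OF that] cell[OF that] ball_cells[OF X, of "insert v u" d R c] by (simp add: cells_def)
      then show "card F \<le> L" by (rule I.up_card_le[OF F(2,1) _ upY u])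
    qed
    have KX: "card (up X s) \<le> K" if "s \<in> cells X d" for s
      using deg_bounded_up[OF X K(2) that] by simp
    have finite_YC: "finite_complex (Xs n) k" for n
      using YC[of n] finY[of n] by (simp add: finite_complex_def finite_complex_axioms_def d)
    define A where "A = sqrt (real K * (real (Suc k) * real L) / lam)"
    have A0: "A \<ge> 0" using lam by (simp add: A_def)
    define M where "M = 1 + real (Suc d)"
    have M: "M > 0" by (simp add: M_def)
    \<comment> \<open>The first bound is a premise of \<open>spectral_gap_harmonic\<close>; the
      second gives \<open>e * M * N * (2 * N) \<le> \<eta> / 4 * N\<^sup>2\<close> for the Rayleigh
      product, where \<open>2 * N\<close> bounds the norm of the truncated form.\<close>
    define e where "e = min (1 / (2 * (1 + A))) (\<eta> / (8 * M))"
    have "e > 0" using A0 \<eta> M by (simp add: e_def)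
    have eA: "e * (1 + A) \<le> 1 / 2"
    proof -
      have "e \<le> 1 / (2 * (1 + A))" by (simp add: e_def)
      then show ?thesis using A0 by (simp add: field_simps)
    qed
    have eM: "e * M * 2 \<le> \<eta> / 4"
    proof -
      have "e \<le> \<eta> / (8 * M)" by (simp add: e_def)
      then show ?thesis using M by (simp add: field_simps)
    qed
    have "0 \<le> e * A" using A0 \<open>e > 0\<close> by simp
    then have e1: "e \<le> 1" using eA unfolding distrib_left by linarith
    obtain f0 f m where f0: "f0 \<in> Zspace X d" "L.nrm f0 > 0" and f: "f \<in> form_space X d ?w" "supported X d m c f"
      and close: "L.nrm (\<lambda>x. f0 x - f x) < e * L.nrm f0"
      and approx: "L.nrm (L.shifted 0 f) \<le> e * (1 + real (Suc d) + \<bar>0\<bar>) * L.nrm f0"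
      using approximate_eigenform[OF mu c assms(6) \<open>e > 0\<close>] by blast
    define N where "N = L.nrm f0"
    have N: "N > 0" using f0 by (simp add: N_def)
    have f0L: "f0 \<in> form_space X d ?w" using f0(1) Zspace_subset by blast
    have lapf: "L.nrm (upper_lap X d f) \<le> e * M * N"
      using approx by (simp add: L.shifted_def M_def N_def)
    have normf: "L.nrm f \<le> 2 * N"
    proof -
      have "L.nrm f \<le> N + e * N"
        using L.seminorm_triangle[OF f0L L.diff_mem[OF f0L f(1)], of 1] close by (simp add: N_def)
      also have "\<dots> \<le> 2 * N" using e1 N by simp
      finally show ?thesis .
    qed
    have "form_ip X d ?w (upper_lap X d f) f \<le> L.nrm (upper_lap X d f) * L.nrm f"
      using L.cauchy_schwarz_sqrt[OF upper_lap_mem[OF f(1)] f(1)] by linarith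
    also have "\<dots> \<le> (e * M * N) * (2 * N)"
      using lapf normf \<open>e > 0\<close> M N L.form_nonneg[OF f(1)] by (intro mult_mono) auto
    also have "\<dots> = (e * M * 2) * N\<^sup>2" by (simp add: power2_eq_square)
    also have "\<dots> \<le> \<eta> / 4 * N\<^sup>2" using eM by (intro mult_right_mono) auto
    finally have small: "form_ip X d ?w (upper_lap X d f) f \<le> \<eta> / 4 * N\<^sup>2" .
    have "\<forall>\<^sub>F n in sequentially. spectral_gap (Xs n) d \<le> \<eta>"
      using iso[of "m + 2"]
    proof (rule eventually_mono)
      fix n assume "\<exists>phi. ball_iso (Xs n) X d (m + 2) (b n) c phi"
      then obtain phi where phi: "ball_iso (Xs n) X (Suc k) (m + 2) (b n) c phi" unfolding d by blast
      show "spectral_gap (Xs n) d \<le> \<eta>"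
        unfolding d
      proof (rule spectral_gap_harmonic[OF finite_YC XC[unfolded d] phi KX[unfolded d] upX lam(1) lam(2)[unfolded d]
            f0(1)[unfolded d] f[unfolded d] le_refl N_def[unfolded d] N])
        show "sqrt (form_ip X (Suc k) ?w (\<lambda>x. f0 x - f x) (\<lambda>x. f0 x - f x)) \<le> e * N"
          using close by (simp add: N_def d)
        show "form_ip X (Suc k) ?w (upper_lap X (Suc k) f) f \<le> \<eta> / 4 * N\<^sup>2"
          using small by (simp add: d)
        show "e * (1 + sqrt (real K * (real (Suc k) * real L) / lam)) \<le> 1 / 2"
          using eA unfolding A_def .
      qed (use \<open>e > 0\<close> \<eta> in auto)
    qed
    then show ?thesis by simp
  qed
  have below: "liminf (\<lambda>n. ereal (spectral_gap (Xs n) d)) \<le> ereal mu" if mu: "mu \<in> spec_Z X d" for mu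
  proof (rule eventually_le_imp_liminf_le)
    fix \<eta> :: real assume "\<eta> > 0"
    then show "\<forall>\<^sub>F n in sequentially. spectral_gap (Xs n) d \<le> mu + \<eta>"
      using positive[OF mu] zero mu nonneg[OF mu] by (cases "mu = 0") auto
  qed
  \<comment> \<open>A nonempty spectrum contains values arbitrarily close to its infimum, so the
    argument does not depend on the infimum being attained.\<close>
  have ne: "spec_Z X d \<noteq> {}"
    using spec_Z_nonempty assms(3) by (simp add: dim_complex_def)
  show ?thesis
  proof (rule ereal_le_epsilon2)
    fix \<eta> :: real assume "\<eta> > 0"
    then obtain mu where mu: "mu \<in> spec_Z X d" "mu < spectral_gap X d + \<eta>"
      using cInf_lessD[OF ne, of "spectral_gap X d + \<eta>"] by (auto simp: spectral_gap_def)
    then have "ereal mu \<le> ereal (spectral_gap X d) + ereal \<eta>" by simp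
    then show "liminf (\<lambda>n. ereal (spectral_gap (Xs n) d)) \<le> ereal (spectral_gap X d) + ereal \<eta>"
      using below[OF mu(1)] by (meson order_trans)
  qed
qed

end
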